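(* Let $\omega:\mathcal A\to\mathcal A^+$ be an admissible tile substitution in $\mathbb R^d$ with FPC which satisfies the non-periodic border condition. Then $\omega$ is partially recognizable: for every $\mathcal T\in X_{\mathcal A,\omega}$ which contains a tile of $\mathcal A_{\rm nonp}$ type there is a unique tiling $\mathcal T'\in X_{\mathcal A,\omega}$ such that $\omega(\mathcal T')=\mathcal T$.
   Context: A tile in $\mathbb R^d$ is a pair $T=(F,i)$ where $F=\operatorname{supp}(T)$ is a (nonempty) compact set that is the closure of its interior and $i$ is a label (type) from a finite set; $T+g=(F+g,i)$. A tiling is a set of tiles whose supports have union $\mathbb R^d$ and such that distinct tiles have supports with disjoint interiors. A patch is a finite set of tiles with pairwise disjoint interiors; $\operatorname{supp}(P)$ is the union of the supports of its tiles. $\mathcal A=\{A_1,\dots,A_N\}$ is a finite set of pairwise translationally inequivalent tiles (prototiles), each with $0\in\operatorname{int}(\operatorname{supp}(A_j))$; $\mathcal A^+$ is the set of patches all of whose tiles are translates of prototiles. Let $\varphi:\mathbb R^d\to\mathbb R^d$ be an expansive linear map (all eigenvalues have modulus $>1$). A tile substitution with expansion $\varphi$ is a map $\omega:\mathcal A\to\mathcal A^+$ with $\operatorname{supp}(\omega(A_j))=\varphi(\operatorname{supp}(A_j))$ for all $j$; it is extended by $\omega(x+A_j)=\varphi(x)+\omega(A_j)$ to translates of prototiles, and tile by tile to patches and tilings. A patch $P$ is legal if $P+x\subseteq\omega^n(A_j)$ for some $n\ge1$, $j$, $x\in\mathbb R^d$. $X_{\mathcal A,\omega}$ is the set of all tilings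 of $\mathbb R^d$ all of whose patches (finite subsets) are legal. $\omega$ is admissible if every prototile $A_j$ is a tile of some $\mathcal T\in X_{\mathcal A,\omega}$. FPC: for every $R>0$ there are, up to translation, finitely many patches of diameter less than $R$ occurring in tilings of $X_{\mathcal A,\omega}$. $X_{\mathcal A,\omega}$ carries the metric $\varrho(\mathcal T_1,\mathcal T_2)=\min\{2^{-1/2},\inf\{r\in(0,2^{-1/2}):\exists g,\ \|g\|\le r,\ \operatorname{supp}((\mathcal T_1-g)\cap\mathcal T_2)\supseteq B_{1/r}(0)\}\}$, and $\mathbb R^d$ acts continuously by translations $\mathcal T\mapsto\mathcal T-g$. A minimal component is a nonempty closed translation-invariant subset of $X_{\mathcal A,\omega}$ on which every orbit is dense. A minimal component is periodic if it contains a tiling $\mathcal T$ with $\mathcal T+v=\mathcal T$ for some $v\ne0$. $\mathcal A_{\rm per}$ is the set of prototiles which occur (up to translation) in tilings of periodic minimal components, and $\mathcal A_{\rm nonp}=\mathcal A\setminus\mathcal A_{\rm per}$. A tile is of $\mathcal A_{\rm nonp}$ type if it is a translate of an element of $\mathcal A_{\rm nonp}$. For a legal patch $P$, $P|_{\rm nonp}$ is the subpatch of all tiles of $P$ of $\mathcal A_{\rm nonp}$ type. The non-periodic border condition: for every $A\in\mathcal A_{\rm nonp}$, $\partial(\operatorname{supp}(\omega(A)))\subseteq\operatorname{supp}(\omega(A)|_{\rm nonp})$. *)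

theory Defs
  imports "HOL-Analysis.Analysis"
begin

subsection \<open>Tiles, tilings, patches\<close>

type_synonym ('d, 'l) tile = "(real ^ 'd) set \<times> 'l"

definition is_tile :: "('d::finite, 'l) tile \<Rightarrow> bool" where
  "is_tile t \<longleftrightarrow> fst t \<noteq> {} \<and> compact (fst t) \<and> closure (interior (fst t)) = fst t"

definition tile_shift :: "real ^ 'd \<Rightarrow> ('d::finite, 'l) tile \<Rightarrow> ('d, 'l) tile" where
  "tile_shift g t = ((\<lambda>y. y + g) ` fst t, snd t)"

definition shift :: "real ^ 'd \<Rightarrow> ('d::finite, 'l) tile set \<Rightarrow> ('d, 'l) tile set" where
  "shift g P = tile_shift g ` P"

definition supp :: "('d::finite, 'l) tile set \<Rightarrow> (real ^ 'd) set" where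
  "supp P = (\<Union>t\<in>P. fst t)"

definition disjoint_interiors :: "('d::finite, 'l) tile set \<Rightarrow> bool" where
  "disjoint_interiors P \<longleftrightarrow>
     (\<forall>s\<in>P. \<forall>t\<in>P. s \<noteq> t \<longrightarrow> interior (fst s) \<inter> interior (fst t) = {})"

definition is_tiling :: "('d::finite, 'l) tile set \<Rightarrow> bool" where
  "is_tiling T \<longleftrightarrow> (\<forall>t\<in>T. is_tile t) \<and> supp T = UNIV \<and> disjoint_interiors T"

definition is_patch :: "('d::finite, 'l) tile set \<Rightarrow> bool" where
  "is_patch P \<longleftrightarrow> finite P \<and> (\<forall>t\<in>P. is_tile t) \<and> disjoint_interiors P"

definition of_type :: "('d::finite, 'l) tile set \<Rightarrow> ('d, 'l) tile \<Rightarrow> bool" where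
  "of_type \<B> t \<longleftrightarrow> (\<exists>A\<in>\<B>. \<exists>x. t = tile_shift x A)"

definition prototile_set :: "('d::finite, 'l) tile set \<Rightarrow> bool" where
  "prototile_set \<A> \<longleftrightarrow> finite \<A> \<and> (\<forall>A\<in>\<A>. is_tile A \<and> 0 \<in> interior (fst A)) \<and>
     (\<forall>A\<in>\<A>. \<forall>B\<in>\<A>. A \<noteq> B \<longrightarrow> (\<nexists>x. B = tile_shift x A))"

text \<open>The set \<open>\<A>\<^sup>+\<close>.\<close>

definition patches_over :: "('d::finite, 'l) tile set \<Rightarrow> ('d, 'l) tile set set" where
  "patches_over \<A> = {P. is_patch P \<and> (\<forall>t\<in>P. of_type \<A> t)}"

subsection \<open>Tile substitutions\<close>

text \<open>Eigenvalues are the complex ones, i.e. those of the complexified map.\<close>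

definition complex_eigenvalue :: "(real ^ 'd::finite \<Rightarrow> real ^ 'd) \<Rightarrow> complex \<Rightarrow> bool" where
  "complex_eigenvalue \<phi> z \<longleftrightarrow>
     (\<exists>v :: complex ^ 'd. v \<noteq> 0 \<and> (\<chi> i j. complex_of_real (matrix \<phi> $ i $ j)) *v v = z *s v)"

definition expansive :: "(real ^ 'd::finite \<Rightarrow> real ^ 'd) \<Rightarrow> bool" where
  "expansive \<phi> \<longleftrightarrow> linear \<phi> \<and> (\<forall>z. complex_eigenvalue \<phi> z \<longrightarrow> norm z > 1)"

text \<open>Only the values of \<open>\<omega>\<close> on \<open>\<A>\<close> are relevant.\<close>

definition tile_substitution ::
  "('d::finite, 'l) tile set \<Rightarrow> (real ^ 'd \<Rightarrow> real ^ 'd) \<Rightarrow>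
   (('d, 'l) tile \<Rightarrow> ('d, 'l) tile set) \<Rightarrow> bool" where
  "tile_substitution \<A> \<phi> \<omega> \<longleftrightarrow> prototile_set \<A> \<and> expansive \<phi> \<and>
     (\<forall>A\<in>\<A>. \<omega> A \<in> patches_over \<A> \<and> supp (\<omega> A) = \<phi> ` fst A)"

text \<open>The extension \<open>\<omega>(x + A) = \<phi>(x) + \<omega>(A)\<close>, applied tile by tile to a set of
  translates of prototiles. The representation of a tile as \<open>x + A\<close> is unique for a
  prototile set.\<close>

definition subst_ext ::
  "('d::finite, 'l) tile set \<Rightarrow> (real ^ 'd \<Rightarrow> real ^ 'd) \<Rightarrow>
   (('d, 'l) tile \<Rightarrow> ('d, 'l) tile set) \<Rightarrow> ('d, 'l) tile set \<Rightarrow> ('d, 'l) tile set" where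
  "subst_ext \<A> \<phi> \<omega> P = \<Union>{shift (\<phi> x) (\<omega> A) | x A. A \<in> \<A> \<and> tile_shift x A \<in> P}"

definition legal ::
  "('d::finite, 'l) tile set \<Rightarrow> (real ^ 'd \<Rightarrow> real ^ 'd) \<Rightarrow>
   (('d, 'l) tile \<Rightarrow> ('d, 'l) tile set) \<Rightarrow> ('d, 'l) tile set \<Rightarrow> bool" where
  "legal \<A> \<phi> \<omega> P \<longleftrightarrow> is_patch P \<and>
     (\<exists>n\<ge>1. \<exists>A\<in>\<A>. \<exists>x. shift x P \<subseteq> (subst_ext \<A> \<phi> \<omega> ^^ n) {A})"

definition tiling_space ::
  "('d::finite, 'l) tile set \<Rightarrow> (real ^ 'd \<Rightarrow> real ^ 'd) \<Rightarrow>
   (('d, 'l) tile \<Rightarrow> ('d, 'l) tile set) \<Rightarrow> ('d, 'l) tile set set" where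
  "tiling_space \<A> \<phi> \<omega> =
     {T. is_tiling T \<and> (\<forall>P. P \<subseteq> T \<and> finite P \<longrightarrow> legal \<A> \<phi> \<omega> P)}"

definition admissible ::
  "('d::finite, 'l) tile set \<Rightarrow> (real ^ 'd \<Rightarrow> real ^ 'd) \<Rightarrow>
   (('d, 'l) tile \<Rightarrow> ('d, 'l) tile set) \<Rightarrow> bool" where
  "admissible \<A> \<phi> \<omega> \<longleftrightarrow> (\<forall>A\<in>\<A>. \<exists>T\<in>tiling_space \<A> \<phi> \<omega>. A \<in> T)"

definition FPC ::
  "('d::finite, 'l) tile set \<Rightarrow> (real ^ 'd \<Rightarrow> real ^ 'd) \<Rightarrow>
   (('d, 'l) tile \<Rightarrow> ('d, 'l) tile set) \<Rightarrow> bool" where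
  "FPC \<A> \<phi> \<omega> \<longleftrightarrow> (\<forall>R>0. \<exists>\<Q>. finite \<Q> \<and>
     (\<forall>T\<in>tiling_space \<A> \<phi> \<omega>. \<forall>P. P \<subseteq> T \<and> finite P \<and> diameter (supp P) < R \<longrightarrow>
        (\<exists>Q\<in>\<Q>. \<exists>x. P = shift x Q)))"

subsection \<open>The tiling metric and its topology\<close>

text \<open>The infimum of the empty set counts as infinity.\<close>

definition tiling_dist :: "('d::finite, 'l) tile set \<Rightarrow> ('d, 'l) tile set \<Rightarrow> real" where
  "tiling_dist T1 T2 =
     (let S = {r. 0 < r \<and> r < 2 powr (-1/2) \<and>
                  (\<exists>g. norm g \<le> r \<and> ball 0 (1/r) \<subseteq> supp (shift (- g) T1 \<inter> T2))}
      in if S = {} then 2 powr (-1/2) else min (2 powr (-1/2)) (Inf S))"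

text \<open>As written, \<open>tiling_dist\<close> is symmetric only up to a recentring of the ball by \<open>g\<close>, so
  the topology is generated directly from its balls and not through the library locale of
  metric spaces. Since \<open>norm g \<le> r\<close>, taking balls in the other argument gives the same
  topology.\<close>

definition tiling_open :: "('d::finite, 'l) tile set set \<Rightarrow> ('d, 'l) tile set set \<Rightarrow> bool" where
  "tiling_open X U \<longleftrightarrow> U \<subseteq> X \<and> (\<forall>T\<in>U. \<exists>\<epsilon>>0. \<forall>S\<in>X. tiling_dist T S < \<epsilon> \<longrightarrow> S \<in> U)"

lemma tiling_openD:
  assumes "tiling_open X U" and "T \<in> U"
  obtains \<epsilon> where "\<epsilon> > 0" "\<forall>S\<in>X. tiling_dist T S < \<epsilon> \<longrightarrow> S \<in> U"
  using assms unfolding tiling_open_def by meson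

lemma istopology_tiling_open: "istopology (tiling_open X)"
  unfolding istopology_def
proof (intro conjI allI impI)
  fix U V assume U: "tiling_open X U" and V: "tiling_open X V"
  show "tiling_open X (U \<inter> V)"
    unfolding tiling_open_def
  proof (intro conjI ballI)
    show "U \<inter> V \<subseteq> X" using U unfolding tiling_open_def by blast
    fix T assume T: "T \<in> U \<inter> V"
    obtain a where a: "a > 0" "\<forall>S\<in>X. tiling_dist T S < a \<longrightarrow> S \<in> U"
      by (rule tiling_openD[OF U IntD1[OF T]])
    obtain b where b: "b > 0" "\<forall>S\<in>X. tiling_dist T S < b \<longrightarrow> S \<in> V"
      by (rule tiling_openD[OF V IntD2[OF T]])
    have "min a b > 0 \<and> (\<forall>S\<in>X. tiling_dist T S < min a b \<longrightarrow> S \<in> U \<inter> V)"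
      using a b by simp
    then show "\<exists>\<epsilon>>0. \<forall>S\<in>X. tiling_dist T S < \<epsilon> \<longrightarrow> S \<in> U \<inter> V" by (rule exI)
  qed
next
  fix \<U> assume \<U>: "\<forall>U\<in>\<U>. tiling_open X U"
  show "tiling_open X (\<Union>\<U>)"
    unfolding tiling_open_def
  proof (intro conjI ballI)
    show "\<Union>\<U> \<subseteq> X" using \<U> unfolding tiling_open_def by (intro Union_least) simp
    fix T assume "T \<in> \<Union>\<U>"
    then obtain U where U: "U \<in> \<U>" "T \<in> U" by (rule UnionE)
    obtain e where e: "e > 0" "\<forall>S\<in>X. tiling_dist T S < e \<longrightarrow> S \<in> U"
      by (rule tiling_openD[OF bspec[OF \<U> U(1)] U(2)])
    have "e > 0 \<and> (\<forall>S\<in>X. tiling_dist T S < e \<longrightarrow> S \<in> \<Union>\<U>)"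
      using e U(1) by (intro conjI ballI impI UnionI[OF U(1)]) simp_all
    then show "\<exists>\<epsilon>>0. \<forall>S\<in>X. tiling_dist T S < \<epsilon> \<longrightarrow> S \<in> \<Union>\<U>" by (rule exI)
  qed
qed

definition tiling_topology :: "('d::finite, 'l) tile set set \<Rightarrow> ('d, 'l) tile set topology" where
  "tiling_topology X = topology (tiling_open X)"

lemma openin_tiling_topology: "openin (tiling_topology X) U \<longleftrightarrow> tiling_open X U"
  unfolding tiling_topology_def topology_inverse'[OF istopology_tiling_open] ..

lemma topspace_tiling_topology: "topspace (tiling_topology X) = X"
proof -
  have "tiling_open X X" unfolding tiling_open_def using zero_less_one by blast
  moreover have "U \<subseteq> X" if "tiling_open X U" for U
    using that unfolding tiling_open_def by (rule conjunct1)
  ultimately show ?thesis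
    unfolding topspace_def openin_tiling_topology by blast
qed

subsection \<open>Minimal components\<close>

definition minimal_component ::
  "('d::finite, 'l) tile set set \<Rightarrow> ('d, 'l) tile set set \<Rightarrow> bool" where
  "minimal_component X C \<longleftrightarrow> C \<noteq> {} \<and> closedin (tiling_topology X) C \<and>
     (\<forall>T\<in>C. \<forall>g. shift (- g) T \<in> C) \<and>
     (\<forall>T\<in>C. C \<subseteq> tiling_topology X closure_of (range (\<lambda>g. shift (- g) T)))"

definition periodic_component ::
  "('d::finite, 'l) tile set set \<Rightarrow> ('d, 'l) tile set set \<Rightarrow> bool" where
  "periodic_component X C \<longleftrightarrow> minimal_component X C \<and> (\<exists>T\<in>C. \<exists>v. v \<noteq> 0 \<and> shift v T = T)"

definition A_per ::
  "('d::finite, 'l) tile set \<Rightarrow> (real ^ 'd \<Rightarrow> real ^ 'd) \<Rightarrow>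
   (('d, 'l) tile \<Rightarrow> ('d, 'l) tile set) \<Rightarrow> ('d, 'l) tile set" where
  "A_per \<A> \<phi> \<omega> =
     {A \<in> \<A>. \<exists>C. periodic_component (tiling_space \<A> \<phi> \<omega>) C \<and> (\<exists>T\<in>C. \<exists>x. tile_shift x A \<in> T)}"

definition A_nonp ::
  "('d::finite, 'l) tile set \<Rightarrow> (real ^ 'd \<Rightarrow> real ^ 'd) \<Rightarrow>
   (('d, 'l) tile \<Rightarrow> ('d, 'l) tile set) \<Rightarrow> ('d, 'l) tile set" where
  "A_nonp \<A> \<phi> \<omega> = \<A> - A_per \<A> \<phi> \<omega>"

definition nonp_part ::
  "('d::finite, 'l) tile set \<Rightarrow> (real ^ 'd \<Rightarrow> real ^ 'd) \<Rightarrow>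
   (('d, 'l) tile \<Rightarrow> ('d, 'l) tile set) \<Rightarrow> ('d, 'l) tile set \<Rightarrow> ('d, 'l) tile set" where
  "nonp_part \<A> \<phi> \<omega> P = {t \<in> P. of_type (A_nonp \<A> \<phi> \<omega>) t}"

definition nonperiodic_border_condition ::
  "('d::finite, 'l) tile set \<Rightarrow> (real ^ 'd \<Rightarrow> real ^ 'd) \<Rightarrow>
   (('d, 'l) tile \<Rightarrow> ('d, 'l) tile set) \<Rightarrow> bool" where
  "nonperiodic_border_condition \<A> \<phi> \<omega> \<longleftrightarrow>
     (\<forall>A\<in>A_nonp \<A> \<phi> \<omega>. frontier (supp (\<omega> A)) \<subseteq> supp (nonp_part \<A> \<phi> \<omega> (\<omega> A)))"

definition partially_recognizable ::
  "('d::finite, 'l) tile set \<Rightarrow> (real ^ 'd \<Rightarrow> real ^ 'd) \<Rightarrow>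
   (('d, 'l) tile \<Rightarrow> ('d, 'l) tile set) \<Rightarrow> bool" where
  "partially_recognizable \<A> \<phi> \<omega> \<longleftrightarrow>
     (\<forall>T\<in>tiling_space \<A> \<phi> \<omega>. (\<exists>t\<in>T. of_type (A_nonp \<A> \<phi> \<omega>) t) \<longrightarrow>
        (\<exists>!T'. T' \<in> tiling_space \<A> \<phi> \<omega> \<and> subst_ext \<A> \<phi> \<omega> T' = T))"

end

theory Submission
  imports Defs "HOL-Computational_Algebra.Fundamental_Theorem_Algebra" "HOL-Library.Diagonal_Subsequence"
begin

text \<open>
  Existence of a desubstitution is a compactness argument based on FPC. For uniqueness,
  suppose first that \<open>\<omega>\<^sup>n(S) = \<omega>\<^sup>n(S')\<close> but \<open>S\<close> and \<open>S'\<close> differ at a nonperiodic tile. Desubstituting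
  both tilings \<open>m\<close> times gives overlapping tiles at level \<open>m\<close> whose relative offsets are, by
  pigeonhole over the finitely many local configurations, pairwise distinct and bounded; two
  nearby offsets differ by a small vector \<open>y\<close>, and then \<open>\<omega>\<^sup>N(R)\<close> is locally invariant under
  translation by \<open>\<phi>\<^sup>N(y)\<close> near the image of a frontier point of a nonperiodic tile. Rescaling, a
  patch \<open>\<omega>\<^sup>j(A)\<close> with \<open>A\<close> nonperiodic and \<open>j\<close> as large as we please has, after \<open>\<omega>\<^sup>k\<close>, the local
  period \<open>\<phi>\<^sup>k(z)\<close> with \<open>z\<close> bounded. By the border condition the frontier of \<open>\<phi>\<^sup>j(A)\<close> is lined
  with nonperiodic tiles; translating this frontier by multiples of \<open>z\<close> makes nonperiodic tiles
  relatively dense in \<open>\<omega>\<^sup>j(A)\<close> with a gap independent of \<open>j\<close>, so \<open>A\<close> has no periodic descendants.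
  But then a limit of the patches \<open>\<omega>\<^sup>j(A)\<close> yields a tiling with a period and without periodic
  tiles, whose hull contains a periodic minimal component: a contradiction. Finally, if \<open>S\<close> and \<open>S'\<close>
  share a nonperiodic tile at every level of desubstitution, the relative position of any two
  overlapping tiles takes only finitely many values over all levels, and again pigeonhole gives
  \<open>S = S'\<close>.
\<close>

subsection \<open>Expansive linear maps\<close>

text \<open>The obstacle is circularity: to pull a period of a substituted patch back to the patch
  itself would already be a form of recognizability. Periods are therefore asserted only after k
  further substitutions, and from them only such conclusions are drawn as survive going back,
  chiefly that an ancestor of a nonperiodic tile is nonperiodic. For the same reason the preimages
  of different levels are chosen independently; they are not nested, and only the finite number of
  local configurations relates them. The bound on z is a constant K \<ge> 1 with norm (\<phi> x)
  \<le> K * norm x: the small offset is expanded until its norm first reaches 1, which overshoots by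
  at most that factor. The levels along which supertiles are compared are fixed for all prototiles
  at once, before j is used to find A, because A, k and z all depend on j. Minimality of components
  is handled through finite patches: a period, like an equality of tilings, is checked by placing
  two overlapping tiles into one tiling.\<close>

lemma contracting_recurrence_tendsto_0:
  fixes a b :: "nat \<Rightarrow> 'a::real_normed_vector" and q :: real
  assumes rec: "\<And>n. norm (a (Suc n)) \<le> q * norm (a n) + norm (b n)"
    and q: "0 \<le> q" "q < 1" and b: "b \<longlonglongrightarrow> 0"
  shows "a \<longlonglongrightarrow> 0"
proof (rule LIMSEQ_I)
  fix r :: real assume r: "r > 0"
  \<comment> \<open>With this e the number r / 2 is the fixed point of the map sending x to q * x +
    e, so errors below e never push the bound beyond r / 2 plus a geometric term.\<close>
  define e where "e = r / 2 * (1 - q)"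
  have e: "e > 0" using r q by (simp add: e_def)
  obtain N where N: "\<And>n. n \<ge> N \<Longrightarrow> norm (b n) < e"
    using LIMSEQ_D[OF b e] by auto
  have bd: "norm (a (N + k)) \<le> q ^ k * norm (a N) + r / 2" for k
  proof (induction k)
    case 0 then show ?case using r by simp
  next
    case (Suc k)
    have "norm (a (N + Suc k)) \<le> q * norm (a (N + k)) + norm (b (N + k))" using rec by simp
    also have "\<dots> \<le> q * (q ^ k * norm (a N) + r / 2) + e"
      using Suc q N[of "N + k"] by (intro add_mono mult_left_mono) auto
    also have "\<dots> = q ^ Suc k * norm (a N) + r / 2" by (simp add: e_def field_simps)
    finally show ?case .
  qed
  have "(\<lambda>k. q ^ k * norm (a N)) \<longlonglongrightarrow> 0"
    using LIMSEQ_realpow_zero[OF q] by (auto intro: tendsto_eq_intros)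
  from LIMSEQ_D[OF this, of "r / 2"] r obtain K
    where K: "\<And>k. k \<ge> K \<Longrightarrow> \<bar>q ^ k * norm (a N)\<bar> < r / 2" by auto
  have "norm (a n - 0) < r" if "n \<ge> N + K" for n
    using bd[of "n - N"] K[of "n - N"] that by fastforce
  then show "\<exists>no. \<forall>n\<ge>no. norm (a n - 0) < r" by blast
qed

section \<open>Vectors annihilated by a polynomial in a matrix\<close>

definition poly_apply ::
  "complex poly \<Rightarrow> (complex ^ 'd::finite \<Rightarrow> complex ^ 'd) \<Rightarrow> complex ^ 'd \<Rightarrow> complex ^ 'd" where
  "poly_apply p f v = (\<Sum>i\<le>degree p. coeff p i *s (f ^^ i) v)"

lemma poly_apply_eq:
  assumes "degree p \<le> n"
  shows "poly_apply p f v = (\<Sum>i\<le>n. coeff p i *s (f ^^ i) v)"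
  unfolding poly_apply_def
  by (rule sum.mono_neutral_left) (use assms in \<open>auto simp: coeff_eq_0 not_le\<close>)

lemma funpow_matrix_vector:
  fixes N :: "complex ^ 'd::finite ^ 'd"
  shows "((*v) N ^^ i) (u + v) = ((*v) N ^^ i) u + ((*v) N ^^ i) v"
    and "((*v) N ^^ i) (c *s v) = c *s ((*v) N ^^ i) v"
  by (induction i)
    (auto simp: matrix_vector_right_distrib vector_scalar_commute[symmetric])

text \<open>The factor N - c commutes with q(N), so it may be applied last or first. The first form
  yields an eigenvector equation for q(N) v, the second passes from v to N v - c v.\<close>

lemma poly_apply_root_mult:
  fixes N :: "complex ^ 'd::finite ^ 'd"
  shows "poly_apply ([:- c, 1:] * q) ((*v) N) v = N *v poly_apply q ((*v) N) v - c *s poly_apply q ((*v) N) v"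
    and "poly_apply ([:- c, 1:] * q) ((*v) N) v = poly_apply q ((*v) N) (N *v v - c *s v)"
proof -
  let ?f = "(*v) N" and ?n = "degree q"
  have "degree ([:- c, 1:] * q) \<le> Suc ?n"
    using degree_mult_le[of "[:- c, 1:]" q] by simp
  then have "poly_apply ([:- c, 1:] * q) ?f v
      = (\<Sum>i\<le>Suc ?n. coeff ([:- c, 1:] * q) i *s (?f ^^ i) v)"
    by (rule poly_apply_eq)
  also have "\<dots> = (\<Sum>i\<le>Suc ?n. coeff (pCons 0 q) i *s (?f ^^ i) v)
      - (\<Sum>i\<le>Suc ?n. c *s (coeff q i *s (?f ^^ i) v))"
    by (simp add: sum_subtractf[symmetric] algebra_simps vector_sub_rdistrib
        vector_smult_assoc vec_eq_iff del: sum.atMost_Suc)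
  also have "(\<Sum>i\<le>Suc ?n. coeff (pCons 0 q) i *s (?f ^^ i) v)
      = (\<Sum>i\<le>?n. coeff q i *s (?f ^^ Suc i) v)"
    by (subst sum.atMost_Suc_shift) simp
  also have "(\<Sum>i\<le>Suc ?n. c *s (coeff q i *s (?f ^^ i) v))
      = (\<Sum>i\<le>?n. c *s (coeff q i *s (?f ^^ i) v))"
    by (simp add: coeff_eq_0)
  finally have *: "poly_apply ([:- c, 1:] * q) ?f v
     = (\<Sum>i\<le>?n. coeff q i *s (?f ^^ Suc i) v) - (\<Sum>i\<le>?n. c *s (coeff q i *s (?f ^^ i) v))" .
  show "poly_apply ([:- c, 1:] * q) ?f v = N *v poly_apply q ?f v - c *s poly_apply q ?f v"
    unfolding *
    by (simp add: poly_apply_def vec.linear_sum[OF matrix_vector_mul_linear_gen] vec.scale_sum_right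
        vector_scalar_commute del: mult_pCons_left)
  show "poly_apply ([:- c, 1:] * q) ?f v = poly_apply q ?f (N *v v - c *s v)"
  proof -
    have "(?f ^^ i) (N *v v - c *s v) = (?f ^^ Suc i) v - c *s (?f ^^ i) v" for i
      using funpow_matrix_vector(1)[of i N "N *v v" "(- c) *s v"]
        funpow_matrix_vector(2)[of i N "- c" v]
      by (simp add: funpow_swap1 vector_sneg_minus1[symmetric])
    then show ?thesis
      unfolding *
      by (simp add: poly_apply_def sum_subtractf[symmetric] vector_ssub_ldistrib vector_smult_assoc mult.commute
        del: mult_pCons_left)
  qed
qed


lemma norm_vector_smult_complex:
  fixes x :: "complex ^ 'd::finite"
  shows "norm (c *s x) = norm c * norm x"
  by (simp add: norm_vec_def norm_mult L2_set_right_distrib)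

text \<open>Induction on the degree of p takes the place of the Jordan form. Split off a root c. If
  c has modulus below 1, then w = N v - c v is annihilated by a polynomial of smaller degree, and
  the orbit of v obeys a contracting recurrence driven by that of w. Otherwise q(N) v would be an
  eigenvector for c unless it is 0, so q already annihilates v.\<close>

lemma poly_annihilated_tendsto_0:
  fixes N :: "complex ^ 'd::finite ^ 'd"
  assumes eig: "\<And>c v. v \<noteq> 0 \<Longrightarrow> N *v v = c *s v \<Longrightarrow> norm c < 1"
    and "p \<noteq> 0" "poly_apply p ((*v) N) v = 0"
  shows "(\<lambda>n. ((*v) N ^^ n) v) \<longlonglongrightarrow> 0"
  using assms(2,3)
proof (induction "degree p" arbitrary: p v)
  case 0
  then obtain c where "p = [:c:]" by (metis degree_eq_zeroE)
  with 0 have "v = 0" by (auto simp: poly_apply_def)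
  moreover have "((*v) N ^^ n) 0 = 0" for n by (induction n) auto
  ultimately show ?case by simp
next
  case (Suc k)
  then have "\<not> constant (poly p)" by (simp add: constant_degree)
  then obtain c where "poly p c = 0" using fundamental_theorem_of_algebra by blast
  then obtain q where q: "p = [:- c, 1:] * q" by (metis dvdE poly_eq_0_iff_dvd)
  have q0: "q \<noteq> 0" using Suc.prems(1) q by auto
  have "degree p = 1 + degree q" unfolding q using q0 by (subst degree_mult_eq) auto
  then have dq: "k = degree q" using Suc.hyps(2) by simp
  define w where "w = N *v v - c *s v"
  show ?case
  proof (cases "norm c < 1")
    case True
    have "poly_apply q ((*v) N) w = 0"
      using Suc.prems(2) unfolding q w_def poly_apply_root_mult(2) .
    from Suc.hyps(1)[OF dq q0 this] have w: "(\<lambda>n. ((*v) N ^^ n) w) \<longlonglongrightarrow> 0" .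
    have "((*v) N ^^ Suc n) v = c *s ((*v) N ^^ n) v + ((*v) N ^^ n) w" for n
    proof -
      have "((*v) N ^^ Suc n) v = ((*v) N ^^ n) (c *s v + w)"
        by (simp add: w_def funpow_swap1)
      then show ?thesis by (simp only: funpow_matrix_vector)
    qed
    then have "norm (((*v) N ^^ Suc n) v) \<le> norm c * norm (((*v) N ^^ n) v) + norm (((*v) N ^^ n) w)" for n
      using norm_triangle_ineq[of "c *s ((*v) N ^^ n) v" "((*v) N ^^ n) w"]
      by (simp only: norm_vector_smult_complex)
    then show ?thesis
      by (rule contracting_recurrence_tendsto_0[OF _ norm_ge_zero True w])
  next
    case False
    have "N *v poly_apply q ((*v) N) v = c *s poly_apply q ((*v) N) v"
      using Suc.prems(2) unfolding q poly_apply_root_mult(1) by simp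
    then have "poly_apply q ((*v) N) v = 0" using eig False by blast
    then show ?thesis using Suc.hyps(1)[OF dq q0] by blast
  qed
qed

text \<open>One more iterate than the real dimension is linearly dependent. Since
  \<open>dependent\<close> speaks of sets, a repetition among the iterates is a separate case,
  settled by a difference of two monomials.\<close>

lemma ex_annihilating_poly:
  fixes N :: "complex ^ 'd::finite ^ 'd"
  shows "\<exists>p. p \<noteq> 0 \<and> poly_apply p ((*v) N) v = 0"
proof -
  let ?g = "\<lambda>i. ((*v) N ^^ i) v" and ?D = "DIM(complex ^ 'd)"
  show ?thesis
  proof (cases "inj_on ?g {..?D}")
    case False
    then obtain i j where ij: "i \<noteq> j" "?g i = ?g j" by (auto simp: inj_on_def)
    let ?p = "monom 1 i - monom 1 j :: complex poly"
    have "coeff ?p i \<noteq> 0" using ij by simp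
    then have "?p \<noteq> 0" by (metis coeff_0)
    moreover have "degree ?p \<le> max i j"
      by (intro degree_diff_le) (auto intro: order_trans[OF degree_monom_le])
    then have "poly_apply ?p ((*v) N) v = (\<Sum>k\<le>max i j. coeff ?p k *s ?g k)"
      by (rule poly_apply_eq)
    then have "poly_apply ?p ((*v) N) v = 0"
      using ij by (simp add: vector_sub_rdistrib sum_subtractf if_distrib[of "\<lambda>c. c *s _"] cong: if_cong)
    ultimately show ?thesis by blast
  next
    case True
    then have "card (?g ` {..?D}) = Suc ?D" by (simp add: card_image)
    then have "dependent (?g ` {..?D})"
      using independent_card_le[of "?g ` {..?D}"] by fastforce
    then obtain u where u: "\<exists>x\<in>?g ` {..?D}. u x \<noteq> 0" "(\<Sum>x\<in>?g ` {..?D}. u x *\<^sub>R x) = 0"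
      by (auto simp: dependent_finite)
    define p where "p = (\<Sum>i\<le>?D. monom (complex_of_real (u (?g i))) i)"
    have cp: "coeff p k = (if k \<le> ?D then complex_of_real (u (?g k)) else 0)" for k
      by (simp add: p_def coeff_sum)
    have "degree p \<le> ?D" by (rule degree_le) (simp add: cp)
    then have "poly_apply p ((*v) N) v = (\<Sum>k\<le>?D. coeff p k *s ?g k)"
      by (rule poly_apply_eq)
    also have "\<dots> = (\<Sum>k\<le>?D. u (?g k) *\<^sub>R ?g k)"
    proof (rule sum.cong[OF refl])
      fix k assume "k \<in> {..?D}"
      then have "coeff p k = complex_of_real (u (?g k))" using cp by simp
      moreover have "complex_of_real c *s x = c *\<^sub>R x" for c and x :: "complex ^ 'd"
        unfolding vec_eq_iff vector_smult_component vector_scaleR_component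
        by (simp add: scaleR_conv_of_real)
      ultimately show "coeff p k *s ?g k = u (?g k) *\<^sub>R ?g k" by (simp only:)
    qed
    also have "\<dots> = 0"
      using u(2) sum.reindex[OF True, of "\<lambda>x. u x *\<^sub>R x"] by (simp only: o_def)
    finally have "poly_apply p ((*v) N) v = 0" .
    moreover obtain k where "k \<le> ?D" "u (?g k) \<noteq> 0" using u(1) by blast
    then have "coeff p k \<noteq> 0" using cp by simp
    then have "p \<noteq> 0" by auto
    ultimately show ?thesis by blast
  qed
qed

section \<open>Real expansive maps through complexification\<close>

definition complexify :: "real ^ 'n ^ 'm \<Rightarrow> complex ^ 'n ^ 'm" where
  "complexify A = (\<chi> i j. complex_of_real (A $ i $ j))"

lemma complexify_mult:
  fixes A B :: "real ^ 'n::finite ^ 'n"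
  shows "complexify A ** complexify B = complexify (A ** B)"
  by (simp add: complexify_def matrix_matrix_mult_def vec_eq_iff)

lemma complexify_funpow:
  fixes A :: "real ^ 'n::finite ^ 'n"
  shows "((*v) (complexify A) ^^ n) (\<chi> i. complex_of_real (x $ i)) = (\<chi> i. complex_of_real (((*v) A ^^ n) x $ i))"
  by (induction n) (simp_all add: complexify_def matrix_vector_mult_def vec_eq_iff)

lemma expansive_inj:
  assumes "expansive \<phi>" shows "inj \<phi>"
proof -
  have lin: "linear \<phi>" using assms by (simp add: expansive_def)
  have "x = 0" if "\<phi> x = 0" for x
  proof (rule ccontr)
    assume "x \<noteq> 0"
    let ?v = "\<chi> i. complex_of_real (x $ i)"
    have "complexify (matrix \<phi>) *v ?v = (\<chi> i. complex_of_real ((matrix \<phi> *v x) $ i))"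
      using complexify_funpow[of 1 "matrix \<phi>" x] by simp
    then have "complexify (matrix \<phi>) *v ?v = 0 *s ?v"
      using that lin by (simp add: matrix_works vec_eq_iff)
    moreover have "?v \<noteq> 0" using \<open>x \<noteq> 0\<close> by (auto simp: vec_eq_iff)
    ultimately have "complex_eigenvalue \<phi> 0"
      unfolding complex_eigenvalue_def complexify_def by blast
    then show False using assms by (force simp: expansive_def)
  qed
  then show ?thesis using lin linear_injective_0 by blast
qed

text \<open>The eigenvalues of the inverse are the reciprocals of those of \<phi>, hence of modulus
  below 1, and the embedding of real vectors into complex ones commutes with iteration.\<close>

lemma expansive_inverse_tendsto_0:
  fixes \<phi> :: "real ^ 'a::finite \<Rightarrow> real ^ 'a"
  assumes "expansive \<phi>" shows "(\<lambda>n. (inv \<phi> ^^ n) x) \<longlonglongrightarrow> 0"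
proof -
  have lin: "linear \<phi>" using assms by (simp add: expansive_def)
  have bij: "bij \<phi>" using expansive_inj[OF assms] lin
    by (simp add: bij_def linear_injective_imp_surjective)
  have lin': "linear (inv \<phi>)"
    using lin bij by (simp add: bij_is_inj bij_is_surj inj_linear_imp_inv_linear)
  define M N where "M = complexify (matrix \<phi>)" and "N = complexify (matrix (inv \<phi>))"
  have "M ** N = complexify (matrix (\<phi> \<circ> inv \<phi>))"
    unfolding M_def N_def complexify_mult using matrix_compose[OF lin' lin] by simp
  also have "\<phi> \<circ> inv \<phi> = id" by (rule ext) (simp add: surj_f_inv_f[OF bij_is_surj[OF bij]])
  also have "complexify (matrix id) = mat 1"
    by (simp add: complexify_def matrix_id_mat_1 vec_eq_iff mat_def)
  finally have MN: "M ** N = mat 1" .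
  have "norm c < 1" if "v \<noteq> 0" "N *v v = c *s v" for c v
  proof -
    have v: "v = c *s (M *v v)"
    proof -
      have "v = M *v (N *v v)" unfolding matrix_vector_mul_assoc MN by simp
      then show ?thesis unfolding that(2) vector_scalar_commute .
    qed
    then have "c \<noteq> 0" using \<open>v \<noteq> 0\<close> by auto
    then have "M *v v = (1 / c) *s v"
      using arg_cong[OF v, of "\<lambda>u. (1 / c) *s u"] unfolding vector_smult_assoc by simp
    then have "complex_eigenvalue \<phi> (1 / c)"
      using \<open>v \<noteq> 0\<close> unfolding complex_eigenvalue_def M_def complexify_def by (intro exI[of _ v] conjI)
    then have "norm (1 / c) > 1" using assms unfolding expansive_def by blast
    then show ?thesis using \<open>c \<noteq> 0\<close> by (simp add: norm_divide divide_simps)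
  qed
  note eig = this
  obtain p where p: "p \<noteq> 0" "poly_apply p ((*v) N) (\<chi> i. complex_of_real (x $ i)) = 0"
    using ex_annihilating_poly by blast
  have *: "(\<lambda>n. ((*v) N ^^ n) (\<chi> i. complex_of_real (x $ i))) \<longlonglongrightarrow> 0"
    by (rule poly_annihilated_tendsto_0[OF eig p])
  have inv: "(*v) (matrix (inv \<phi>)) = inv \<phi>"
    using lin' by (simp add: fun_eq_iff matrix_works)
  note ** = *[unfolded N_def complexify_funpow inv]
  show ?thesis
  proof (rule vec_tendstoI)
    fix i
    have "(\<lambda>n. complex_of_real ((inv \<phi> ^^ n) x $ i)) \<longlonglongrightarrow> complex_of_real 0"
      using tendsto_vec_nth[OF **, of i] unfolding vec_lambda_beta zero_index of_real_0 .
    then show "(\<lambda>n. (inv \<phi> ^^ n) x $ i) \<longlonglongrightarrow> 0 $ i"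
      unfolding tendsto_of_real_iff zero_index .
  qed
qed

text \<open>Convergence to 0 on the finitely many basis vectors bounds the operator norm of the
  iterated inverse. The map \<phi> itself need not increase the Euclidean norm; only high powers do,
  hence the threshold L.\<close>

lemma expansive_funpow_lower_bound:
  fixes \<phi> :: "real ^ 'a::finite \<Rightarrow> real ^ 'a"
  assumes "expansive \<phi>" and "e > 0"
  shows "\<exists>L. \<forall>l\<ge>L. \<forall>x. norm x \<le> e * norm ((\<phi> ^^ l) x)"
proof -
  have lin: "linear \<phi>" using assms by (simp add: expansive_def)
  have bij: "bij \<phi>" using expansive_inj[OF assms(1)] lin
    by (simp add: bij_def linear_injective_imp_surjective)
  have lin': "linear (inv \<phi>)"
    using lin bij by (simp add: bij_is_inj bij_is_surj inj_linear_imp_inv_linear)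
  have linn: "linear (inv \<phi> ^^ n)" for n
  proof (induction n)
    case 0 then show ?case by (simp add: linear_iff)
  next
    case (Suc n) from linear_compose[OF this lin'] show ?case by (simp add: o_def)
  qed
  have "(\<lambda>n. \<Sum>b\<in>(Basis :: (real ^ 'a) set). norm ((inv \<phi> ^^ n) b)) \<longlonglongrightarrow> (\<Sum>b\<in>(Basis :: (real ^ 'a) set). norm (0 :: real ^ 'a))"
    by (intro tendsto_sum tendsto_norm expansive_inverse_tendsto_0[OF assms(1)])
  then have "\<forall>\<^sub>F n in sequentially. (\<Sum>b\<in>Basis. norm ((inv \<phi> ^^ n) b)) < e"
    using assms(2) by (intro order_tendstoD(2)) auto
  then obtain L where L: "\<And>n. n \<ge> L \<Longrightarrow> (\<Sum>b\<in>Basis. norm ((inv \<phi> ^^ n) b)) < e"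
    unfolding eventually_sequentially by blast
  have "norm x \<le> e * norm ((\<phi> ^^ l) x)" if "l \<ge> L" for l x
  proof -
    have inv: "(inv \<phi> ^^ l) ((\<phi> ^^ l) x) = x"
      using inv_f_f[OF bij_is_inj[OF bij_fn[OF bij, of l]], of x] by (simp only: inv_fn[OF bij])
    have "norm ((inv \<phi> ^^ l) y) \<le> (\<Sum>b\<in>Basis. norm ((inv \<phi> ^^ l) b)) * norm y" for y
    proof -
      have "(inv \<phi> ^^ l) y = (\<Sum>b\<in>Basis. (y \<bullet> b) *\<^sub>R (inv \<phi> ^^ l) b)"
        using linear_sum[OF linn[of l], of "\<lambda>b. (y \<bullet> b) *\<^sub>R b" Basis]
        unfolding linear_cmul[OF linn[of l]] euclidean_representation .
      also have "norm \<dots> \<le> (\<Sum>b\<in>Basis. norm ((inv \<phi> ^^ l) b) * norm y)"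
      proof (rule sum_norm_le)
        fix b :: "real ^ 'a" assume "b \<in> Basis"
        then have "\<bar>y \<bullet> b\<bar> * norm ((inv \<phi> ^^ l) b) \<le> norm y * norm ((inv \<phi> ^^ l) b)"
          by (intro mult_right_mono Basis_le_norm) auto
        then show "norm ((y \<bullet> b) *\<^sub>R (inv \<phi> ^^ l) b) \<le> norm ((inv \<phi> ^^ l) b) * norm y"
          unfolding norm_scaleR by (subst (2) mult.commute)
      qed
      finally show ?thesis unfolding sum_distrib_right .
    qed
    then have "norm ((inv \<phi> ^^ l) ((\<phi> ^^ l) x)) \<le> (\<Sum>b\<in>Basis. norm ((inv \<phi> ^^ l) b)) * norm ((\<phi> ^^ l) x)" .
    also have "\<dots> \<le> e * norm ((\<phi> ^^ l) x)"
      by (rule mult_right_mono[OF less_imp_le[OF L[OF that]] norm_ge_zero])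
    finally have "norm ((inv \<phi> ^^ l) ((\<phi> ^^ l) x)) \<le> e * norm ((\<phi> ^^ l) x)" .
    then show ?thesis unfolding inv .
  qed
  then show ?thesis by (intro exI[of _ L] allI impI)
qed

subsection \<open>Tiles and substitutions\<close>

text \<open>Tiles are pairs; splitting them hides the facts about tiles from the automation.\<close>

declare split_paired_All [simp del] split_paired_Ex [simp del]

lemma tile_shift_0 [simp]: "tile_shift 0 t = t"
  by (simp add: tile_shift_def)

lemma tile_shift_tile_shift [simp]: "tile_shift g (tile_shift h t) = tile_shift (h + g) t"
  by (simp add: tile_shift_def image_image add.assoc)

lemma fst_tile_shift: "fst (tile_shift g t) = (\<lambda>y. y + g) ` fst t"
  by (simp add: tile_shift_def)

lemma mem_fst_tile_shift [simp]: "y \<in> fst (tile_shift g t) \<longleftrightarrow> y - g \<in> fst t"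
  unfolding fst_tile_shift by (force simp: image_iff algebra_simps)

lemma interior_fst_tile_shift: "interior (fst (tile_shift g t)) = (\<lambda>y. y + g) ` interior (fst t)"
  unfolding fst_tile_shift using interior_translation[of g "fst t"] by (simp add: add.commute[of _ g])

lemma mem_interior_tile_shift [simp]:
  "y \<in> interior (fst (tile_shift g t)) \<longleftrightarrow> y - g \<in> interior (fst t)"
  unfolding interior_fst_tile_shift by (force simp: image_iff algebra_simps)

lemma is_tile_shift [simp]:
  fixes t :: "('d::finite, 'l) tile"
  shows "is_tile (tile_shift g t) \<longleftrightarrow> is_tile t"
proof -
  have "closure ((\<lambda>y. y + g) ` S) = (\<lambda>y. y + g) ` closure S" for S :: "(real ^ 'd) set"
    using closure_translation[of g S] by (simp add: add.commute[of _ g])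
  moreover have "compact ((\<lambda>y. y + g) ` S) \<longleftrightarrow> compact S" for S :: "(real ^ 'd) set"
    using compact_translation[of S g] compact_translation[of "(+) g ` S" "- g"]
    by (auto simp: add.commute[of _ g] image_image)
  moreover have "inj (\<lambda>y :: real ^ 'd. y + g)" by (simp add: inj_def)
  ultimately show ?thesis
    unfolding is_tile_def interior_fst_tile_shift by (simp add: fst_tile_shift inj_image_eq_iff)
qed

lemma frontier_tile_shift: "frontier (fst (tile_shift g t)) = (\<lambda>y. y + g) ` frontier (fst t)"
  unfolding fst_tile_shift using frontier_translation[of g "fst t"] by (simp add: add.commute[of _ g])

lemma mem_frontier_tile_shift [simp]:
  "y \<in> frontier (fst (tile_shift g t)) \<longleftrightarrow> y - g \<in> frontier (fst t)"
  unfolding frontier_tile_shift by (force simp: image_iff algebra_simps)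

lemma tile_shift_inj_iff [simp]: "tile_shift g s = tile_shift g t \<longleftrightarrow> s = t"
proof
  assume "tile_shift g s = tile_shift g t"
  then have "tile_shift (- g) (tile_shift g s) = tile_shift (- g) (tile_shift g t)" by (rule arg_cong)
  then show "s = t" by simp
qed simp

lemma shift_0 [simp]: "shift 0 P = P"
  by (simp add: shift_def)

lemma shift_shift [simp]: "shift g (shift h P) = shift (h + g) P"
  by (simp add: shift_def image_image)

lemma mem_shift [simp]: "t \<in> shift g P \<longleftrightarrow> tile_shift (- g) t \<in> P"
proof
  assume "tile_shift (- g) t \<in> P"
  then have "tile_shift g (tile_shift (- g) t) \<in> shift g P" unfolding shift_def by (rule imageI)
  then show "t \<in> shift g P" by simp
qed (auto simp: shift_def)

lemma shift_mono: "P \<subseteq> Q \<Longrightarrow> shift g P \<subseteq> shift g Q"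
  by auto

lemma shift_subset_shift_iff: "shift g P \<subseteq> T \<longleftrightarrow> P \<subseteq> shift (- g) T"
  using shift_mono[of P "shift (- g) T" g] shift_mono[of "shift g P" T "- g"] by auto

lemma finite_shift [simp]: "finite (shift g P) \<longleftrightarrow> finite P"
  unfolding shift_def by (rule finite_image_iff) (simp add: inj_on_def)

lemma shift_empty [simp]: "shift g {} = {}"
  by (simp add: shift_def)

lemma shift_insert [simp]: "shift g (insert t P) = insert (tile_shift g t) (shift g P)"
  by (simp add: shift_def)

lemma mem_supp_iff: "y \<in> supp P \<longleftrightarrow> (\<exists>t\<in>P. y \<in> fst t)"
  by (auto simp: supp_def)

lemma mem_supp_shift [simp]: "y \<in> supp (shift g P) \<longleftrightarrow> y - g \<in> supp P"
  by (force simp: mem_supp_iff shift_def)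

lemma supp_shift: "supp (shift g P) = (\<lambda>y. y + g) ` supp P"
  by (force simp: image_iff algebra_simps)

text \<open>Disjointness in its positive form: two tiles of one tiling are proved equal by showing
  that they overlap.\<close>

definition overlap :: "('d::finite, 'l) tile \<Rightarrow> ('d, 'l) tile \<Rightarrow> bool" where
  "overlap s t \<longleftrightarrow> interior (fst s) \<inter> interior (fst t) \<noteq> {}"

lemma overlap_shift [simp]: "overlap (tile_shift g s) (tile_shift g t) \<longleftrightarrow> overlap s t"
  by (auto simp: overlap_def interior_fst_tile_shift)

lemma disjoint_interiors_iff:
  "disjoint_interiors P \<longleftrightarrow> (\<forall>s\<in>P. \<forall>t\<in>P. overlap s t \<longrightarrow> s = t)"
  unfolding disjoint_interiors_def overlap_def by blast

lemma disjoint_interiors_shift [simp]: "disjoint_interiors (shift g P) \<longleftrightarrow> disjoint_interiors P"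
  unfolding disjoint_interiors_iff shift_def by simp

lemma is_tiling_shift [simp]: "is_tiling (shift g T) \<longleftrightarrow> is_tiling T"
proof -
  have "(\<lambda>y. y + g) ` A = UNIV \<longleftrightarrow> A = UNIV" for A :: "(real ^ 'a) set"
    using inj_image_eq_iff[of "\<lambda>y. y + g" A UNIV] by (simp add: inj_def surj_plus_right)
  moreover have "(\<forall>t\<in>shift g T. is_tile t) \<longleftrightarrow> (\<forall>t\<in>T. is_tile t)" by (simp add: shift_def)
  ultimately show ?thesis unfolding is_tiling_def supp_shift by simp
qed

text \<open>A point of F that maximises the inner product with g would be moved by g to a point of F
  where it is larger by the square of the norm of g.\<close>

lemma translation_eq_imp_0:
  fixes F :: "'a::euclidean_space set"
  assumes "(\<lambda>y. y + g) ` F = F" "compact F" "F \<noteq> {}"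
  shows "g = 0"
proof -
  have "continuous_on F (\<lambda>y. y \<bullet> g)" by (intro continuous_intros)
  from continuous_attains_sup[OF assms(2,3) this] obtain x
    where x: "x \<in> F" "\<And>y. y \<in> F \<Longrightarrow> y \<bullet> g \<le> x \<bullet> g" by auto
  have "x + g \<in> F" using assms(1) x(1) by blast
  from x(2)[OF this] have "g \<bullet> g \<le> 0" by (simp add: inner_add_left)
  then show ?thesis by (metis antisym inner_eq_zero_iff inner_ge_zero)
qed

lemma tile_shift_eq_imp:
  assumes "tile_shift g t = tile_shift h t" "is_tile t"
  shows "g = h"
proof -
  from arg_cong[OF assms(1), of "\<lambda>s. tile_shift (- h) s"] have "tile_shift (g - h) t = t"
    by simp
  then have "(\<lambda>y. y + (g - h)) ` fst t = fst t" by (metis fst_tile_shift)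
  then have "g - h = 0" using assms(2) by (intro translation_eq_imp_0[of _ "fst t"]) (auto simp: is_tile_def)
  then show ?thesis by simp
qed

lemma is_tile_closed: "is_tile t \<Longrightarrow> closed (fst t)"
  by (simp add: is_tile_def compact_imp_closed)

lemma is_tile_interior_meets:
  assumes "is_tile t" "y \<in> fst t" "open U" "y \<in> U"
  shows "interior (fst t) \<inter> U \<noteq> {}"
proof -
  have "y \<in> closure (interior (fst t))" using assms by (simp add: is_tile_def)
  then show ?thesis using assms by (metis IntI Int_commute empty_iff open_Int_closure_eq_empty)
qed

lemma is_tile_interior_nonempty: "is_tile t \<Longrightarrow> interior (fst t) \<noteq> {}"
  by (metis closure_empty is_tile_def)

lemma is_tile_frontier_nonempty: "is_tile t \<Longrightarrow> frontier (fst t) \<noteq> {}"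
  by (metis compact_imp_bounded frontier_eq_empty is_tile_def not_bounded_UNIV)

lemma tiling_unique:
  assumes "is_tiling T" "s \<in> T" "t \<in> T" "overlap s t"
  shows "s = t"
  using assms unfolding is_tiling_def disjoint_interiors_def overlap_def by blast

lemma tiling_covers:
  assumes "is_tiling T" obtains t where "t \<in> T" "y \<in> fst t"
  using assms unfolding is_tiling_def supp_def by blast

lemma tiling_overlap_ex:
  assumes "is_tiling T" "is_tile s"
  shows "\<exists>t\<in>T. overlap s t"
proof -
  obtain y where y: "y \<in> interior (fst s)" using is_tile_interior_nonempty[OF assms(2)] by blast
  obtain t where t: "t \<in> T" "y \<in> fst t" using tiling_covers[OF assms(1)] .
  then have "is_tile t" using assms(1) by (simp add: is_tiling_def)
  \<comment> \<open>The tile t may contain y only on its boundary; being the closure of its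
    interior, it has interior points in every neighbourhood of y.\<close>
  from is_tile_interior_meets[OF this t(2) open_interior y] show ?thesis
    using t(1) by (auto simp: overlap_def)
qed

text \<open>A tile of T overlaps some tile of S, and both lie in T, so they coincide. One inclusion
  is thus all that an equality of tilings requires.\<close>

lemma tiling_subset_eq:
  assumes "is_tiling S" "is_tiling T" "S \<subseteq> T"
  shows "S = T"
proof
  show "T \<subseteq> S"
  proof
    fix t assume t: "t \<in> T"
    then have "is_tile t" using assms(2) by (simp add: is_tiling_def)
    then obtain s where "s \<in> S" "overlap t s" using tiling_overlap_ex[OF assms(1)] by blast
    then show "t \<in> S" using tiling_unique[OF assms(2) t, of s] assms(3) by auto
  qed
qed fact

lemma of_type_shift [simp]:
  fixes t :: "('d::finite, 'l) tile"
  shows "of_type \<B> (tile_shift g t) \<longleftrightarrow> of_type \<B> t"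
proof -
  have *: "of_type \<B> (tile_shift g t)" if "of_type \<B> t" for g and t :: "('d, 'l) tile"
    using that by (auto simp: of_type_def simp del: tile_shift_inj_iff) blast
  from *[of "tile_shift g t" "- g"] *[of t g] show ?thesis by auto
qed

lemma of_type_mono: "of_type \<B> t \<Longrightarrow> \<B> \<subseteq> \<C> \<Longrightarrow> of_type \<C> t"
  by (auto simp: of_type_def)

lemma of_type_prototile: "A \<in> \<B> \<Longrightarrow> of_type \<B> (tile_shift x A)" "A \<in> \<B> \<Longrightarrow> of_type \<B> A"
  unfolding of_type_def using tile_shift_0[of A, symmetric] by blast+

locale tile_subst =
  fixes \<A> :: "('d::finite, 'l) tile set" and \<phi> :: "real ^ 'd \<Rightarrow> real ^ 'd"
    and \<omega> :: "('d, 'l) tile \<Rightarrow> ('d, 'l) tile set"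
  assumes tile_substitution: "tile_substitution \<A> \<phi> \<omega>"
begin

abbreviation "W \<equiv> subst_ext \<A> \<phi> \<omega>"
abbreviation "X \<equiv> tiling_space \<A> \<phi> \<omega>"

lemma finite_prototiles: "finite \<A>"
  and is_tile_prototile: "A \<in> \<A> \<Longrightarrow> is_tile A"
  and zero_in_interior: "A \<in> \<A> \<Longrightarrow> 0 \<in> interior (fst A)"
  and prototiles_inequivalent: "A \<in> \<A> \<Longrightarrow> tile_shift x A \<in> \<A> \<Longrightarrow> tile_shift x A = A"
proof -
  have "prototile_set \<A>" using tile_substitution by (simp add: tile_substitution_def)
  note * = this[unfolded prototile_set_def]
  show "finite \<A>" using * by (rule conjunct1)
  show "is_tile A" "0 \<in> interior (fst A)" if "A \<in> \<A>"
    using *[THEN conjunct2, THEN conjunct1, THEN bspec, OF that] by simp_all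
  show "tile_shift x A = A" if "A \<in> \<A>" "tile_shift x A \<in> \<A>"
    using *[THEN conjunct2, THEN conjunct2, THEN bspec, THEN bspec, OF that] by metis
qed

lemma expansive: "expansive \<phi>"
  and finite_subst: "A \<in> \<A> \<Longrightarrow> finite (\<omega> A)"
  and is_tile_subst: "A \<in> \<A> \<Longrightarrow> t \<in> \<omega> A \<Longrightarrow> is_tile t"
  and disjoint_subst: "A \<in> \<A> \<Longrightarrow> disjoint_interiors (\<omega> A)"
  and of_type_subst: "A \<in> \<A> \<Longrightarrow> t \<in> \<omega> A \<Longrightarrow> of_type \<A> t"
  and supp_subst: "A \<in> \<A> \<Longrightarrow> supp (\<omega> A) = \<phi> ` fst A"
proof -
  show "expansive \<phi>" using tile_substitution by (simp add: tile_substitution_def)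
  assume A: "A \<in> \<A>"
  then have *: "\<omega> A \<in> patches_over \<A>" "supp (\<omega> A) = \<phi> ` fst A"
    using tile_substitution by (auto simp: tile_substitution_def)
  then show "finite (\<omega> A)" "disjoint_interiors (\<omega> A)" "supp (\<omega> A) = \<phi> ` fst A"
    by (simp_all add: patches_over_def is_patch_def)
  show "is_tile t" "of_type \<A> t" if "t \<in> \<omega> A"
    using * that by (simp_all add: patches_over_def is_patch_def)
qed

lemma linear_\<phi>: "linear \<phi>" using expansive by (simp add: expansive_def)

lemma linear_funpow: "linear (\<phi> ^^ n)"
proof (induction n)
  case 0 then show ?case by (simp add: linear_iff)
next
  case (Suc n) from linear_compose[OF this linear_\<phi>] show ?case by (simp add: o_def)
qed

lemma bij_\<phi>: "bij \<phi>"
  using expansive_inj[OF expansive] linear_\<phi> by (simp add: bij_def linear_injective_imp_surjective)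

lemma bij_funpow: "bij (\<phi> ^^ n)"
  by (rule bij_fn[OF bij_\<phi>])

lemma funpow_eq_iff [simp]: "(\<phi> ^^ n) x = (\<phi> ^^ n) y \<longleftrightarrow> x = y"
  using bij_is_inj[OF bij_funpow] by (simp add: inj_eq)

lemma phi_pow_add : "(\<phi> ^^ n) (x + y) = (\<phi> ^^ n) x + (\<phi> ^^ n) y"
  and phi_pow_diff : "(\<phi> ^^ n) (x - y) = (\<phi> ^^ n) x - (\<phi> ^^ n) y"
  and phi_pow_minus : "(\<phi> ^^ n) (- x) = - (\<phi> ^^ n) x"
  and phi_pow_scaleR : "(\<phi> ^^ n) (c *\<^sub>R x) = c *\<^sub>R (\<phi> ^^ n) x"
  and phi_pow_zero [simp] : "(\<phi> ^^ n) 0 = 0"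
  by (simp_all add: linear_funpow linear_add linear_diff linear_neg linear_cmul linear_0)

lemma interior_image: "interior ((\<phi> ^^ n) ` S) = (\<phi> ^^ n) ` interior S"
  by (rule interior_injective_linear_image[OF linear_funpow bij_is_inj[OF bij_funpow]])

lemma of_type_is_tile: "of_type \<A> t \<Longrightarrow> is_tile t"
  by (auto simp: of_type_def is_tile_prototile)

lemma tile_shift_prototile_eq_iff:
  assumes "A \<in> \<A>" "B \<in> \<A>"
  shows "tile_shift x A = tile_shift y B \<longleftrightarrow> A = B \<and> x = y"
proof
  assume eq: "tile_shift x A = tile_shift y B"
  from arg_cong[OF this, of "tile_shift (- y)"] have "B = tile_shift (x - y) A" by simp
  then have "A = B" using prototiles_inequivalent assms by metis
  then show "A = B \<and> x = y" using tile_shift_eq_imp[of x A y] eq is_tile_prototile[OF assms(1)] by auto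
qed auto

section \<open>The substitution on sets of tiles and its iterates\<close>

lemma mem_W: "s \<in> W P \<longleftrightarrow> (\<exists>A\<in>\<A>. \<exists>x. tile_shift x A \<in> P \<and> s \<in> shift (\<phi> x) (\<omega> A))"
proof
  assume "s \<in> W P"
  then obtain Q where "Q \<in> {shift (\<phi> x) (\<omega> A) | x A. A \<in> \<A> \<and> tile_shift x A \<in> P}" "s \<in> Q"
    unfolding subst_ext_def by (rule UnionE)
  then show "\<exists>A\<in>\<A>. \<exists>x. tile_shift x A \<in> P \<and> s \<in> shift (\<phi> x) (\<omega> A)" by blast
next
  assume "\<exists>A\<in>\<A>. \<exists>x. tile_shift x A \<in> P \<and> s \<in> shift (\<phi> x) (\<omega> A)"
  then obtain A x where "A \<in> \<A>" "tile_shift x A \<in> P" and s: "s \<in> shift (\<phi> x) (\<omega> A)" by blast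
  then have "shift (\<phi> x) (\<omega> A) \<in> {shift (\<phi> x) (\<omega> A) | x A. A \<in> \<A> \<and> tile_shift x A \<in> P}" by blast
  then show "s \<in> W P" unfolding subst_ext_def using s by (rule UnionI)
qed

lemma W_single: assumes A: "A \<in> \<A>" shows "W {tile_shift x A} = shift (\<phi> x) (\<omega> A)"
proof (intro subset_antisym subsetI)
  fix s assume "s \<in> W {tile_shift x A}"
  then obtain B y where B: "B \<in> \<A>" "tile_shift y B = tile_shift x A" "s \<in> shift (\<phi> y) (\<omega> B)"
    unfolding mem_W singleton_iff by blast
  then have "B = A \<and> y = x" using tile_shift_prototile_eq_iff[OF B(1) A] by simp
  with B(3) show "s \<in> shift (\<phi> x) (\<omega> A)" by simp
next
  fix s assume "s \<in> shift (\<phi> x) (\<omega> A)"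
  then show "s \<in> W {tile_shift x A}"
    unfolding mem_W using A by (intro bexI[of _ A] exI[of _ x]) simp_all
qed

lemma W_UN: "W (\<Union>i\<in>I. P i) = (\<Union>i\<in>I. W (P i))"
  by (rule set_eqI) (auto simp: mem_W)

lemma W_eq_UN: "W P = (\<Union>t\<in>P. W {t})"
  using W_UN[of "\<lambda>t. {t}" P] by simp

lemma mem_W_iff: "s \<in> W P \<longleftrightarrow> (\<exists>t\<in>P. s \<in> W {t})"
  by (subst W_eq_UN) blast

lemma W_shift: "W (shift g P) = shift (\<phi> g) (W P)"
proof -
  have le: "shift (\<phi> g) (W P) \<subseteq> W (shift g P)" for g P
  proof
    fix t assume "t \<in> shift (\<phi> g) (W P)"
    then obtain x A where xA: "A \<in> \<A>" "tile_shift x A \<in> P" "tile_shift (- \<phi> g) t \<in> shift (\<phi> x) (\<omega> A)"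
      unfolding subst_ext_def by auto
    then have "t \<in> shift (\<phi> (x + g)) (\<omega> A)" "tile_shift (x + g) A \<in> shift g P"
      using linear_add[OF linear_\<phi>, of x g] by (simp_all add: algebra_simps)
    then show "t \<in> W (shift g P)" using xA(1) unfolding subst_ext_def by blast
  qed
  have "shift (\<phi> (- g)) (W (shift g P)) \<subseteq> W P" using le[of "- g" "shift g P"] by simp
  then have "W (shift g P) \<subseteq> shift (\<phi> g) (W P)"
    using linear_neg[OF linear_\<phi>, of g] by (simp add: shift_subset_shift_iff)
  with le show ?thesis by blast
qed

lemma Wn_UN: "(W ^^ n) (\<Union>i\<in>I. P i) = (\<Union>i\<in>I. (W ^^ n) (P i))"
  by (induction n) (simp_all add: W_UN)

lemma Wn_eq_UN: "(W ^^ n) P = (\<Union>t\<in>P. (W ^^ n) {t})"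
  using Wn_UN[of n "\<lambda>t. {t}" P] by simp

lemma Wn_mono: "P \<subseteq> Q \<Longrightarrow> (W ^^ n) P \<subseteq> (W ^^ n) Q"
  using Wn_eq_UN[of n P] Wn_eq_UN[of n Q] by blast

lemma mem_WnE:
  assumes "s \<in> (W ^^ n) P" obtains t where "t \<in> P" "s \<in> (W ^^ n) {t}"
  using assms by (subst (asm) Wn_eq_UN) blast

lemma mem_WnI: "t \<in> P \<Longrightarrow> s \<in> (W ^^ n) {t} \<Longrightarrow> s \<in> (W ^^ n) P"
  by (subst Wn_eq_UN) blast

lemma Wn_shift: "(W ^^ n) (shift g P) = shift ((\<phi> ^^ n) g) ((W ^^ n) P)"
  by (induction n) (simp_all add: W_shift)

lemma Wn_tile_shift: "(W ^^ n) {tile_shift g t} = shift ((\<phi> ^^ n) g) ((W ^^ n) {t})"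
  using Wn_shift[of n g "{t}"] by simp

lemma mem_Wn_tile_shift:
  "s \<in> (W ^^ n) {t} \<Longrightarrow> tile_shift ((\<phi> ^^ n) g) s \<in> (W ^^ n) {tile_shift g t}"
  by (simp add: Wn_tile_shift)

lemma Wn_Wn: "(W ^^ m) ((W ^^ n) P) = (W ^^ (m + n)) P"
  by (simp add: funpow_add)

lemma phi_pow_phi_pow: "(\<phi> ^^ m) ((\<phi> ^^ n) x) = (\<phi> ^^ (m + n)) x"
  by (simp add: funpow_add)

lemma of_type_W: "t \<in> W P \<Longrightarrow> of_type \<A> t"
proof -
  assume "t \<in> W P"
  then obtain x A where "A \<in> \<A>" "tile_shift (- \<phi> x) t \<in> \<omega> A" unfolding subst_ext_def by auto
  then have "of_type \<A> (tile_shift (- \<phi> x) t)" using of_type_subst by blast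
  then show "of_type \<A> t" by simp
qed

lemma of_type_Wn:
  assumes "\<And>t. t \<in> P \<Longrightarrow> of_type \<A> t" "t \<in> (W ^^ n) P" shows "of_type \<A> t"
  using assms(2) by (cases n) (auto intro: assms(1) of_type_W)

lemma of_type_Wn_single: "of_type \<A> t \<Longrightarrow> s \<in> (W ^^ n) {t} \<Longrightarrow> of_type \<A> s"
  using of_type_Wn[of "{t}"] by blast

lemma supp_W_single:
  assumes "of_type \<A> t" shows "supp (W {t}) = \<phi> ` fst t"
proof -
  obtain A x where A: "A \<in> \<A>" "t = tile_shift x A" using assms by (auto simp: of_type_def)
  have "supp (W {t}) = (\<lambda>y. y + \<phi> x) ` (\<phi> ` fst A)"
    by (simp add: A W_single supp_shift supp_subst)
  also have "\<dots> = \<phi> ` ((\<lambda>y. y + x) ` fst A)"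
    by (simp add: image_image linear_add[OF linear_\<phi>])
  finally show ?thesis by (simp add: A fst_tile_shift)
qed

lemma supp_W:
  assumes "\<And>t. t \<in> P \<Longrightarrow> of_type \<A> t" shows "supp (W P) = \<phi> ` supp P"
proof -
  have "supp (W P) = (\<Union>t\<in>P. supp (W {t}))" by (subst W_eq_UN) (auto simp: supp_def)
  also have "\<dots> = (\<Union>t\<in>P. \<phi> ` fst t)" using assms supp_W_single by simp
  finally show ?thesis by (auto simp: supp_def)
qed

lemma supp_Wn:
  assumes "\<And>t. t \<in> P \<Longrightarrow> of_type \<A> t" shows "supp ((W ^^ n) P) = (\<phi> ^^ n) ` supp P"
proof (induction n)
  case (Suc n)
  have "supp ((W ^^ Suc n) P) = \<phi> ` supp ((W ^^ n) P)"
    using of_type_Wn[OF assms] by (simp add: supp_W)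
  then show ?case using Suc by (simp add: image_image)
qed simp

lemma supp_Wn_single: "of_type \<A> t \<Longrightarrow> supp ((W ^^ n) {t}) = (\<phi> ^^ n) ` fst t"
  using supp_Wn[of "{t}" n] by (simp add: supp_def)

lemma Wn_subset:
  assumes "of_type \<A> t" "s \<in> (W ^^ n) {t}" shows "fst s \<subseteq> (\<phi> ^^ n) ` fst t"
  using supp_Wn_single[OF assms(1), of n] assms(2) by (auto simp: supp_def)

lemma Wn_interior_subset:
  assumes "of_type \<A> t" "s \<in> (W ^^ n) {t}" shows "interior (fst s) \<subseteq> (\<phi> ^^ n) ` interior (fst t)"
  using interior_mono[OF Wn_subset[OF assms]] by (simp add: interior_image)

text \<open>The interiors of s and s' lie in the images of the interiors of t and t' under one
  injective map, so an overlap of descendants is inherited by their ancestors.\<close>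

lemma overlap_Wn:
  assumes "of_type \<A> t" "s \<in> (W ^^ n) {t}" "of_type \<A> t'" "s' \<in> (W ^^ n) {t'}" "overlap s s'"
  shows "overlap t t'"
proof -
  obtain y where y: "y \<in> interior (fst s)" "y \<in> interior (fst s')" using assms(5) by (auto simp: overlap_def)
  obtain a where a: "y = (\<phi> ^^ n) a" "a \<in> interior (fst t)"
    using Wn_interior_subset[OF assms(1,2)] y(1) by blast
  obtain b where b: "y = (\<phi> ^^ n) b" "b \<in> interior (fst t')"
    using Wn_interior_subset[OF assms(3,4)] y(2) by blast
  have "a = b" using a b by simp
  then show ?thesis using a b by (auto simp: overlap_def)
qed

lemma disjoint_interiors_W:
  assumes "\<And>t. t \<in> P \<Longrightarrow> of_type \<A> t" "disjoint_interiors P"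
  shows "disjoint_interiors (W P)"
proof -
  have "s = s'" if s: "s \<in> W P" "s' \<in> W P" "overlap s s'" for s s'
  proof -
    obtain t t' where t: "t \<in> P" "t' \<in> P" "s \<in> W {t}" "s' \<in> W {t'}"
      using s(1,2) mem_W_iff by metis
    have "overlap t t'" using overlap_Wn[of t s 1 t' s'] t s(3) assms(1) by simp
    then have "t = t'" using t assms(2) by (auto simp: disjoint_interiors_def overlap_def)
    obtain A x where A: "A \<in> \<A>" "t = tile_shift x A" using assms(1)[OF t(1)] by (auto simp: of_type_def)
    have "disjoint_interiors (W {t})" using disjoint_subst[OF A(1)] by (simp add: A W_single)
    then show ?thesis using t s(3) \<open>t = t'\<close> by (auto simp: disjoint_interiors_def overlap_def)
  qed
  then show ?thesis unfolding disjoint_interiors_iff by blast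
qed

lemma is_tiling_W:
  assumes "is_tiling T" "\<And>t. t \<in> T \<Longrightarrow> of_type \<A> t"
  shows "is_tiling (W T)"
  using assms bij_is_surj[OF bij_\<phi>] of_type_is_tile[OF of_type_W]
  by (auto simp: is_tiling_def supp_W disjoint_interiors_W)

section \<open>The tiling space and its invariance\<close>

lemma X_tiling: "T \<in> X \<Longrightarrow> is_tiling T"
  by (simp add: tiling_space_def)

lemma X_legal:
  assumes "T \<in> X" "P \<subseteq> T" "finite P"
  obtains n A x where "n \<ge> 1" "A \<in> \<A>" "shift x P \<subseteq> (W ^^ n) {A}"
  using assms unfolding tiling_space_def legal_def by blast

lemma XI:
  assumes T: "is_tiling T"
    and ex: "\<And>P. P \<subseteq> T \<Longrightarrow> finite P \<Longrightarrow> \<exists>n\<ge>1. \<exists>A\<in>\<A>. \<exists>x. shift x P \<subseteq> (W ^^ n) {A}"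
  shows "T \<in> X"
proof -
  have "legal \<A> \<phi> \<omega> P" if P: "P \<subseteq> T" "finite P" for P
  proof -
    have "\<forall>t\<in>P. is_tile t" using P(1) T unfolding is_tiling_def by (meson subsetD)
    moreover have "disjoint_interiors P"
      using P(1) T unfolding is_tiling_def disjoint_interiors_iff by (meson subsetD)
    ultimately show ?thesis unfolding legal_def is_patch_def using P(2) ex[OF P] by (intro conjI)
  qed
  then show ?thesis unfolding tiling_space_def using T by (intro CollectI conjI allI impI) simp_all
qed

lemma X_of_type:
  assumes "T \<in> X" "t \<in> T" shows "of_type \<A> t"
proof -
  have "{t} \<subseteq> T" "finite {t}" using assms(2) by simp_all
  from X_legal[OF assms(1) this]
  obtain n A x where *: "n \<ge> 1" "A \<in> \<A>" "shift x {t} \<subseteq> (W ^^ n) {A}" .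
  have "tile_shift x t \<in> (W ^^ n) {A}" using *(3) by simp
  then have "of_type \<A> (tile_shift x t)"
    by (rule of_type_Wn_single[OF of_type_prototile(2)[OF *(2)]])
  then show ?thesis by simp
qed

lemma X_is_tile: "T \<in> X \<Longrightarrow> t \<in> T \<Longrightarrow> is_tile t"
  using of_type_is_tile X_of_type by blast

lemma X_shift [simp]: "shift g T \<in> X \<longleftrightarrow> T \<in> X"
proof -
  have *: "shift g T \<in> X" if "T \<in> X" for g T
  proof (rule XI)
    show "is_tiling (shift g T)" using X_tiling[OF that] by simp
    fix P assume "P \<subseteq> shift g T" "finite P"
    then have "shift (- g) P \<subseteq> T" "finite (shift (- g) P)"
      by (simp_all add: shift_subset_shift_iff)
    from X_legal[OF that this] obtain n A x where "n \<ge> 1" "A \<in> \<A>" "shift (- g + x) P \<subseteq> (W ^^ n) {A}"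
      unfolding shift_shift .
    then show "\<exists>n\<ge>1. \<exists>A\<in>\<A>. \<exists>x. shift x P \<subseteq> (W ^^ n) {A}" by blast
  qed
  from *[of T g] *[of "shift g T" "- g"] show ?thesis by auto
qed

text \<open>A finite patch of \<open>W T\<close> lies in the image of the finite patch of its
  parents; if that one is legal with n substitutions, the image is legal with n + 1.\<close>

lemma X_W: assumes "T \<in> X" shows "W T \<in> X"
proof (rule XI)
  show "is_tiling (W T)" using X_tiling[OF assms] X_of_type[OF assms] by (rule is_tiling_W)
  fix P assume P: "P \<subseteq> W T" "finite P"
  then have "\<forall>p\<in>P. \<exists>t. t \<in> T \<and> p \<in> W {t}" using mem_W_iff[of _ T] by blast
  from bchoice[OF this] obtain f where f: "\<And>p. p \<in> P \<Longrightarrow> f p \<in> T \<and> p \<in> W {f p}" by blast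
  have "f ` P \<subseteq> T" "finite (f ` P)" using f P(2) by blast+
  from X_legal[OF assms this]
  obtain n A x where n: "n \<ge> 1" "A \<in> \<A>" "shift x (f ` P) \<subseteq> (W ^^ n) {A}" .
  have "P \<subseteq> W (f ` P)"
  proof
    fix p assume "p \<in> P"
    then show "p \<in> W (f ` P)" using f by (subst mem_W_iff) blast
  qed
  then have "shift (\<phi> x) P \<subseteq> W (shift x (f ` P))" unfolding W_shift by (rule shift_mono)
  also have "\<dots> \<subseteq> W ((W ^^ n) {A})" using Wn_mono[OF n(3), of 1] by simp
  finally have "shift (\<phi> x) P \<subseteq> (W ^^ Suc n) {A}" by simp
  then show "\<exists>n\<ge>1. \<exists>A\<in>\<A>. \<exists>x. shift x P \<subseteq> (W ^^ n) {A}"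
    using n(2) by (intro exI[of _ "Suc n"]) auto
qed

lemma X_Wn: "T \<in> X \<Longrightarrow> (W ^^ n) T \<in> X"
  by (induction n) (simp_all add: X_W)

lemma X_unique: "T \<in> X \<Longrightarrow> s \<in> T \<Longrightarrow> t \<in> T \<Longrightarrow> overlap s t \<Longrightarrow> s = t"
  using tiling_unique X_tiling by blast

lemma X_overlap_ex: "T \<in> X \<Longrightarrow> is_tile s \<Longrightarrow> \<exists>t\<in>T. overlap s t"
  using tiling_overlap_ex X_tiling by blast

end

subsection \<open>Compactness of the tiling space\<close>

lemma finite_range_const_subseq:
  fixes f :: "nat \<Rightarrow> 'a"
  assumes "finite S" "\<And>n. f n \<in> S"
  shows "\<exists>r c. strict_mono (r :: nat \<Rightarrow> nat) \<and> (\<forall>n. f (r n) = c) \<and> c \<in> S"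
proof -
  have "finite (f ` UNIV)" using assms by (metis finite_subset image_subsetI)
  from pigeonhole_infinite[OF infinite_UNIV_nat this] obtain n0
    where "infinite {n. f n = f n0}" by auto
  from infinite_enumerate[OF this] obtain r :: "nat \<Rightarrow> nat" where "strict_mono r" "\<And>n. f (r n) = f n0"
    by auto
  then show ?thesis using assms(2) by (intro exI[of _ r] exI[of _ "f n0"]) simp
qed

text \<open>For T in \<open>X\<close> these are finite windows, over which limits and pigeonhole
  arguments run.\<close>

definition meeting :: "('d::finite, 'l) tile set \<Rightarrow> real \<Rightarrow> ('d, 'l) tile set" where
  "meeting T r = {t \<in> T. fst t \<inter> cball 0 r \<noteq> {}}"

lemma meeting_subset: "meeting T r \<subseteq> T" by (auto simp: meeting_def)

lemma meetingI: "t \<in> T \<Longrightarrow> y \<in> fst t \<Longrightarrow> norm y \<le> r \<Longrightarrow> t \<in> meeting T r"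
  by (auto simp: meeting_def)

lemma meeting_eventually:
  assumes "t \<in> T" "is_tile t" shows "\<exists>N::nat. \<forall>n\<ge>N. t \<in> meeting T (real n)"
proof -
  obtain y where y: "y \<in> fst t" using assms(2) by (auto simp: is_tile_def)
  obtain N :: nat where N: "norm y \<le> real N" using real_arch_simple by blast
  have "t \<in> meeting T (real n)" if "n \<ge> N" for n
    using N that by (intro meetingI[OF assms(1) y]) linarith
  then show ?thesis by blast
qed

locale fpc_subst = tile_subst \<A> \<phi> \<omega> for \<A> :: "('d::finite, 'l) tile set" and \<phi> \<omega> +
  assumes admissible: "admissible \<A> \<phi> \<omega>" and FPC: "FPC \<A> \<phi> \<omega>"
begin

lemma ex_prototile_radius: "\<exists>D>0. \<forall>A\<in>\<A>. fst A \<subseteq> cball 0 D"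
proof -
  have "bounded (\<Union>A\<in>\<A>. fst A)"
    using finite_prototiles is_tile_prototile by (auto simp: is_tile_def compact_imp_bounded)
  then obtain D where D: "D > 0" "\<And>y. y \<in> (\<Union>A\<in>\<A>. fst A) \<Longrightarrow> norm y \<le> D"
    unfolding bounded_pos by blast
  have "fst A \<subseteq> cball 0 D" if "A \<in> \<A>" for A
    using D(2) that by (intro subsetI) (simp, blast)
  then show ?thesis using D(1) by blast
qed

definition radius :: real where "radius = (SOME D. D > 0 \<and> (\<forall>A\<in>\<A>. fst A \<subseteq> cball 0 D))"

lemma radius_pos: "radius > 0"
  and prototile_norm_le: "A \<in> \<A> \<Longrightarrow> y \<in> fst A \<Longrightarrow> norm y \<le> radius"
proof -
  have *: "radius > 0 \<and> (\<forall>A\<in>\<A>. fst A \<subseteq> cball 0 radius)"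
    unfolding radius_def using ex_prototile_radius by (rule someI_ex)
  show "radius > 0" using * by simp
  show "norm y \<le> radius" if "A \<in> \<A>" "y \<in> fst A" for A y
    using *[THEN conjunct2, THEN bspec, OF that(1)] that(2) by (auto dest: subsetD)
qed

lemma tile_diam:
  assumes "of_type \<A> t" "y \<in> fst t" "z \<in> fst t" shows "dist y z \<le> 2 * radius"
proof -
  obtain A x where A: "A \<in> \<A>" "t = tile_shift x A" using assms(1) by (auto simp: of_type_def)
  have "norm (y - x) \<le> radius" "norm (z - x) \<le> radius"
    using assms(2,3) prototile_norm_le[OF A(1)] by (simp_all add: A(2))
  then show ?thesis using norm_triangle_ineq4[of "y - x" "z - x"] by (simp add: dist_norm)
qed

text \<open>FPC counts patches up to translation, and fixing the tile a removes that freedom: in a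
  two-tile patch {a, t} the position of a determines the translation and hence t. The finiteness is
  joint for all tilings of \<open>X\<close> that contain a.\<close>

lemma finite_neighbours:
  "finite {t. \<exists>T\<in>X. a \<in> T \<and> t \<in> meeting T r}" (is "finite ?V")
proof (cases "of_type \<A> a")
  case False
  then have "?V = {}" using X_of_type by blast
  then show ?thesis by (simp only: finite.emptyI)
next
  case True
  note tile_a = of_type_is_tile[OF this]
  then obtain M where M: "\<And>y. y \<in> fst a \<Longrightarrow> norm y \<le> M"
    using compact_imp_bounded[of "fst a"] unfolding is_tile_def bounded_iff by blast
  \<comment> \<open>The ball of radius K about 0 contains a, whose points have norm at most M, and
    every tile that meets the ball of radius r.\<close>
  define K where "K = \<bar>M\<bar> + \<bar>r\<bar> + 2 * radius"
  have K0: "K \<ge> 0" using radius_pos by (simp add: K_def)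
  obtain \<Q> where fin: "finite \<Q>" and Q: "\<And>T P. T \<in> X \<Longrightarrow> P \<subseteq> T \<Longrightarrow> finite P \<Longrightarrow> diameter (supp P) < 2 * K + 1
      \<Longrightarrow> \<exists>Q\<in>\<Q>. \<exists>x. P = shift x Q"
    using FPC[unfolded FPC_def, rule_format, of "2 * K + 1"] K0 by (auto simp del: mem_shift)
  \<comment> \<open>Recovers t from its place q in a representative patch: the translation is the
    one that carries q', the place of a, onto a.\<close>
  let ?F = "\<lambda>(q, q'). tile_shift (THE x. tile_shift x q' = a) q"
  have "?V \<subseteq> (\<Union>Q\<in>{Q\<in>\<Q>. finite Q}. ?F ` (Q \<times> Q))"
  proof
    fix t assume "t \<in> ?V"
    then obtain T where T: "T \<in> X" "a \<in> T" "t \<in> T" "fst t \<inter> cball 0 r \<noteq> {}" by (auto simp: meeting_def)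
    then obtain z where z: "z \<in> fst t" "norm z \<le> r" by auto
    have "supp {a, t} \<subseteq> cball 0 K"
    proof
      fix y assume "y \<in> supp {a, t}"
      then consider "y \<in> fst a" | "y \<in> fst t" by (auto simp: supp_def)
      then have "norm y \<le> K"
      proof cases
        case 1
        then show ?thesis using M[OF 1] radius_pos by (simp add: K_def)
      next
        case 2
        have "norm y \<le> norm z + dist y z" using norm_triangle_sub[of y z] by (simp add: dist_norm)
        also have "\<dots> \<le> r + 2 * radius" using z tile_diam[OF X_of_type[OF T(1,3)] 2 z(1)] by simp
        finally show ?thesis by (simp add: K_def)
      qed
      then show "y \<in> cball 0 K" by simp
    qed
    then have "diameter (supp {a, t}) \<le> diameter (cball (0 :: real ^ 'd) K)"
      by (rule diameter_subset) simp
    then have "diameter (supp {a, t}) < 2 * K + 1" using K0 by simp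
    from Q[OF T(1) _ _ this] T obtain R x where R: "R \<in> \<Q>" "{a, t} = shift x R" by auto
    have finR: "finite R" using R(2) by (metis finite.emptyI finite_insert finite_shift)
    have "a \<in> shift x R" "t \<in> shift x R" using R(2) by blast+
    then have q: "tile_shift (- x) a \<in> R" "tile_shift (- x) t \<in> R" by simp_all
    have "(THE y. tile_shift y (tile_shift (- x) a) = a) = x"
    proof (rule the_equality)
      fix y assume "tile_shift y (tile_shift (- x) a) = a"
      then have "tile_shift (- x + y) a = tile_shift 0 a" by simp
      from tile_shift_eq_imp[OF this tile_a] show "y = x" by simp
    qed simp
    then have "t = ?F (tile_shift (- x) t, tile_shift (- x) a)" unfolding prod.case by simp
    then have "t \<in> ?F ` (R \<times> R)" by (rule image_eqI) (rule SigmaI[OF q(2,1)])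
    then show "t \<in> (\<Union>Q\<in>{Q\<in>\<Q>. finite Q}. ?F ` (Q \<times> Q))" using R(1) finR by (intro UN_I[of R]) simp_all
  qed
  moreover have "finite (\<Union>Q\<in>{Q\<in>\<Q>. finite Q}. ?F ` (Q \<times> Q))" using fin by simp
  ultimately show ?thesis by (rule finite_subset)
qed

lemma finite_meeting:
  assumes "T \<in> X" shows "finite (meeting T r)"
proof -
  obtain a where "a \<in> T" using tiling_covers[OF X_tiling[OF assms]] .
  then have "meeting T r \<subseteq> {t. \<exists>T\<in>X. a \<in> T \<and> t \<in> meeting T r}" using assms by auto
  then show ?thesis using finite_neighbours by (rule finite_subset)
qed

text \<open>Compactness with a common tile as anchor. By \<open>finite_neighbours\<close> the window
  of radius k takes finitely many values along the sequence, and a diagonal subsequence makes every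
  window eventually constant.\<close>

lemma limit_tiling:
  assumes TX: "\<And>n. T n \<in> X" and anchor: "\<And>n. a \<in> T n"
  shows "\<exists>U\<in>X. \<exists>f. a \<in> U \<and> strict_mono (f :: nat \<Rightarrow> nat) \<and>
    (\<forall>P. P \<subseteq> U \<longrightarrow> finite P \<longrightarrow> (\<exists>N. \<forall>n\<ge>N. P \<subseteq> T (f n)))"
proof -
  interpret subseqs "\<lambda>k s. \<exists>c. \<forall>n. meeting (T (s n)) (real k) = c"
  proof
    fix k :: nat and s :: "nat \<Rightarrow> nat" assume "strict_mono s"
    let ?V = "{t. \<exists>T\<in>X. a \<in> T \<and> t \<in> meeting T (real k)}"
    have "finite (Pow ?V)" unfolding finite_Pow_iff by (rule finite_neighbours)
    moreover have "meeting (T (s n)) (real k) \<in> Pow ?V" for n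
      using TX[of "s n"] anchor[of "s n"] by blast
    ultimately have "\<exists>r c. strict_mono (r :: nat \<Rightarrow> nat) \<and> (\<forall>n. meeting (T (s (r n))) (real k) = c) \<and> c \<in> Pow ?V"
      by (rule finite_range_const_subseq)
    then obtain r c where r: "strict_mono (r :: nat \<Rightarrow> nat)" "\<And>n. meeting (T (s (r n))) (real k) = c"
      by (elim exE conjE) (rule that, assumption, erule spec)
    have "\<forall>n. meeting (T (s (r n))) (real k) = c" using r(2) by (rule allI)
    then have "\<exists>c. \<forall>n. meeting (T (s (r n))) (real k) = c" by (rule exI)
    then show "\<exists>r :: nat \<Rightarrow> nat. strict_mono r \<and> (\<exists>c. \<forall>n. meeting (T ((s \<circ> r) n)) (real k) = c)"
      unfolding comp_def by (intro exI[of _ r] conjI r(1))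
  qed
  define f where "f = diagseq"
  have f: "strict_mono f" unfolding f_def by (rule subseq_diagseq)
  \<comment> \<open>The diagonal sequence is a subsequence of the one chosen for k only from index
    \<open>Suc k\<close> on.\<close>
  have ev: "\<exists>c. \<forall>n. meeting (T ((f \<circ> (+) (Suc k)) n)) (real k) = c" for k
    unfolding f_def by (rule diagseq_holds) (simp add: comp_def, blast)
  have const: "meeting (T (f m)) (real k) = meeting (T (f n)) (real k)" if "m \<ge> Suc k" "n \<ge> Suc k" for k m n
  proof -
    obtain c where c: "\<And>n. meeting (T ((f \<circ> (+) (Suc k)) n)) (real k) = c"
      using ev[of k] by blast
    show ?thesis using c[of "m - Suc k"] c[of "n - Suc k"] that by simp
  qed
  define U where "U = {t. \<exists>N. \<forall>n\<ge>N. t \<in> T (f n)}"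
  have inU: "t \<in> U" if "t \<in> meeting (T (f n)) (real k)" "n \<ge> Suc k" for t n k
  proof -
    have "t \<in> T (f m)" if "m \<ge> Suc k" for m
      using const[OF that \<open>n \<ge> Suc k\<close>] \<open>t \<in> meeting (T (f n)) (real k)\<close> meeting_subset by blast
    then show ?thesis unfolding U_def by blast
  qed
  have fin: "\<exists>N. \<forall>n\<ge>N. P \<subseteq> T (f n)" if "P \<subseteq> U" "finite P" for P
  proof -
    have "\<forall>t\<in>P. \<forall>\<^sub>F n in sequentially. t \<in> T (f n)"
      using that(1) unfolding U_def eventually_sequentially by blast
    then have "\<forall>\<^sub>F n in sequentially. \<forall>t\<in>P. t \<in> T (f n)"
      by (rule eventually_ball_finite[OF that(2)])
    then show ?thesis unfolding eventually_sequentially by blast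
  qed
  have "is_tiling U"
    unfolding is_tiling_def disjoint_interiors_iff
  proof (intro conjI ballI impI)
    fix t assume "t \<in> U"
    then obtain N where "t \<in> T (f N)" unfolding U_def by blast
    then show "is_tile t" by (rule X_is_tile[OF TX])
  next
    have "y \<in> supp U" for y :: "real ^ 'd"
    proof -
      obtain k :: nat where k: "norm y \<le> real k" using real_arch_simple by blast
      obtain t where "t \<in> T (f (Suc k))" "y \<in> fst t" using tiling_covers[OF X_tiling[OF TX]] .
      from inU[OF meetingI[OF this k] order_refl] have "t \<in> U" .
      then show ?thesis unfolding mem_supp_iff using \<open>y \<in> fst t\<close> by (rule bexI[rotated])
    qed
    then show "supp U = UNIV" by auto
  next
    fix s t assume st: "s \<in> U" "t \<in> U" "overlap s t"
    obtain N where "{s, t} \<subseteq> T (f N)" using fin[of "{s, t}"] st by auto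
    then show "s = t" using X_unique[OF TX, of s "f N" t] st(3) by simp
  qed
  then have "U \<in> X"
  proof (rule XI)
    fix P assume "P \<subseteq> U" "finite P"
    from fin[OF this] obtain N where "\<forall>n\<ge>N. P \<subseteq> T (f n)" by (rule exE)
    then have "P \<subseteq> T (f N)" by simp
    from X_legal[OF TX this \<open>finite P\<close>] obtain m A x
      where m: "m \<ge> 1" "A \<in> \<A>" "shift x P \<subseteq> (W ^^ m) {A}" .
    show "\<exists>n\<ge>1. \<exists>A\<in>\<A>. \<exists>x. shift x P \<subseteq> (W ^^ n) {A}"
      by (intro exI[of _ m] conjI m(1) bexI[of _ A] exI[of _ x] m(3,2))
  qed
  moreover have "a \<in> U" using anchor by (simp add: U_def)
  ultimately show ?thesis
    by (intro bexI[of _ U] exI[of _ f] conjI f allI impI fin)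
qed

text \<open>The T n are preimages of S only on growing balls; a parent of a tile at the origin
  serves as the anchor for \<open>limit_tiling\<close>. The last conjunct lets statements about
  patches pass from the T n to the limit.\<close>

lemma desubstitute:
  assumes S: "S \<in> X" and TX: "\<And>n::nat. T n \<in> X" and sub: "\<And>n. meeting S (real n) \<subseteq> W (T n)"
  shows "\<exists>U\<in>X. W U = S \<and> (\<forall>P. P \<subseteq> U \<longrightarrow> finite P \<longrightarrow> (\<exists>n. P \<subseteq> T n))"
proof -
  obtain t0 where t0: "t0 \<in> S" "0 \<in> fst t0" using tiling_covers[OF X_tiling[OF S]] .
  have t0n: "t0 \<in> W (T n)" for n using sub[of n] meetingI[OF t0, of "real n"] by auto
  have "\<exists>b. b \<in> T n \<and> t0 \<in> W {b}" for n using t0n[of n] mem_W_iff[of t0 "T n"] by blast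
  then have "\<forall>n. \<exists>b. b \<in> T n \<and> t0 \<in> W {b}" by (rule allI)
  from choice[OF this] obtain b where "\<forall>n. b n \<in> T n \<and> t0 \<in> W {b n}" by (rule exE)
  then have b: "\<And>n. b n \<in> T n" "\<And>n. t0 \<in> W {b n}" by simp_all
  \<comment> \<open>A parent of t0 is determined by its prototile A and by the tile s of \<omega> A
    that becomes t0, so the parents b n range over a finite set.\<close>
  let ?F = "\<lambda>(A, s). tile_shift (inv \<phi> (THE g. tile_shift g s = t0)) A"
  let ?B = "?F ` (Sigma \<A> \<omega>)"
  have "b n \<in> ?B" for n
  proof -
    obtain A x where A: "A \<in> \<A>" "b n = tile_shift x A"
      using X_of_type[OF TX b(1)[of n]] by (auto simp: of_type_def)
    let ?s = "tile_shift (- \<phi> x) t0"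
    have s: "?s \<in> \<omega> A" using b(2)[of n] by (simp add: A W_single)
    have "(THE g. tile_shift g ?s = t0) = \<phi> x"
    proof (rule the_equality)
      fix y assume "tile_shift y ?s = t0"
      then have "tile_shift (- \<phi> x + y) t0 = tile_shift 0 t0" by simp
      from tile_shift_eq_imp[OF this X_is_tile[OF S t0(1)]] show "y = \<phi> x" by simp
    qed simp
    then have "b n = ?F (A, ?s)"
      unfolding prod.case using A(2) by (simp only: inv_f_f[OF bij_is_inj[OF bij_\<phi>]])
    then show ?thesis by (rule image_eqI) (simp only: mem_Sigma_iff A(1) s)
  qed
  moreover have "finite ?B" by (intro finite_imageI finite_SigmaI finite_prototiles finite_subst)
  ultimately have "\<exists>g c. strict_mono (g :: nat \<Rightarrow> nat) \<and> (\<forall>n. b (g n) = c) \<and> c \<in> ?B"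
    by (intro finite_range_const_subseq)
  then obtain g c where g: "strict_mono (g :: nat \<Rightarrow> nat)" "\<And>n. b (g n) = c"
    by (elim exE conjE) (rule that, assumption, erule spec)
  have "c \<in> T (g n)" for n using b(1)[of "g n"] g(2) by simp
  from limit_tiling[of "\<lambda>n. T (g n)" c, OF TX this] obtain U f
    where U: "U \<in> X" "c \<in> U" "strict_mono (f :: nat \<Rightarrow> nat)"
      "\<forall>P. P \<subseteq> U \<longrightarrow> finite P \<longrightarrow> (\<exists>N. \<forall>n\<ge>N. P \<subseteq> T (g (f n)))"
    by (elim bexE exE conjE) (rule that)
  have "W U \<subseteq> S"
  proof
    fix s assume s: "s \<in> W U"
    then obtain u where u: "u \<in> U" "s \<in> W {u}" using mem_W_iff[of s U] by blast
    obtain t where t: "t \<in> S" "overlap s t"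
      using X_overlap_ex[OF S of_type_is_tile[OF of_type_W[OF s]]] by blast
    obtain N where N: "\<And>n. n \<ge> N \<Longrightarrow> {u} \<subseteq> T (g (f n))" using U(4)[rule_format, of "{u}"] u(1) by auto
    obtain M where M: "\<And>n. n \<ge> M \<Longrightarrow> t \<in> meeting S (real n)"
      using meeting_eventually[OF t(1) X_is_tile[OF S t(1)]] by blast
    \<comment> \<open>An index so large that T contains u and that its image contains t, so that s
      and t meet in one tiling.\<close>
    let ?n = "g (f (max N M))"
    have "u \<in> T ?n" using N[of "max N M"] by auto
    then have s': "s \<in> W (T ?n)" using u(2) mem_W_iff[of s "T ?n"] by blast
    have "?n \<ge> M"
      using seq_suble[OF g(1), of "f (max N M)"] seq_suble[OF U(3), of "max N M"] by simp
    then have "t \<in> W (T ?n)" using sub M by blast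
    then have "s = t" using X_unique[OF X_W[OF TX] s'] t(2) by blast
    then show "s \<in> S" using t(1) by simp
  qed
  then have "W U = S" using tiling_subset_eq[OF X_tiling[OF X_W[OF U(1)]] X_tiling[OF S]] by simp
  moreover have "\<exists>n. P \<subseteq> T n" if "P \<subseteq> U" "finite P" for P using U(4)[rule_format, OF that] by auto
  ultimately show ?thesis by (intro bexI[of _ U] conjI allI impI U(1))
qed

lemma surj_\<phi>: obtains x where "\<phi> x = y"
  using bij_is_surj[OF bij_\<phi>] by (metis surjD)

text \<open>Legality places each finite patch of S inside at least one substitution of a prototile,
  and admissibility places that prototile in a tiling. Leaving out the last substitution gives a
  preimage over the patch.\<close>

lemma W_surj:
  assumes S: "S \<in> X" shows "\<exists>U\<in>X. W U = S"
proof -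
  have "\<exists>T\<in>X. meeting S (real n) \<subseteq> W T" for n :: nat
  proof -
    obtain m A x where m: "m \<ge> 1" "A \<in> \<A>" "shift x (meeting S (real n)) \<subseteq> (W ^^ m) {A}"
      using X_legal[OF S meeting_subset finite_meeting[OF S]] .
    obtain T where T: "T \<in> X" "A \<in> T" using admissible m(2) unfolding admissible_def by blast
    obtain k where k: "m = Suc k" using m(1) by (cases m) auto
    obtain y where y: "\<phi> y = - x" using surj_\<phi> .
    have "(W ^^ m) {A} \<subseteq> (W ^^ m) T" using T(2) by (intro Wn_mono) simp
    with m(3) have "shift x (meeting S (real n)) \<subseteq> W ((W ^^ k) T)"
      unfolding k funpow.simps comp_def by (rule order_trans)
    then have "meeting S (real n) \<subseteq> shift (- x) (W ((W ^^ k) T))"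
      unfolding shift_subset_shift_iff .
    also have "\<dots> = W (shift y ((W ^^ k) T))" by (simp add: W_shift y)
    finally show ?thesis using X_Wn[OF T(1), of k] by (intro bexI[of _ "shift y ((W ^^ k) T)"]) simp_all
  qed
  then have "\<forall>n::nat. \<exists>T. T \<in> X \<and> meeting S (real n) \<subseteq> W T" by blast
  from choice[OF this] obtain T where T: "\<forall>n::nat. T n \<in> X \<and> meeting S (real n) \<subseteq> W (T n)" by (rule exE)
  have "\<exists>U\<in>X. W U = S \<and> (\<forall>P. P \<subseteq> U \<longrightarrow> finite P \<longrightarrow> (\<exists>n. P \<subseteq> T n))"
    by (rule desubstitute[OF S]) (simp_all add: T)
  then show ?thesis by blast
qed

lemma Wn_surj:
  assumes S: "S \<in> X" shows "\<exists>U\<in>X. (W ^^ n) U = S"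
proof (induction n)
  case 0 show ?case using S by auto
next
  case (Suc n)
  then obtain U where U: "U \<in> X" "(W ^^ n) U = S" by blast
  obtain V where "V \<in> X" "W V = U" using W_surj[OF U(1)] by blast
  then show ?case using U(2) by (intro bexI[of _ V]) (auto simp: funpow_Suc_right simp del: funpow.simps(2))
qed

end

subsection \<open>Minimal components and periodic tiles\<close>

text \<open>For tilings of \<open>X\<close> this means that S lies in the orbit closure of T, as
  \<open>sublang_approx\<close> and \<open>closure_of_orbit_sublang\<close> show. It allows
  minimality to be treated without the metric.\<close>

definition sublang :: "('d::finite, 'l) tile set \<Rightarrow> ('d, 'l) tile set \<Rightarrow> bool" where
  "sublang S T \<longleftrightarrow> (\<forall>P. P \<subseteq> S \<longrightarrow> finite P \<longrightarrow> (\<exists>x. shift x P \<subseteq> T))"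

lemma sublangD: "sublang S T \<Longrightarrow> P \<subseteq> S \<Longrightarrow> finite P \<Longrightarrow> \<exists>x. shift x P \<subseteq> T"
  unfolding sublang_def by blast

lemma sublang_refl: "sublang T T"
  unfolding sublang_def by (metis shift_0)

lemma sublang_trans:
  assumes "sublang R S" "sublang S T" shows "sublang R T"
  unfolding sublang_def
proof (intro allI impI)
  fix P assume "P \<subseteq> R" "finite P"
  then obtain x where "shift x P \<subseteq> S" using sublangD[OF assms(1)] by meson
  with \<open>finite P\<close> obtain y where "shift y (shift x P) \<subseteq> T" using sublangD[OF assms(2)] by (meson finite_shift)
  then show "\<exists>x. shift x P \<subseteq> T" unfolding shift_shift by (rule exI)
qed

lemma sublang_shift: "sublang (shift g T) T"
  unfolding sublang_def shift_subset_shift_iff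
proof (intro allI impI)
  fix P assume "P \<subseteq> shift g T"
  then have "P \<subseteq> shift (- (- g)) T" by simp
  then show "\<exists>x. P \<subseteq> shift (- x) T" by (rule exI)
qed

text \<open>If s - v and a tile t overlapping s belong to S, a translate of {s - v, t} lies in T.
  There the period moves s - v to s, and uniqueness in T gives s = t.\<close>

lemma sublang_shift_period:
  assumes sub: "sublang S T" and T: "is_tiling T" "shift v T = T" and S: "is_tiling S"
  shows "shift v S = S"
proof -
  have "shift v S \<subseteq> S"
  proof
    fix s assume "s \<in> shift v S"
    then have s: "tile_shift (- v) s \<in> S" by simp
    then have "is_tile s" using S unfolding is_tiling_def by (metis is_tile_shift)
    then obtain t where t: "t \<in> S" "overlap s t" using tiling_overlap_ex[OF S] by blast
    obtain x where "shift x {tile_shift (- v) s, t} \<subseteq> T"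
      using sublangD[OF sub, of "{tile_shift (- v) s, t}"] s t(1) by auto
    then have x: "tile_shift x (tile_shift (- v) s) \<in> T" "tile_shift x t \<in> T" by simp_all
    have "tile_shift v (tile_shift x (tile_shift (- v) s)) \<in> shift v T" using x(1) by simp
    then have "tile_shift x s \<in> T" using T(2) by (simp add: algebra_simps)
    from tiling_unique[OF T(1) this x(2)] have "s = t" using t(2) by simp
    then show "s \<in> S" using t(1) by simp
  qed
  then show ?thesis using tiling_subset_eq[of "shift v S" S] S by simp
qed

section \<open>Occurrence of patches in terms of the tiling metric\<close>

lemma two_powr_bounds: "0 < (2::real) powr (-1/2)" "(2::real) powr (-1/2) < 1"
proof -
  have "(2::real) powr (-1/2) < 2 powr 0" by (rule powr_less_mono) auto
  then show "(2::real) powr (-1/2) < 1" by simp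
qed simp

lemma tiling_dist_le:
  assumes "0 < r" "r < 2 powr (-1/2)" "ball 0 (1/r) \<subseteq> supp (T \<inter> S)"
  shows "tiling_dist T S \<le> r"
proof -
  let ?S = "{r. 0 < r \<and> r < 2 powr (-1/2) \<and>
                  (\<exists>g. norm g \<le> r \<and> ball 0 (1/r) \<subseteq> supp (shift (- g) T \<inter> S))}"
  have "\<exists>g. norm g \<le> r \<and> ball 0 (1/r) \<subseteq> supp (shift (- g) T \<inter> S)"
    using assms(1,3) by (intro exI[of _ 0]) simp
  then have r: "r \<in> ?S" using assms(1,2) by simp
  then have "?S \<noteq> {}" by (metis empty_iff)
  then have "tiling_dist T S = min (2 powr (-1/2)) (Inf ?S)"
    unfolding tiling_dist_def Let_def by (simp only: if_False)
  also have "\<dots> \<le> Inf ?S" by (rule min.cobounded2)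
  also have "\<dots> \<le> r"
  proof (rule cInf_lower[OF r])
    show "bdd_below ?S" by (rule bdd_belowI[of _ 0]) simp
  qed
  finally show ?thesis .
qed

lemma tiling_dist_lessD:
  assumes "tiling_dist T S < e" "e \<le> 2 powr (-1/2)"
  shows "\<exists>r g. 0 < r \<and> r < e \<and> norm g \<le> r \<and> ball 0 (1/r) \<subseteq> supp (shift (- g) T \<inter> S)"
proof -
  let ?S = "{r. 0 < r \<and> r < 2 powr (-1/2) \<and>
                  (\<exists>g. norm g \<le> r \<and> ball 0 (1/r) \<subseteq> supp (shift (- g) T \<inter> S))}"
  have "?S \<noteq> {}"
  proof
    assume "?S = {}"
    \<comment> \<open>Without admissible radii the distance is the cap, which is not below
      e.\<close>
    then have "tiling_dist T S = 2 powr (-1/2)" unfolding tiling_dist_def Let_def by (simp only: simp_thms if_True)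
    then show False using assms by simp
  qed
  then have "tiling_dist T S = min (2 powr (-1/2)) (Inf ?S)"
    unfolding tiling_dist_def Let_def by (simp only: if_False)
  then have "Inf ?S < e" using assms by (simp add: min_less_iff_disj)
  from cInf_lessD[OF \<open>?S \<noteq> {}\<close> this] show ?thesis by blast
qed

context fpc_subst
begin

lemma tiling_open_occurs:
  assumes P: "finite P"
  shows "tiling_open X {S \<in> X. \<exists>x. shift x P \<subseteq> S}" (is "tiling_open X ?U")
  unfolding tiling_open_def
proof (intro conjI ballI)
  show "?U \<subseteq> X" by (rule Collect_subset)
  fix T assume "T \<in> ?U"
  then obtain x where T: "T \<in> X" and x: "shift x P \<subseteq> T" by blast
  let ?P = "shift x P"
  have "\<forall>p\<in>?P. \<exists>y. y \<in> interior (fst p)"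
    using x X_is_tile[OF T] is_tile_interior_nonempty by blast
  from bchoice[OF this] obtain y where y: "\<And>p. p \<in> ?P \<Longrightarrow> y p \<in> interior (fst p)" by blast
  have "finite (y ` ?P)" using P by simp
  then have "bounded (y ` ?P)" by (rule finite_imp_bounded)
  then obtain M where M: "M > 0" "\<And>p. p \<in> ?P \<Longrightarrow> norm (y p) \<le> M"
    unfolding bounded_pos by blast
  \<comment> \<open>Closeness e forces agreement, up to a shift g of norm below 1, on a ball of
    radius above M + 1, which contains all the points y p - g.\<close>
  define e where "e = min (2 powr (-1/2)) (1 / (M + 1))"
  have e: "e > 0" using M(1) two_powr_bounds by (simp add: e_def)
  have "S \<in> ?U" if S: "S \<in> X" "tiling_dist T S < e" for S
  proof -
    have "e \<le> 2 powr (-1/2)" by (simp add: e_def)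
    from tiling_dist_lessD[OF S(2) this] obtain r g
      where r: "0 < r" "r < e" "norm g \<le> r" "ball 0 (1/r) \<subseteq> supp (shift (- g) T \<inter> S)" by blast
    have "r < 1" using r(2) two_powr_bounds(2) unfolding e_def by linarith
    have "r < 1 / (M + 1)" using r(2) unfolding e_def by simp
    then have r': "M + 1 < 1 / r" using r(1) M(1) by (simp add: field_simps)
    have "shift (- g) ?P \<subseteq> S"
    proof
      fix q assume "q \<in> shift (- g) ?P"
      then have q: "tile_shift g q \<in> ?P" by (simp only: mem_shift minus_minus)
      let ?p = "tile_shift g q"
      have "norm (y ?p - g) \<le> norm (y ?p) + norm g" by (rule norm_triangle_ineq4)
      also have "\<dots> < 1 / r" using M(2)[OF q] r(3) \<open>r < 1\<close> r' by linarith
      finally have "y ?p - g \<in> ball 0 (1/r)" by simp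
      then have "y ?p - g \<in> supp (shift (- g) T \<inter> S)" using r(4) by (rule subsetD[rotated])
      then obtain t where t: "t \<in> shift (- g) T" "t \<in> S" "y ?p - g \<in> fst t"
        unfolding mem_supp_iff by blast
      have yq: "y ?p - g \<in> interior (fst q)" using y[OF q] by simp
      have "is_tile t" using X_is_tile[OF S(1) t(2)] .
      from is_tile_interior_meets[OF this t(3) open_interior yq] have "overlap t q"
        unfolding overlap_def .
      moreover have "tile_shift g q \<in> T" using x q by (rule subsetD)
      then have "q \<in> shift (- g) T" by (simp only: mem_shift minus_minus)
      moreover have "shift (- g) T \<in> X" using T by simp
      ultimately have "t = q" using X_unique t(1) by metis
      then show "q \<in> S" using t(2) by simp
    qed
    then have "\<exists>x. shift x P \<subseteq> S" unfolding shift_shift by (rule exI)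
    then show "S \<in> ?U" using S(1) by simp
  qed
  then show "\<exists>\<epsilon>>0. \<forall>S\<in>X. tiling_dist T S < \<epsilon> \<longrightarrow> S \<in> ?U" using e by blast
qed

lemma sublang_approx:
  assumes S: "S \<in> X" and sub: "sublang S T" and T: "T \<in> X" and e: "e > 0"
  shows "\<exists>g. tiling_dist S (shift (- g) T) < e"
proof -
  obtain r where r: "0 < r" "r < e" "r < 2 powr (-1/2)"
    using dense[of 0 "min e (2 powr (-1/2))"] e two_powr_bounds(1) by fastforce
  obtain x where "shift x (meeting S (1/r)) \<subseteq> T"
    using sublangD[OF sub meeting_subset finite_meeting[OF S]] by blast
  then have x: "meeting S (1/r) \<subseteq> shift (- x) T" unfolding shift_subset_shift_iff .
  have "ball 0 (1/r) \<subseteq> supp (S \<inter> shift (- x) T)"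
  proof
    fix y :: "real ^ 'd" assume "y \<in> ball 0 (1/r)"
    then have y: "norm y \<le> 1/r" by simp
    obtain t where t: "t \<in> S" "y \<in> fst t" using tiling_covers[OF X_tiling[OF S]] .
    have "t \<in> shift (- x) T" using meetingI[OF t y] x by blast
    then show "y \<in> supp (S \<inter> shift (- x) T)" using t unfolding mem_supp_iff by blast
  qed
  from tiling_dist_le[OF r(1,3) this] r(2) show ?thesis by (intro exI[of _ x]) simp
qed

text \<open>Minimality of the orbit closure of T in terms of patches.
  \<open>minimal_component_min_tiling\<close> and \<open>minimal_component_min_tilingD\<close>
  relate it to minimal components.\<close>

definition min_tiling :: "('d, 'l) tile set \<Rightarrow> bool" where
  "min_tiling T \<longleftrightarrow> T \<in> X \<and> (\<forall>S\<in>X. sublang S T \<longrightarrow> sublang T S)"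

lemma min_tilingD: "min_tiling T \<Longrightarrow> T \<in> X"
  "min_tiling T \<Longrightarrow> S \<in> X \<Longrightarrow> sublang S T \<Longrightarrow> sublang T S"
  by (simp_all add: min_tiling_def)

text \<open>The set is closed because a patch foreign to T that occurs in a tiling occurs in all
  tilings near it. Orbits are dense because minimality makes any two members contain each other's
  patches.\<close>

lemma minimal_component_min_tiling:
  assumes "min_tiling T" shows "minimal_component X {S \<in> X. sublang S T}" (is "minimal_component X ?C")
  unfolding minimal_component_def
proof (intro conjI ballI allI)
  note T = min_tilingD[OF assms]
  show "?C \<noteq> {}" using T(1) sublang_refl by blast
  show "closedin (tiling_topology X) ?C"
    unfolding closedin_def topspace_tiling_topology openin_tiling_topology
  proof (intro conjI)
    show "?C \<subseteq> X" by (rule Collect_subset)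
    show "tiling_open X (X - ?C)"
      unfolding tiling_open_def
    proof (intro conjI ballI)
      show "X - ?C \<subseteq> X" by (rule Diff_subset)
      fix S assume "S \<in> X - ?C"
      then have S: "S \<in> X" "\<not> sublang S T" by simp_all
      then obtain P where P: "P \<subseteq> S" "finite P" "\<not> (\<exists>x. shift x P \<subseteq> T)" unfolding sublang_def by blast
      have "\<exists>x. shift x P \<subseteq> S" using P(1) by (intro exI[of _ 0]) simp
      then have "S \<in> {S \<in> X. \<exists>x. shift x P \<subseteq> S}" using S(1) by simp
      from tiling_openD[OF tiling_open_occurs[OF P(2)] this] obtain e
        where e: "e > 0" "\<forall>R\<in>X. tiling_dist S R < e \<longrightarrow> R \<in> {S \<in> X. \<exists>x. shift x P \<subseteq> S}" .
      have "R \<in> X - ?C" if R: "R \<in> X" "tiling_dist S R < e" for R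
      proof -
        obtain x where x: "shift x P \<subseteq> R" using e(2) R by blast
        have "\<not> sublang R T"
        proof
          assume "sublang R T"
          from sublangD[OF this x] P(2) obtain y where "shift y (shift x P) \<subseteq> T" by auto
          then have "\<exists>x. shift x P \<subseteq> T" unfolding shift_shift by (rule exI)
          then show False using P(3) by (rule notE[rotated])
        qed
        then show ?thesis using R(1) by simp
      qed
      then show "\<exists>\<epsilon>>0. \<forall>R\<in>X. tiling_dist S R < \<epsilon> \<longrightarrow> R \<in> X - ?C" using e(1) by blast
    qed
  qed
  show "shift (- g) S \<in> ?C" if "S \<in> ?C" for S g
    using that sublang_trans[OF sublang_shift[of "- g" S]] by simp
  show "?C \<subseteq> tiling_topology X closure_of range (\<lambda>g. shift (- g) S)" if S: "S \<in> ?C" for S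
  proof
    fix R assume R: "R \<in> ?C"
    have S': "S \<in> X" "sublang S T" and R': "R \<in> X" "sublang R T" using S R by simp_all
    have sub: "sublang R S" using sublang_trans[OF R'(2) T(2)[OF S']] .
    show "R \<in> tiling_topology X closure_of range (\<lambda>g. shift (- g) S)"
      unfolding in_closure_of topspace_tiling_topology openin_tiling_topology
    proof (intro conjI allI impI R'(1))
      fix U assume U: "R \<in> U \<and> tiling_open X U"
      then obtain e where e: "e > 0" "\<forall>S\<in>X. tiling_dist R S < e \<longrightarrow> S \<in> U"
        using tiling_openD[of X U R] by blast
      obtain g where g: "tiling_dist R (shift (- g) S) < e"
        using sublang_approx[OF R'(1) sub S'(1) e(1)] by blast
      have "shift (- g) S \<in> X" using S'(1) by simp
      then have "shift (- g) S \<in> U" using e(2) g by blast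
      then show "\<exists>y. y \<in> range (\<lambda>g. shift (- g) S) \<and> y \<in> U" by blast
    qed
  qed
qed

lemma closure_of_orbit_sublang:
  assumes T: "T \<in> X" and cl: "T \<in> tiling_topology X closure_of range (\<lambda>g. shift (- g) S)"
  shows "sublang T S"
  unfolding sublang_def
proof (intro allI impI)
  fix P assume P: "P \<subseteq> T" "finite P"
  have "\<exists>x. shift x P \<subseteq> T" using P(1) by (intro exI[of _ 0]) simp
  then have "T \<in> {S \<in> X. \<exists>x. shift x P \<subseteq> S}" using T by simp
  moreover have "openin (tiling_topology X) {S \<in> X. \<exists>x. shift x P \<subseteq> S}"
    unfolding openin_tiling_topology by (rule tiling_open_occurs[OF P(2)])
  ultimately obtain R where R: "R \<in> range (\<lambda>g. shift (- g) S)" "R \<in> {S \<in> X. \<exists>x. shift x P \<subseteq> S}"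
    using cl unfolding in_closure_of by meson
  obtain g x where "R = shift (- g) S" "shift x P \<subseteq> R" using R by blast
  then have "shift x P \<subseteq> shift (- g) S" by simp
  then have "shift g (shift x P) \<subseteq> S" unfolding shift_subset_shift_iff[of g] .
  then show "\<exists>x. shift x P \<subseteq> S" unfolding shift_shift by (rule exI)
qed

text \<open>A tiling S with patches from T is a limit of translates of T, so it stays in the closed
  set C; the density of its orbit then returns every patch of T.\<close>

lemma minimal_component_min_tilingD:
  assumes C: "minimal_component X C" and T: "T \<in> C"
  shows "min_tiling T"
  unfolding min_tiling_def
proof (intro conjI ballI impI)
  have closed: "C \<subseteq> X" "tiling_open X (X - C)"
    using C unfolding minimal_component_def closedin_def topspace_tiling_topology openin_tiling_topology
    by simp_all
  show TX: "T \<in> X" using closed(1) T by blast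
  fix S assume S: "S \<in> X" "sublang S T"
  have "S \<in> C"
  proof (rule ccontr)
    assume "S \<notin> C"
    with S(1) have "S \<in> X - C" by simp
    from tiling_openD[OF closed(2) this] obtain e
      where e: "e > 0" "\<forall>R\<in>X. tiling_dist S R < e \<longrightarrow> R \<in> X - C" .
    obtain g where g: "tiling_dist S (shift (- g) T) < e"
      using sublang_approx[OF S TX e(1)] by blast
    have "shift (- g) T \<in> X" using TX by simp
    then have "shift (- g) T \<notin> C" using e(2) g by blast
    then show False using C T unfolding minimal_component_def by blast
  qed
  then have cl: "T \<in> tiling_topology X closure_of range (\<lambda>g. shift (- g) S)"
    using C T unfolding minimal_component_def by blast
  show "sublang T S" by (rule closure_of_orbit_sublang[OF TX cl])
qed

text \<open>A component may show its period in one tiling and the tile A in another. The second has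
  only patches of the first, so \<open>sublang_shift_period\<close> gives it the period too.\<close>

lemma A_per_iff:
  "A \<in> A_per \<A> \<phi> \<omega> \<longleftrightarrow> A \<in> \<A> \<and>
     (\<exists>T v x. min_tiling T \<and> v \<noteq> 0 \<and> shift v T = T \<and> tile_shift x A \<in> T)"
proof (intro iffI conjI)
  assume A: "A \<in> A_per \<A> \<phi> \<omega>"
  then show "A \<in> \<A>" by (simp add: A_per_def)
  obtain C T x where C: "periodic_component X C" "T \<in> C" "tile_shift x A \<in> T"
    using A unfolding A_per_def by blast
  then obtain S v where S: "minimal_component X C" "S \<in> C" "v \<noteq> 0" "shift v S = S"
    unfolding periodic_component_def by blast
  have T: "min_tiling T" "min_tiling S"
    using minimal_component_min_tilingD S(1,2) C(2) by blast+
  have "T \<in> tiling_topology X closure_of range (\<lambda>g. shift (- g) S)"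
    using S(1,2) C(2) unfolding minimal_component_def by blast
  from closure_of_orbit_sublang[OF min_tilingD(1)[OF T(1)] this] have "sublang T S" .
  from sublang_shift_period[OF this X_tiling[OF min_tilingD(1)[OF T(2)]] S(4) X_tiling[OF min_tilingD(1)[OF T(1)]]]
  have "shift v T = T" .
  then show "\<exists>T v x. min_tiling T \<and> v \<noteq> 0 \<and> shift v T = T \<and> tile_shift x A \<in> T"
    by (intro exI[of _ T] exI[of _ v] exI[of _ x] conjI T(1) S(3) C(3))
next
  assume A: "A \<in> \<A> \<and> (\<exists>T v x. min_tiling T \<and> v \<noteq> 0 \<and> shift v T = T \<and> tile_shift x A \<in> T)"
  then obtain T v x where T: "min_tiling T" "v \<noteq> 0" "shift v T = T" "tile_shift x A \<in> T" by blast
  let ?C = "{S \<in> X. sublang S T}"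
  have TC: "T \<in> ?C" using min_tilingD(1)[OF T(1)] sublang_refl by blast
  then have "periodic_component X ?C"
    unfolding periodic_component_def using minimal_component_min_tiling[OF T(1)] T(2,3) by blast
  then show "A \<in> A_per \<A> \<phi> \<omega>"
    unfolding A_per_def using A TC T(4) by blast
qed

lemma sublang_W:
  assumes "sublang S T" shows "sublang (W S) (W T)"
  unfolding sublang_def
proof (intro allI impI)
  fix P assume P: "P \<subseteq> W S" "finite P"
  have "\<forall>p\<in>P. \<exists>t. t \<in> S \<and> p \<in> W {t}" using P(1) mem_W_iff[of _ S] by blast
  from bchoice[OF this] obtain f where f: "\<And>p. p \<in> P \<Longrightarrow> f p \<in> S \<and> p \<in> W {f p}" by blast
  have "f ` P \<subseteq> S" "finite (f ` P)" using f P(2) by blast+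
  from sublangD[OF assms this] obtain x where x: "shift x (f ` P) \<subseteq> T" by blast
  have "P \<subseteq> W (f ` P)"
  proof
    fix p assume "p \<in> P"
    then show "p \<in> W (f ` P)" using f by (subst mem_W_iff) blast
  qed
  then have "shift (\<phi> x) P \<subseteq> W (shift x (f ` P))" unfolding W_shift by (rule shift_mono)
  also have "\<dots> \<subseteq> W T" using Wn_mono[OF x, of 1] by simp
  finally show "\<exists>x. shift x P \<subseteq> W T" by (rule exI)
qed

text \<open>A tiling S with patches from \<open>W T\<close> can be desubstituted along translates of
  T, so its preimage U has only patches of T. Minimality of T returns all patches of T in U, hence
  those of \<open>W T\<close> in S.\<close>

lemma min_tiling_W:
  assumes "min_tiling T" shows "min_tiling (W T)"
  unfolding min_tiling_def
proof (intro conjI ballI impI)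
  note T = min_tilingD[OF assms]
  show "W T \<in> X" using X_W[OF T(1)] .
  fix S assume S: "S \<in> X" "sublang S (W T)"
  have "\<exists>R. R \<in> X \<and> sublang R T \<and> meeting S (real n) \<subseteq> W R" for n :: nat
  proof -
    obtain x where x: "shift x (meeting S (real n)) \<subseteq> W T"
      using sublangD[OF S(2) meeting_subset finite_meeting[OF S(1)]] by blast
    obtain y where y: "\<phi> y = - x" using surj_\<phi> .
    have "meeting S (real n) \<subseteq> W (shift y T)"
      using x by (simp only: W_shift y shift_subset_shift_iff)
    then show ?thesis using T(1) sublang_shift by (intro exI[of _ "shift y T"]) simp
  qed
  then have "\<forall>n::nat. \<exists>R. R \<in> X \<and> sublang R T \<and> meeting S (real n) \<subseteq> W R" by (rule allI)
  from choice[OF this] obtain R where R: "\<forall>n::nat. R n \<in> X \<and> sublang (R n) T \<and> meeting S (real n) \<subseteq> W (R n)"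
    by (rule exE)
  have "\<exists>U\<in>X. W U = S \<and> (\<forall>P. P \<subseteq> U \<longrightarrow> finite P \<longrightarrow> (\<exists>n. P \<subseteq> R n))"
    by (rule desubstitute[OF S(1)]) (simp_all add: R)
  then obtain U where U: "U \<in> X" "W U = S" "\<forall>P. P \<subseteq> U \<longrightarrow> finite P \<longrightarrow> (\<exists>n. P \<subseteq> R n)" by blast
  have "sublang U T"
    unfolding sublang_def
  proof (intro allI impI)
    fix P assume P: "P \<subseteq> U" "finite P"
    then obtain n where n: "P \<subseteq> R n" using U(3) by blast
    show "\<exists>x. shift x P \<subseteq> T" by (rule sublangD[OF _ n P(2)]) (simp add: R)
  qed
  from sublang_W[OF T(2)[OF U(1) this]] show "sublang (W T) S" unfolding U(2) .
qed

text \<open>\<open>W\<close> sends a minimal tiling with period v to a minimal tiling with the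
  nonzero period \<phi> v.\<close>

lemma A_per_W:
  assumes "A \<in> A_per \<A> \<phi> \<omega>" "t \<in> W {A}" shows "of_type (A_per \<A> \<phi> \<omega>) t"
proof -
  obtain T v x where T: "A \<in> \<A>" "min_tiling T" "v \<noteq> 0" "shift v T = T" "tile_shift x A \<in> T"
    using assms(1) unfolding A_per_iff by blast
  have v: "\<phi> v \<noteq> 0" using T(3) funpow_eq_iff[of 1 v 0] phi_pow_zero[of 1] by simp
  have per: "shift (\<phi> v) (W T) = W T" using T(4) W_shift[of v T] by simp
  obtain B y where B: "B \<in> \<A>" "t = tile_shift y B" using of_type_W[OF assms(2)] unfolding of_type_def by blast
  have "tile_shift (\<phi> x) t \<in> W {tile_shift x A}"
    using mem_Wn_tile_shift[of t 1 A x] assms(2) by simp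
  then have "tile_shift (\<phi> x) t \<in> W T" using mem_W_iff[of _ T] T(5) by blast
  then have "tile_shift (y + \<phi> x) B \<in> W T" using B(2) by simp
  then have "B \<in> A_per \<A> \<phi> \<omega>"
    unfolding A_per_iff using B(1) min_tiling_W[OF T(2)] v per by blast
  then show ?thesis unfolding B(2) by (rule of_type_prototile)
qed

abbreviation "per \<equiv> of_type (A_per \<A> \<phi> \<omega>)"
abbreviation "nonp \<equiv> of_type (A_nonp \<A> \<phi> \<omega>)"

lemma per_of_type: "per t \<Longrightarrow> of_type \<A> t"
  by (rule of_type_mono) (auto simp: A_per_def)

lemma nonp_of_type: "nonp t \<Longrightarrow> of_type \<A> t"
  by (rule of_type_mono) (auto simp: A_nonp_def)

lemma nonp_iff: "of_type \<A> t \<Longrightarrow> nonp t \<longleftrightarrow> \<not> per t"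
proof
  assume "nonp t" show "\<not> per t"
  proof
    assume "per t"
    then obtain A x where A: "A \<in> A_per \<A> \<phi> \<omega>" "t = tile_shift x A" unfolding of_type_def by blast
    obtain B y where B: "B \<in> A_nonp \<A> \<phi> \<omega>" "t = tile_shift y B" using \<open>nonp t\<close> unfolding of_type_def by blast
    have "A \<in> \<A>" "B \<in> \<A>" using A(1) B(1) by (simp_all add: A_per_def A_nonp_def)
    from tile_shift_prototile_eq_iff[OF this, of x y] have "A = B" using A(2) B(2) by simp
    then show False using A(1) B(1) by (simp add: A_nonp_def)
  qed
next
  assume "of_type \<A> t" "\<not> per t"
  then obtain A x where A: "A \<in> \<A>" "t = tile_shift x A" unfolding of_type_def by blast
  with \<open>\<not> per t\<close> have "A \<notin> A_per \<A> \<phi> \<omega>" using of_type_prototile(1) by metis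
  then have "A \<in> A_nonp \<A> \<phi> \<omega>" using A(1) by (simp add: A_nonp_def)
  then show "nonp t" unfolding A(2) by (rule of_type_prototile)
qed

lemma per_Wn: "per t \<Longrightarrow> s \<in> (W ^^ n) {t} \<Longrightarrow> per s"
proof (induction n arbitrary: s)
  case (Suc n)
  then have "s \<in> W ((W ^^ n) {t})" by simp
  then obtain u where u: "u \<in> (W ^^ n) {t}" "s \<in> W {u}" using mem_W_iff by blast
  from Suc.IH[OF Suc.prems(1) u(1)] obtain A x where A: "A \<in> A_per \<A> \<phi> \<omega>" "u = tile_shift x A"
    unfolding of_type_def by blast
  have "tile_shift (- \<phi> x) s \<in> W {A}"
    using u(2) Wn_tile_shift[of 1 x A] by (simp add: A(2))
  from A_per_W[OF A(1) this] show ?case by simp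
qed simp

text \<open>By FPC there are countably many patches up to translation, which permits a greedy
  construction: for each in turn the class is restricted to the tilings that avoid it, if there are
  any. A limit tiling lying in all the classes has only unavoidable patches.\<close>

lemma ex_min_tiling:
  assumes T0: "T0 \<in> X" shows "\<exists>T. min_tiling T \<and> sublang T T0"
proof -
  have "\<exists>\<Q>. finite \<Q> \<and> (\<forall>T\<in>X. \<forall>P. P \<subseteq> T \<and> finite P \<and> diameter (supp P) < real (Suc n) \<longrightarrow> (\<exists>Q\<in>\<Q>. \<exists>x. P = shift x Q))" for n :: nat
    using FPC unfolding FPC_def by simp
  then have "\<forall>n::nat. \<exists>\<Q>. finite \<Q> \<and> (\<forall>T\<in>X. \<forall>P. P \<subseteq> T \<and> finite P \<and> diameter (supp P) < real (Suc n) \<longrightarrow> (\<exists>Q\<in>\<Q>. \<exists>x. P = shift x Q))"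
    by (rule allI)
  from choice[OF this] obtain \<Q> where \<Q>: "\<forall>n::nat. finite (\<Q> n) \<and> (\<forall>T\<in>X. \<forall>P. P \<subseteq> T \<and> finite P \<and> diameter (supp P) < real (Suc n) \<longrightarrow> (\<exists>Q\<in>\<Q> n. \<exists>x. P = shift x Q))"
    by (rule exE)
  let ?QQ = "insert {} (\<Union>n. \<Q> n)"
  have "countable ?QQ" using \<Q> by (simp add: countable_finite)
  define q where "q = from_nat_into ?QQ"
  have q: "\<exists>n x. P = shift x (q n)" if P: "P \<subseteq> T" "finite P" "T \<in> X" for P T
  proof -
    obtain n :: nat where "diameter (supp P) < real n" using reals_Archimedean2 by blast
    then have "diameter (supp P) < real (Suc n)" by simp
    then obtain Q x where Q: "Q \<in> \<Q> n" "P = shift x Q" using \<Q> P by meson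
    then have "Q \<in> ?QQ" by blast
    then obtain m where "q m = Q" unfolding q_def using from_nat_into_surj[OF \<open>countable ?QQ\<close>] by blast
    then show ?thesis using Q(2) by (intro exI[of _ m] exI[of _ x]) simp
  qed
  \<comment> \<open>FPC does not say that the representatives are finite. An infinite Q never occurs
    and so leaves the class unchanged.\<close>
  define occ where "occ Q T \<longleftrightarrow> (\<exists>x. finite Q \<and> shift x Q \<subseteq> T)" for Q T :: "('d, 'l) tile set"
  define Y where "Y = rec_nat {S \<in> X. sublang S T0} (\<lambda>n Z. if \<exists>S\<in>Z. \<not> occ (q n) S then {S \<in> Z. \<not> occ (q n) S} else Z)"
  have Y0: "Y 0 = {S \<in> X. sublang S T0}" by (simp add: Y_def)
  have YS: "Y (Suc n) = (if \<exists>S\<in>Y n. \<not> occ (q n) S then {S \<in> Y n. \<not> occ (q n) S} else Y n)" for n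
    by (simp add: Y_def)
  have Yne: "\<exists>S. S \<in> Y n" for n
  proof (induction n)
    case 0 show ?case using T0 sublang_refl unfolding Y0 by blast
  next
    case (Suc n) then show ?case unfolding YS by (cases "\<exists>S\<in>Y n. \<not> occ (q n) S") auto
  qed
  have Ydec: "Y (Suc n) \<subseteq> Y n" for n unfolding YS by auto
  have Ydec': "Y n \<subseteq> Y m" if "m \<le> n" for m n using that
    by (rule lift_Suc_antimono_le[of Y, OF Ydec])
  have occ_sub: "occ Q T" if occ: "occ Q S" and sub: "sublang S T" for Q S T
  proof -
    obtain x where x: "finite Q" "shift x Q \<subseteq> S" using occ unfolding occ_def by blast
    from sublangD[OF sub x(2)] x(1) obtain y where "shift y (shift x Q) \<subseteq> T" by auto
    then show ?thesis unfolding occ_def shift_shift using x(1) by blast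
  qed
  \<comment> \<open>Each class is closed under passing to a smaller set of patches, in particular
    under translation.\<close>
  have Ysub: "S \<in> Y n" if "S \<in> X" "sublang S T" "T \<in> Y n" for S T n
    using that(3)
  proof (induction n)
    case 0 then show ?case unfolding Y0 using that(1) sublang_trans[OF that(2)] by simp
  next
    case (Suc n)
    then have "T \<in> Y n" using Ydec by blast
    from Suc.IH[OF this] have S: "S \<in> Y n" .
    show ?case
    proof (cases "\<exists>S\<in>Y n. \<not> occ (q n) S")
      case True
      then have "\<not> occ (q n) T" using Suc.prems unfolding YS by simp
      then have "\<not> occ (q n) S" using occ_sub that(2) by blast
      then show ?thesis unfolding YS using True S by simp
    qed (use S in \<open>simp add: YS\<close>)
  qed
  have YX: "Y n \<subseteq> X" for n using Ydec'[of 0 n] unfolding Y0 by auto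
  \<comment> \<open>A tile moved to its prototile position provides, after a pigeonhole over the
    prototiles, the common tile that \<open>limit_tiling\<close> requires.\<close>
  have "\<exists>S A. S \<in> Y n \<and> A \<in> \<A> \<and> A \<in> S" for n
  proof -
    obtain S where S: "S \<in> Y n" using Yne by blast
    then have SX: "S \<in> X" using YX by blast
    obtain t where t: "t \<in> S" using tiling_covers[OF X_tiling[OF SX]] .
    obtain A x where A: "A \<in> \<A>" "t = tile_shift x A" using X_of_type[OF SX t] unfolding of_type_def by blast
    have "shift (- x) S \<in> Y n" using Ysub[OF _ sublang_shift S, of "- x"] SX by simp
    moreover have "A \<in> shift (- x) S" using t A(2) by simp
    ultimately show ?thesis using A(1) by blast
  qed
  then have "\<exists>p. fst p \<in> Y n \<and> snd p \<in> \<A> \<and> snd p \<in> fst p" for n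
    by (metis fst_conv snd_conv)
  then have "\<forall>n. \<exists>p. fst p \<in> Y n \<and> snd p \<in> \<A> \<and> snd p \<in> fst p" by (rule allI)
  from choice[OF this] obtain p where p: "\<forall>n. fst (p n) \<in> Y n \<and> snd (p n) \<in> \<A> \<and> snd (p n) \<in> fst (p n)" by (rule exE)
  have "\<exists>r c. strict_mono (r :: nat \<Rightarrow> nat) \<and> (\<forall>n. snd (p (r n)) = c) \<and> c \<in> \<A>"
    using finite_prototiles by (rule finite_range_const_subseq) (simp add: p)
  then obtain r c where r: "strict_mono (r :: nat \<Rightarrow> nat)" "\<And>n. snd (p (r n)) = c"
    by (elim exE conjE) (rule that, assumption, erule spec)
  have "\<exists>U\<in>X. \<exists>f. c \<in> U \<and> strict_mono (f :: nat \<Rightarrow> nat) \<and>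
    (\<forall>P. P \<subseteq> U \<longrightarrow> finite P \<longrightarrow> (\<exists>N. \<forall>n\<ge>N. P \<subseteq> fst (p (r (f n)))))"
  proof (rule limit_tiling)
    show "fst (p (r n)) \<in> X" for n using p YX by blast
    show "c \<in> fst (p (r n))" for n using p r(2)[of n] by metis
  qed
  then obtain U f where U: "U \<in> X" "strict_mono (f :: nat \<Rightarrow> nat)"
      "\<forall>P. P \<subseteq> U \<longrightarrow> finite P \<longrightarrow> (\<exists>N. \<forall>n\<ge>N. P \<subseteq> fst (p (r (f n))))"
    by (elim bexE exE conjE) (rule that)
  have appr: "\<exists>S\<in>Y m. P \<subseteq> S" if "P \<subseteq> U" "finite P" for P m
  proof -
    obtain N where N: "\<forall>n\<ge>N. P \<subseteq> fst (p (r (f n)))" using U(3) \<open>P \<subseteq> U\<close> \<open>finite P\<close> by blast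
    let ?n = "max N m"
    have "r (f ?n) \<ge> m"
      using seq_suble[OF r(1), of "f ?n"] seq_suble[OF U(2), of ?n] by simp
    then have "fst (p (r (f ?n))) \<in> Y m" using Ydec' p by blast
    moreover have "P \<subseteq> fst (p (r (f ?n)))" using N by simp
    ultimately show ?thesis by (rule bexI[rotated])
  qed
  have UY: "U \<in> Y n" for n
  proof (induction n)
    case 0
    have "sublang U T0"
      unfolding sublang_def
    proof (intro allI impI)
      fix P assume P: "P \<subseteq> U" "finite P"
      from appr[OF this, of 0] obtain S where "S \<in> Y 0" "P \<subseteq> S" by blast
      then show "\<exists>x. shift x P \<subseteq> T0" using sublangD[of S T0 P] P(2) unfolding Y0 by simp
    qed
    then show ?case unfolding Y0 using U(1) by simp
  next
    case (Suc n)
    show ?case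
    proof (cases "\<exists>S\<in>Y n. \<not> occ (q n) S")
      case True
      have "\<not> occ (q n) U"
      proof
        assume "occ (q n) U"
        then obtain x where x: "finite (q n)" "shift x (q n) \<subseteq> U" unfolding occ_def by blast
        then obtain S where S: "S \<in> Y (Suc n)" "shift x (q n) \<subseteq> S" using appr[OF x(2), of "Suc n"] by auto
        from S(1) True have "\<not> occ (q n) S" unfolding YS by simp
        then show False using S(2) x(1) unfolding occ_def by blast
      qed
      then show ?thesis unfolding YS using True Suc by simp
    qed (use Suc in \<open>simp add: YS\<close>)
  qed
  have "min_tiling U"
    unfolding min_tiling_def
  proof (intro conjI ballI impI U(1))
    fix S assume S: "S \<in> X" "sublang S U"
    show "sublang U S"
      unfolding sublang_def
    proof (intro allI impI)
      fix P assume P: "P \<subseteq> U" "finite P"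
      from q[OF P U(1)] obtain n x where n: "P = shift x (q n)" by blast
      have fin: "finite (q n)" using P(2) unfolding n by simp
      have "occ (q n) U" unfolding occ_def using P(1) fin n by blast
      \<comment> \<open>U lies in the next class although \<open>q n\<close> occurs in it, so no
        member of \<open>Y n\<close> avoids \<open>q n\<close>; S is such a member.\<close>
      then have "\<not> (\<exists>S\<in>Y n. \<not> occ (q n) S)" using UY[of "Suc n"] unfolding YS by (auto split: if_splits)
      moreover have "S \<in> Y n" using Ysub[OF S UY] .
      ultimately obtain y where "shift y (q n) \<subseteq> S" unfolding occ_def by blast
      then have "shift (- x + y) P \<subseteq> S" unfolding n by (simp add: algebra_simps)
      then show "\<exists>x. shift x P \<subseteq> S" by (rule exI)
    qed
  qed
  moreover have "sublang U T0" using UY[of 0] unfolding Y0 by simp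
  ultimately show ?thesis by blast
qed

end

subsection \<open>Local periods\<close>

lemma strict_mono_add_le:
  assumes "strict_mono (h :: nat \<Rightarrow> nat)" shows "h i + k \<le> h (i + k)"
proof (induction k)
  case (Suc k)
  have "h (i + k) < h (i + Suc k)" using assms by (simp add: strict_mono_def)
  then show ?case using Suc by simp
qed simp

locale border_subst = fpc_subst \<A> \<phi> \<omega> for \<A> :: "('d::finite, 'l) tile set" and \<phi> \<omega> +
  assumes border: "nonperiodic_border_condition \<A> \<phi> \<omega>"
begin

lemma frontier_image: "frontier ((\<phi> ^^ n) ` S) = (\<phi> ^^ n) ` frontier S"
proof -
  have inj: "inj (\<phi> ^^ n)" using bij_is_inj[OF bij_funpow] .
  show ?thesis
    unfolding frontier_def image_set_diff[OF inj] interior_image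
    using closure_injective_linear_image[OF linear_funpow inj] by simp
qed

lemma Wn_eq_mono:
  assumes "(W ^^ m) P = (W ^^ m) Q" "m \<le> n" shows "(W ^^ n) P = (W ^^ n) Q"
proof -
  obtain k where k: "n = k + m" using assms(2) by (metis le_add_diff_inverse2)
  show ?thesis unfolding k using assms(1) by (simp add: funpow_add)
qed

lemma surj_funpow: "\<exists>x. (\<phi> ^^ n) x = y"
  using bij_is_surj[OF bij_funpow, of n] by (metis surjD)

lemma Wn_fst_mem:
  assumes "of_type \<A> t" "s \<in> (W ^^ n) {t}" "(\<phi> ^^ n) v \<in> fst s" shows "v \<in> fst t"
proof -
  have "(\<phi> ^^ n) v \<in> (\<phi> ^^ n) ` fst t" using Wn_subset[OF assms(1,2)] assms(3) by (rule subsetD)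
  then show ?thesis using inj_image_mem_iff[OF bij_is_inj[OF bij_funpow]] by simp
qed

lemma Wn_interior_mem:
  assumes "of_type \<A> t" "s \<in> (W ^^ n) {t}" "(\<phi> ^^ n) v \<in> interior (fst s)" shows "v \<in> interior (fst t)"
proof -
  have "(\<phi> ^^ n) v \<in> (\<phi> ^^ n) ` interior (fst t)" using Wn_interior_subset[OF assms(1,2)] assms(3) by (rule subsetD)
  then show ?thesis using inj_image_mem_iff[OF bij_is_inj[OF bij_funpow]] by simp
qed

lemma X_Wn_parent:
  assumes "Q \<in> X" "s \<in> (W ^^ n) Q" obtains t where "t \<in> Q" "s \<in> (W ^^ n) {t}" "of_type \<A> t"
  using mem_WnE[OF assms(2)] X_of_type[OF assms(1)] by metis

text \<open>Descendants of periodic tiles are periodic, by \<open>per_Wn\<close>. This inheritance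
  by ancestors is what replaces unique desubstitution below.\<close>

lemma nonp_parent:
  assumes "of_type \<A> t" "s \<in> (W ^^ n) {t}" "nonp s" shows "nonp t"
proof (rule ccontr)
  assume "\<not> nonp t"
  then have "per t" using nonp_iff[OF assms(1)] by simp
  then have "per s" using assms(2) by (rule per_Wn)
  then show False using assms(3) nonp_iff[OF nonp_of_type[OF assms(3)]] by simp
qed

text \<open>The border condition puts the image of y into a nonperiodic tile s. It lies on the
  frontier of s because the interior of s is inside the interior of the whole patch, and so the step
  can be repeated.\<close>

lemma border_step:
  assumes t: "nonp t" and y: "y \<in> frontier (fst t)"
  shows "\<exists>s. s \<in> W {t} \<and> nonp s \<and> \<phi> y \<in> frontier (fst s)"
proof -
  obtain A x where A: "A \<in> A_nonp \<A> \<phi> \<omega>" "t = tile_shift x A" using t unfolding of_type_def by blast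
  then have AA: "A \<in> \<A>" by (simp add: A_nonp_def)
  have "y - x \<in> frontier (fst A)" using y by (simp add: A(2))
  then have fr: "\<phi> (y - x) \<in> frontier (supp (\<omega> A))"
    using frontier_image[of 1 "fst A"] by (simp add: supp_subst[OF AA])
  have "frontier (supp (\<omega> A)) \<subseteq> supp (nonp_part \<A> \<phi> \<omega> (\<omega> A))"
    using border A(1) unfolding nonperiodic_border_condition_def by (rule bspec)
  then have "\<phi> (y - x) \<in> supp (nonp_part \<A> \<phi> \<omega> (\<omega> A))" using fr by (rule subsetD)
  then obtain s where s: "s \<in> \<omega> A" "nonp s" "\<phi> (y - x) \<in> fst s"
    unfolding mem_supp_iff nonp_part_def by blast
  have "fst s \<subseteq> supp (\<omega> A)" using s(1) by (auto simp: supp_def)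
  then have "\<phi> (y - x) \<notin> interior (fst s)"
    using interior_mono fr unfolding frontier_def by blast
  moreover have "closed (fst s)" using is_tile_closed[OF is_tile_subst[OF AA s(1)]] .
  ultimately have "\<phi> (y - x) \<in> frontier (fst s)" using s(3) by (simp add: frontier_def)
  moreover have "\<phi> (y - x) = \<phi> y - \<phi> x" using phi_pow_diff[of 1] by simp
  ultimately have "\<phi> y \<in> frontier (fst (tile_shift (\<phi> x) s))" by simp
  moreover have "tile_shift (\<phi> x) s \<in> W {t}" using s(1) by (simp add: A(2) W_single[OF AA])
  moreover have "nonp (tile_shift (\<phi> x) s)" using s(2) by simp
  ultimately show ?thesis by (intro exI[of _ "tile_shift (\<phi> x) s"] conjI)
qed

lemma border_iter:
  assumes t: "nonp t" and y: "y \<in> frontier (fst t)"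
  shows "\<exists>s. s \<in> (W ^^ n) {t} \<and> nonp s \<and> (\<phi> ^^ n) y \<in> frontier (fst s)"
proof (induction n)
  case 0
  show ?case using assms by (intro exI[of _ t]) simp
next
  case (Suc n)
  then obtain s where s: "s \<in> (W ^^ n) {t}" "nonp s" "(\<phi> ^^ n) y \<in> frontier (fst s)" by blast
  from border_step[OF s(2,3)] obtain u where u: "u \<in> W {s}" "nonp u" "\<phi> ((\<phi> ^^ n) y) \<in> frontier (fst u)"
    by blast
  have "u \<in> W ((W ^^ n) {t})" using mem_W_iff[of u] s(1) u(1) by blast
  then show ?case using u(2,3) by (intro exI[of _ u]) simp
qed

lemma frontier_tile_mem: "is_tile t \<Longrightarrow> y \<in> frontier (fst t) \<Longrightarrow> y \<in> fst t"
  using is_tile_closed frontier_subset_closed by blast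

lemma ex_norm_bound: "\<exists>K\<ge>1. \<forall>x. norm (\<phi> x) \<le> K * norm x"
proof -
  obtain B where B: "B > 0" "\<And>x. norm (\<phi> x) \<le> B * norm x"
    using linear_bounded_pos[OF linear_\<phi>] by blast
  have "norm (\<phi> x) \<le> max 1 B * norm x" for x
    using B(2)[of x] mult_right_mono[of B "max 1 B" "norm x"] by simp
  then show ?thesis by (intro exI[of _ "max 1 B"]) simp
qed

lemma norm_funpow_le:
  assumes "K \<ge> 1" "\<And>x. norm (\<phi> x) \<le> K * norm x"
  shows "norm ((\<phi> ^^ n) x) \<le> K ^ n * norm x"
proof (induction n)
  case (Suc n)
  have "norm ((\<phi> ^^ Suc n) x) \<le> K * norm ((\<phi> ^^ n) x)" using assms(2) by simp
  also have "\<dots> \<le> K * (K ^ n * norm x)" using Suc assms(1) by (intro mult_left_mono) auto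
  finally show ?case by (simp add: mult.assoc)
qed simp

text \<open>The period arises from a closed loop. Near p a tile of \<open>(W ^^ N) R\<close> is also
  one of the substituted second preimage at level m; equal windows move it to level m', agreement
  takes it back to the first preimage there, and equal windows return it to level m. The two moves
  differ by y, the change of offset between the ancestors of a and b.\<close>

lemma local_period:
  assumes S: "S \<in> X" "S' \<in> X" and eq: "(W ^^ n0) S = (W ^^ n0) S'"
    and a: "a \<in> S" "nonp a" "a \<notin> S'" and e: "e > 0"
  shows "\<exists>R A p y N0. R \<in> X \<and> A \<in> R \<and> nonp A \<and> p \<in> frontier (fst A) \<and> y \<noteq> 0 \<and> norm y < e \<and>
    (\<forall>N\<ge>N0. \<forall>s\<in>(W ^^ N) R. \<forall>v. dist v p < 1 \<longrightarrow> (\<phi> ^^ N) v \<in> interior (fst s) \<longrightarrow>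
       tile_shift ((\<phi> ^^ N) y) s \<in> (W ^^ N) R)"
proof -
  obtain b where b: "b \<in> S'" "overlap a b"
    using X_overlap_ex[OF S(2) X_is_tile[OF S(1) a(1)]] by blast
  have "\<forall>m. \<exists>R. R \<in> X \<and> (W ^^ m) R = S" using Wn_surj[OF S(1)] by blast
  from choice[OF this] obtain R where R: "\<And>m. R m \<in> X" "\<And>m. (W ^^ m) (R m) = S" by blast
  have "\<forall>m. \<exists>R. R \<in> X \<and> (W ^^ m) R = S'" using Wn_surj[OF S(2)] by blast
  from choice[OF this] obtain R' where R': "\<And>m. R' m \<in> X" "\<And>m. (W ^^ m) (R' m) = S'" by blast
  have "\<exists>p. fst p \<in> \<A> \<and> tile_shift (snd p) (fst p) \<in> R m \<and> a \<in> (W ^^ m) {tile_shift (snd p) (fst p)}" for m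
  proof -
    have "a \<in> (W ^^ m) (R m)" using R(2) a(1) by simp
    then obtain t where t: "t \<in> R m" "a \<in> (W ^^ m) {t}" "of_type \<A> t" using X_Wn_parent[OF R(1)] by blast
    then obtain A x where "A \<in> \<A>" "t = tile_shift x A" unfolding of_type_def by blast
    then show ?thesis using t by (intro exI[of _ "(A, x)"]) simp
  qed
  then have "\<forall>m. \<exists>p. fst p \<in> \<A> \<and> tile_shift (snd p) (fst p) \<in> R m \<and> a \<in> (W ^^ m) {tile_shift (snd p) (fst p)}" by (rule allI)
  from choice[OF this] obtain p where p:
    "\<forall>m. fst (p m) \<in> \<A> \<and> tile_shift (snd (p m)) (fst (p m)) \<in> R m \<and> a \<in> (W ^^ m) {tile_shift (snd (p m)) (fst (p m))}"
    by (rule exE)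
  have "\<exists>p. fst p \<in> \<A> \<and> tile_shift (snd p) (fst p) \<in> R' m \<and> b \<in> (W ^^ m) {tile_shift (snd p) (fst p)}" for m
  proof -
    have "b \<in> (W ^^ m) (R' m)" using R'(2) b(1) by simp
    then obtain t where t: "t \<in> R' m" "b \<in> (W ^^ m) {t}" "of_type \<A> t" using X_Wn_parent[OF R'(1)] by blast
    then obtain A x where "A \<in> \<A>" "t = tile_shift x A" unfolding of_type_def by blast
    then show ?thesis using t by (intro exI[of _ "(A, x)"]) simp
  qed
  then have "\<forall>m. \<exists>p. fst p \<in> \<A> \<and> tile_shift (snd p) (fst p) \<in> R' m \<and> b \<in> (W ^^ m) {tile_shift (snd p) (fst p)}" by (rule allI)
  from choice[OF this] obtain p' where p':
    "\<forall>m. fst (p' m) \<in> \<A> \<and> tile_shift (snd (p' m)) (fst (p' m)) \<in> R' m \<and> b \<in> (W ^^ m) {tile_shift (snd (p' m)) (fst (p' m))}"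
    by (rule exE)
  define PA where "PA m = fst (p m)" for m
  define \<alpha> where "\<alpha> m = snd (p m)" for m
  define PB where "PB m = fst (p' m)" for m
  define \<beta> where "\<beta> m = snd (p' m)" for m
  have A: "PA m \<in> \<A>" "tile_shift (\<alpha> m) (PA m) \<in> R m" "a \<in> (W ^^ m) {tile_shift (\<alpha> m) (PA m)}" for m
    using p by (simp_all add: PA_def \<alpha>_def)
  have B: "PB m \<in> \<A>" "tile_shift (\<beta> m) (PB m) \<in> R' m" "b \<in> (W ^^ m) {tile_shift (\<beta> m) (PB m)}" for m
    using p' by (simp_all add: PB_def \<beta>_def)
  \<comment> \<open>The offset of the two ancestors, bounded because a and b, and hence the
    ancestors, overlap.\<close>
  define x where "x m = \<beta> m - \<alpha> m" for m
  have x_bound: "norm (x m) \<le> 2 * radius" for m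
  proof -
    have "overlap (tile_shift (\<alpha> m) (PA m)) (tile_shift (\<beta> m) (PB m))"
      by (rule overlap_Wn[OF of_type_prototile(1)[OF A(1)] A(3) of_type_prototile(1)[OF B(1)] B(3) b(2)])
    then obtain y where "y \<in> interior (fst (tile_shift (\<alpha> m) (PA m)))" "y \<in> interior (fst (tile_shift (\<beta> m) (PB m)))"
      unfolding overlap_def by blast
    then have "y - \<alpha> m \<in> fst (PA m)" "y - \<beta> m \<in> fst (PB m)"
      using interior_subset by auto
    then have "norm (y - \<alpha> m) \<le> radius" "norm (y - \<beta> m) \<le> radius"
      using prototile_norm_le A(1) B(1) by blast+
    then show ?thesis using norm_triangle_ineq4[of "y - \<alpha> m" "y - \<beta> m"] by (simp add: x_def)
  qed
  \<comment> \<open>Wide enough for the loop: its points lie within 3 * radius + 1 of \<beta> m on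
    the way out and, as norm y is below 1, within radius + 2 of \<alpha> m' on the way back.\<close>
  define r where "r = 3 * radius + 2"
  define P where "P m = meeting (shift (- \<alpha> m) (R m)) r" for m
  define P' where "P' m = meeting (shift (- \<beta> m) (R' m)) r" for m
  let ?V = "\<Union>C\<in>\<A>. {t. \<exists>T\<in>X. C \<in> T \<and> t \<in> meeting T r}"
  have finV: "finite ?V" by (intro finite_UN_I finite_prototiles finite_neighbours)
  have PV: "P m \<in> Pow ?V" "P' m \<in> Pow ?V" for m
  proof -
    have "shift (- \<alpha> m) (R m) \<in> X" "PA m \<in> shift (- \<alpha> m) (R m)" using R(1) A(2) by simp_all
    then show "P m \<in> Pow ?V" unfolding P_def using A(1) by blast
    have "shift (- \<beta> m) (R' m) \<in> X" "PB m \<in> shift (- \<beta> m) (R' m)" using R'(1) B(2) by simp_all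
    then show "P' m \<in> Pow ?V" unfolding P'_def using B(1) by blast
  qed
  have "\<exists>f c. strict_mono (f :: nat \<Rightarrow> nat) \<and> (\<forall>n. (PA (f n), PB (f n), P (f n), P' (f n)) = c)
     \<and> c \<in> \<A> \<times> \<A> \<times> Pow ?V \<times> Pow ?V"
  proof (rule finite_range_const_subseq)
    show "finite (\<A> \<times> \<A> \<times> Pow ?V \<times> Pow ?V)"
      using finV finite_prototiles by (intro finite_cartesian_product) (simp_all only: finite_Pow_iff)
    show "(PA m, PB m, P m, P' m) \<in> \<A> \<times> \<A> \<times> Pow ?V \<times> Pow ?V" for m
      by (intro SigmaI A(1) B(1) PV)
  qed
  then obtain f c where f: "strict_mono (f :: nat \<Rightarrow> nat)" "\<And>n. (PA (f n), PB (f n), P (f n), P' (f n)) = c"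
    by (elim exE conjE) (rule that, assumption, erule spec)
  have "bounded (range (x \<circ> f))" unfolding bounded_iff using x_bound by (intro exI[of _ "2 * radius"]) auto
  then obtain l g where g: "strict_mono (g :: nat \<Rightarrow> nat)" "((x \<circ> f) \<circ> g) \<longlonglongrightarrow> l"
    using bounded_imp_convergent_subsequence by blast
  define h where "h n = f (g n)" for n
  have h: "strict_mono h" using f(1) g(1) by (simp add: strict_mono_def h_def)
  have "Cauchy (\<lambda>n. x (h n))" using LIMSEQ_imp_Cauchy[OF g(2)] by (simp add: comp_def h_def)
  moreover have e': "min e 1 > 0" using e by simp
  ultimately obtain M where M: "\<And>i j. i \<ge> M \<Longrightarrow> j \<ge> M \<Longrightarrow> dist (x (h i)) (x (h j)) < min e 1"
    unfolding Cauchy_def by meson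
  define m where "m = h M"
  \<comment> \<open>The index is raised by n0 so that the two preimages at level m agree after m'
    substitutions, as the proof of y \<noteq> 0 requires.\<close>
  define m' where "m' = h (M + n0)"
  have m': "m + n0 \<le> m'" unfolding m_def m'_def by (rule strict_mono_add_le[OF h])
  have "(PA m, PB m, P m, P' m) = (PA m', PB m', P m', P' m')"
    unfolding m_def m'_def h_def f(2) by (rule refl)
  then have same: "PA m' = PA m" "PB m' = PB m" "P m' = P m" "P' m' = P' m" by simp_all
  define y where "y = x m' - x m"
  have y_small: "norm y < min e 1"
    using M[of "M + n0" M] by (simp add: y_def m_def m'_def dist_norm)
  define w where "w = \<alpha> m' - \<alpha> m"
  define w' where "w' = \<beta> m' - \<beta> m"
  have yw: "y = w' - w" by (simp add: y_def w_def w'_def x_def)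
  have agree: "(W ^^ N) (R i) = (W ^^ N) (R' i)" if "N \<ge> i + n0" for N i
  proof (rule Wn_eq_mono[OF _ that])
    have "(W ^^ (n0 + i)) (R i) = (W ^^ (n0 + i)) (R' i)"
      using eq by (simp only: Wn_Wn[symmetric] R(2) R'(2))
    then show "(W ^^ (i + n0)) (R i) = (W ^^ (i + n0)) (R' i)" by (simp only: add.commute)
  qed
  \<comment> \<open>With equal offsets one translation would carry both a and b into
    \<open>(W ^^ m') (R m)\<close>, where overlapping tiles are equal; but b belongs to S' and a
    does not.\<close>
  have "y \<noteq> 0"
  proof
    assume "y = 0"
    then have ww: "w' = w" using yw by simp
    let ?g = "- (\<phi> ^^ m') w"
    have "tile_shift ?g a \<in> (W ^^ m') {tile_shift (- w) (tile_shift (\<alpha> m') (PA m'))}"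
      using mem_Wn_tile_shift[OF A(3)[of m'], of "- w"] by (simp only: phi_pow_minus)
    then have a': "tile_shift ?g a \<in> (W ^^ m') {tile_shift (\<alpha> m) (PA m)}"
      by (simp add: same w_def)
    have "tile_shift ?g b \<in> (W ^^ m') {tile_shift (- w') (tile_shift (\<beta> m') (PB m'))}"
      using mem_Wn_tile_shift[OF B(3)[of m'], of "- w'"] by (simp only: phi_pow_minus ww)
    then have b': "tile_shift ?g b \<in> (W ^^ m') {tile_shift (\<beta> m) (PB m)}"
      by (simp add: same w'_def)
    have "tile_shift ?g a \<in> (W ^^ m') (R m)" using mem_WnI[OF A(2) a'] .
    moreover have "tile_shift ?g b \<in> (W ^^ m') (R m)"
      unfolding agree[OF m'] using mem_WnI[OF B(2) b'] .
    moreover have "overlap (tile_shift ?g a) (tile_shift ?g b)" using b(2) by simp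
    ultimately have "tile_shift ?g a = tile_shift ?g b" by (rule X_unique[OF X_Wn[OF R(1)]])
    then have "a = b" by simp
    then show False using b(1) a(3) by simp
  qed
  obtain p0 where p0: "p0 \<in> frontier (fst (PA m))"
    using is_tile_frontier_nonempty[OF is_tile_prototile[OF A(1)]] by blast
  have p0n: "norm p0 \<le> radius"
    using prototile_norm_le[OF A(1) frontier_tile_mem[OF is_tile_prototile[OF A(1)] p0]] .
  let ?A = "tile_shift (\<alpha> m) (PA m)" and ?p = "p0 + \<alpha> m"
  \<comment> \<open>For N \<ge> m' + n0 the two preimages agree both at level m and at level
    m'.\<close>
  have "tile_shift ((\<phi> ^^ N) y) s \<in> (W ^^ N) (R m)"
    if N: "N \<ge> m' + n0" and s: "s \<in> (W ^^ N) (R m)" and v: "dist v ?p < 1" "(\<phi> ^^ N) v \<in> interior (fst s)" for N s v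
  proof -
    have vp: "norm (v - (p0 + \<alpha> m)) < 1" using v(1) by (simp add: dist_norm)
    have v\<alpha>: "norm (v - \<alpha> m) \<le> radius + 1"
      using norm_triangle_ineq[of "v - (p0 + \<alpha> m)" p0] vp p0n by (simp add: algebra_simps)
    have v\<beta>: "norm (v - \<beta> m) \<le> 3 * radius + 1"
      using norm_triangle_ineq4[of "v - \<alpha> m" "x m"] v\<alpha> x_bound[of m] by (simp add: x_def algebra_simps)
    have "s \<in> (W ^^ N) (R' m)" using s agree[of m N] N m' by simp
    then obtain t where t: "t \<in> R' m" "s \<in> (W ^^ N) {t}" "of_type \<A> t" using X_Wn_parent[OF R'(1)] by blast
    have "v \<in> fst t" using Wn_interior_mem[OF t(3,2) v(2)] interior_subset by blast
    then have "v - \<beta> m \<in> fst (tile_shift (- \<beta> m) t)" by simp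
    moreover have "tile_shift (- \<beta> m) t \<in> shift (- \<beta> m) (R' m)" using t(1) by simp
    ultimately have "tile_shift (- \<beta> m) t \<in> P' m"
      unfolding P'_def by (intro meetingI[of _ _ "v - \<beta> m"]) (use v\<beta> in \<open>simp_all add: r_def\<close>)
    then have "tile_shift (- \<beta> m) t \<in> P' m'" using same by simp
    then have "tile_shift (- \<beta> m) t \<in> shift (- \<beta> m') (R' m')" unfolding P'_def using meeting_subset by blast
    then have t': "tile_shift w' t \<in> R' m'" by (simp add: w'_def)
    define s1 where "s1 = tile_shift ((\<phi> ^^ N) w') s"
    have "s1 \<in> (W ^^ N) (R' m')"
      unfolding s1_def by (rule mem_WnI[OF t' mem_Wn_tile_shift[OF t(2)]])
    then have "s1 \<in> (W ^^ N) (R m')" using agree[OF N] by simp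
    then obtain u where u: "u \<in> R m'" "s1 \<in> (W ^^ N) {u}" "of_type \<A> u" using X_Wn_parent[OF R(1)] by blast
    have "(\<phi> ^^ N) (v + w') \<in> interior (fst s1)" using v(2) by (simp add: s1_def phi_pow_add)
    then have "v + w' \<in> fst u" using Wn_interior_mem[OF u(3,2)] interior_subset by blast
    then have "v + w' - \<alpha> m' \<in> fst (tile_shift (- \<alpha> m') u)" by simp
    moreover have "norm (v + w' - \<alpha> m') \<le> r"
    proof -
      have "v + w' - \<alpha> m' = (v - \<alpha> m) + y" by (simp add: yw w_def)
      then have "norm (v + w' - \<alpha> m') \<le> norm (v - \<alpha> m) + norm y" by (metis norm_triangle_ineq)
      then show ?thesis using v\<alpha> y_small radius_pos by (simp add: r_def)
    qed
    moreover have "tile_shift (- \<alpha> m') u \<in> shift (- \<alpha> m') (R m')" using u(1) by simp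
    ultimately have "tile_shift (- \<alpha> m') u \<in> P m'"
      unfolding P_def by (intro meetingI[of _ _ "v + w' - \<alpha> m'"])
    then have "tile_shift (- \<alpha> m') u \<in> P m" using same by simp
    then have "tile_shift (- \<alpha> m') u \<in> shift (- \<alpha> m) (R m)" unfolding P_def using meeting_subset by blast
    then have u': "tile_shift (- w) u \<in> R m" by (simp add: w_def)
    have "tile_shift ((\<phi> ^^ N) (- w)) s1 \<in> (W ^^ N) (R m)"
      by (rule mem_WnI[OF u' mem_Wn_tile_shift[OF u(2)]])
    moreover have "tile_shift ((\<phi> ^^ N) (- w)) s1 = tile_shift ((\<phi> ^^ N) y) s"
      by (simp add: s1_def yw phi_pow_minus phi_pow_diff)
    ultimately show ?thesis by simp
  qed
  moreover have "nonp ?A" using nonp_parent[OF of_type_prototile(1)[OF A(1)] A(3) a(2)] .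
  moreover have "?p \<in> frontier (fst ?A)" using p0 by simp
  moreover have "norm y < e" using y_small by simp
  ultimately show ?thesis
    using R(1)[of m] A(2)[of m] \<open>y \<noteq> 0\<close>
    by (intro exI[of _ "R m"] exI[of _ ?A] exI[of _ ?p] exI[of _ y] exI[of _ "m' + n0"] conjI allI impI ballI)
qed

end

subsection \<open>Spreading local periods\<close>

context border_subst
begin

lemma dist_funpow: "dist ((\<phi> ^^ n) x) ((\<phi> ^^ n) y) = norm ((\<phi> ^^ n) (x - y))"
  by (simp add: dist_norm phi_pow_diff)

text \<open>A period of the substituted patch and not of G: without unique desubstitution it does
  not descend to G. The point v and the bound \<rho> measure on the scale of G where it is valid,
  namely around the supertile of t.\<close>

definition near_period :: "real \<Rightarrow> nat \<Rightarrow> nat \<Rightarrow> ('d, 'l) tile set \<Rightarrow> ('d, 'l) tile \<Rightarrow> real ^ 'd \<Rightarrow> bool" where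
  "near_period \<rho> j k G t z \<longleftrightarrow> (\<forall>s\<in>(W ^^ k) G. \<forall>v. \<forall>q\<in>fst t. dist v ((\<phi> ^^ j) q) < \<rho> \<longrightarrow>
     (\<phi> ^^ k) v \<in> interior (fst s) \<longrightarrow> tile_shift ((\<phi> ^^ k) z) s \<in> (W ^^ k) G)"

lemma near_periodD:
  "near_period \<rho> j k G t z \<Longrightarrow> s \<in> (W ^^ k) G \<Longrightarrow> q \<in> fst t \<Longrightarrow> dist v ((\<phi> ^^ j) q) < \<rho> \<Longrightarrow>
     (\<phi> ^^ k) v \<in> interior (fst s) \<Longrightarrow> tile_shift ((\<phi> ^^ k) z) s \<in> (W ^^ k) G"
  unfolding near_period_def
  by (drule bspec, assumption, drule spec, drule bspec, assumption, drule mp, assumption, drule mp)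

text \<open>Expanding the tiny y of \<open>local_period\<close> until its norm first reaches 1 gives
  z. The unit ball about p, where the period is valid, expands with it and then covers the
  neighbourhood of a whole supertile of level j that touches the image of p;
  \<open>border_iter\<close> makes it the supertile of a nonperiodic tile.\<close>

lemma local_period_scaled:
  assumes S: "S \<in> X" "S' \<in> X" and eq: "(W ^^ n0) S = (W ^^ n0) S'"
    and a: "a \<in> S" "nonp a" "a \<notin> S'"
    and K: "K \<ge> 1" "\<And>x. norm (\<phi> x) \<le> K * norm x" and \<rho>: "\<rho> > 0"
  shows "\<exists>t G k z. nonp t \<and> G \<in> X \<and> (W ^^ j) {t} \<subseteq> G \<and> z \<noteq> 0 \<and> norm z \<le> K \<and> near_period \<rho> j k G t z"
proof -
  \<comment> \<open>The supertile of t has diameter at most K ^ j * (2 * radius), so its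
    \<rho>-neighbourhood is within \<rho>' of the image of p.\<close>
  define \<rho>' where "\<rho>' = \<rho> + K ^ j * (2 * radius)"
  have \<rho>': "\<rho>' > 0" using \<rho> K(1) radius_pos by (simp add: \<rho>'_def add_pos_nonneg)
  obtain L0 where L0: "\<And>l x. l \<ge> L0 \<Longrightarrow> norm x \<le> (1 / \<rho>') * norm ((\<phi> ^^ l) x)"
    using expansive_funpow_lower_bound[OF expansive, of "1 / \<rho>'"] \<rho>' by auto
  define L where "L = max L0 j"
  \<comment> \<open>So small that L steps, each of factor at most K, do not bring y to norm 1; hence
    l exceeds L.\<close>
  define e where "e = 1 / K ^ L"
  have e: "e > 0" using K(1) by (simp add: e_def)
  obtain R A p y N0 where R: "R \<in> X" "A \<in> R" "nonp A" "p \<in> frontier (fst A)" "y \<noteq> 0" "norm y < e"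
    and per: "\<forall>N\<ge>N0. \<forall>s\<in>(W ^^ N) R. \<forall>v. dist v p < 1 \<longrightarrow> (\<phi> ^^ N) v \<in> interior (fst s) \<longrightarrow>
       tile_shift ((\<phi> ^^ N) y) s \<in> (W ^^ N) R"
    using local_period[OF S eq a e] by blast
  \<comment> \<open>With this constant the lower bound says that the orbit of y reaches norm 2,
    hence norm 1.\<close>
  have "norm y / 2 > 0" using R(5) by simp
  from expansive_funpow_lower_bound[OF expansive this]
  obtain L2 where L2: "norm y \<le> norm y / 2 * norm ((\<phi> ^^ L2) y)" by blast
  have "norm ((\<phi> ^^ L2) y) \<ge> 1"
  proof (rule ccontr)
    assume "\<not> norm ((\<phi> ^^ L2) y) \<ge> 1"
    then have "norm y / 2 * norm ((\<phi> ^^ L2) y) \<le> norm y / 2 * 1" by (intro mult_left_mono) auto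
    then show False using L2 R(5) by simp
  qed
  define l where "l = (LEAST l. norm ((\<phi> ^^ l) y) \<ge> 1)"
  have l1: "norm ((\<phi> ^^ l) y) \<ge> 1" unfolding l_def using \<open>norm ((\<phi> ^^ L2) y) \<ge> 1\<close> by (rule LeastI)
  have lmin: "norm ((\<phi> ^^ i) y) < 1" if "i < l" for i
    using not_less_Least[of i "\<lambda>l. norm ((\<phi> ^^ l) y) \<ge> 1"] that unfolding l_def by simp
  have "l > L"
  proof (rule ccontr)
    assume "\<not> l > L"
    then have "K ^ l \<le> K ^ L" using K(1) by (intro power_increasing) auto
    have "norm ((\<phi> ^^ l) y) \<le> K ^ l * norm y" by (rule norm_funpow_le[OF K])
    also have "\<dots> \<le> K ^ L * norm y" using \<open>K ^ l \<le> K ^ L\<close> by (intro mult_right_mono) auto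
    also have "\<dots> < K ^ L * e" using R(6) K(1) by (intro mult_strict_left_mono) auto
    also have "\<dots> = 1" using K(1) by (simp add: e_def)
    finally show False using l1 by simp
  qed
  then obtain l' where l': "l = Suc l'" by (cases l) auto
  have lj: "l \<ge> j" "l \<ge> L0" using \<open>l > L\<close> by (simp_all add: L_def)
  define z where "z = (\<phi> ^^ l) y"
  have "norm z \<le> K * norm ((\<phi> ^^ l') y)" using K(2) by (simp add: z_def l')
  also have "\<dots> \<le> K * 1" using lmin[of l'] K(1) l' by (intro mult_left_mono) auto
  finally have zK: "norm z \<le> K" by simp
  have z0: "z \<noteq> 0" using l1 unfolding z_def by auto
  define N where "N = max N0 l"
  define k where "k = N - l"
  have N: "N \<ge> N0" "N = k + l" by (simp_all add: N_def k_def)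
  define G where "G = (W ^^ l) R"
  have G: "G \<in> X" unfolding G_def by (rule X_Wn[OF R(1)])
  obtain t where t: "t \<in> (W ^^ (l - j)) {A}" "nonp t" "(\<phi> ^^ (l - j)) p \<in> frontier (fst t)"
    using border_iter[OF R(3,4)] by blast
  note tile_t = of_type_is_tile[OF nonp_of_type[OF t(2)]]
  have "(W ^^ j) {t} \<subseteq> (W ^^ j) ((W ^^ (l - j)) R)"
    using mem_WnI[OF R(2) t(1)] by (intro Wn_mono) simp
  then have tG: "(W ^^ j) {t} \<subseteq> G" unfolding Wn_Wn G_def using lj by simp
  have "near_period \<rho> j k G t z"
    unfolding near_period_def
  proof (intro ballI allI impI)
    fix s v q
    assume s: "s \<in> (W ^^ k) G" and q: "q \<in> fst t" "dist v ((\<phi> ^^ j) q) < \<rho>" and v: "(\<phi> ^^ k) v \<in> interior (fst s)"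
    obtain v0 where v0: "(\<phi> ^^ l) v0 = v" using surj_funpow by blast
    let ?c = "(\<phi> ^^ (l - j)) p"
    have c: "(\<phi> ^^ j) ?c = (\<phi> ^^ l) p" using lj by (simp add: phi_pow_phi_pow)
    have "dist ((\<phi> ^^ j) q) ((\<phi> ^^ j) ?c) \<le> K ^ j * norm (q - ?c)"
      unfolding dist_funpow by (rule norm_funpow_le[OF K])
    also have "\<dots> \<le> K ^ j * (2 * radius)"
      using tile_diam[OF nonp_of_type[OF t(2)] q(1) frontier_tile_mem[OF tile_t t(3)]] K(1)
      by (intro mult_left_mono) (auto simp: dist_norm)
    finally have "dist v ((\<phi> ^^ l) p) < \<rho>'"
      using dist_triangle[of v "(\<phi> ^^ l) p" "(\<phi> ^^ j) q"] q(2) unfolding c \<rho>'_def by simp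
    then have "norm ((\<phi> ^^ l) (v0 - p)) < \<rho>'" unfolding v0[symmetric] dist_funpow .
    then have "(1 / \<rho>') * norm ((\<phi> ^^ l) (v0 - p)) < 1" using \<rho>' by (simp add: field_simps)
    then have "dist v0 p < 1" using L0[OF lj(2), of "v0 - p"] by (simp add: dist_norm)
    moreover have "s \<in> (W ^^ N) R" using s unfolding G_def N(2) Wn_Wn .
    moreover have "(\<phi> ^^ N) v0 \<in> interior (fst s)" using v unfolding N(2) phi_pow_phi_pow[symmetric] v0 .
    ultimately have "tile_shift ((\<phi> ^^ N) y) s \<in> (W ^^ N) R" using per N(1) by blast
    then show "tile_shift ((\<phi> ^^ k) z) s \<in> (W ^^ k) G"
      unfolding G_def z_def Wn_Wn phi_pow_phi_pow N(2) .
  qed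
  then show ?thesis using t(2) G tG z0 zK by blast
qed

lemma near_period_shift:
  assumes "near_period \<rho> j k G (tile_shift x t) z"
  shows "near_period \<rho> j k (shift (- (\<phi> ^^ j) x) G) t z"
  unfolding near_period_def
proof (intro ballI allI impI)
  fix s v q
  assume s: "s \<in> (W ^^ k) (shift (- (\<phi> ^^ j) x) G)" and q: "q \<in> fst t" "dist v ((\<phi> ^^ j) q) < \<rho>"
    and v: "(\<phi> ^^ k) v \<in> interior (fst s)"
  let ?g = "(\<phi> ^^ k) ((\<phi> ^^ j) x)"
  have "tile_shift ?g s \<in> (W ^^ k) G" using s by (simp add: Wn_shift phi_pow_minus)
  moreover have "q + x \<in> fst (tile_shift x t)" using q(1) by simp
  moreover have "dist (v + (\<phi> ^^ j) x) ((\<phi> ^^ j) (q + x)) < \<rho>" using q(2) by (simp add: phi_pow_add dist_norm)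
  moreover have "(\<phi> ^^ k) (v + (\<phi> ^^ j) x) \<in> interior (fst (tile_shift ?g s))" using v by (simp add: phi_pow_add)
  ultimately have "tile_shift ((\<phi> ^^ k) z) (tile_shift ?g s) \<in> (W ^^ k) G" by (rule near_periodD[OF assms])
  then have "tile_shift ?g (tile_shift ((\<phi> ^^ k) z) s) \<in> (W ^^ k) G"
    by (simp only: tile_shift_tile_shift add.commute[of ?g])
  then show "tile_shift ((\<phi> ^^ k) z) s \<in> (W ^^ k) (shift (- (\<phi> ^^ j) x) G)"
    by (simp only: Wn_shift phi_pow_minus mem_shift minus_minus)
qed

text \<open>From the given point walk by steps -z until the supertile is left. The last step crosses
  its frontier, where the border condition supplies a nonperiodic tile, and the period carries that
  tile back along the walk to within norm z of the start. It is carried in \<open>(W ^^ k) G\<close>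
  only, but its ancestor in G is nonperiodic as well.\<close>

lemma nonp_relatively_dense:
  assumes t: "nonp t" and G: "G \<in> X" "(W ^^ j) {t} \<subseteq> G" and z: "z \<noteq> 0" "norm z \<le> K"
    and per: "near_period (K + 1) j k G t z" and q: "q \<in> fst t"
  shows "\<exists>g\<in>G. nonp g \<and> (\<exists>v\<in>fst g. dist v ((\<phi> ^^ j) q) \<le> K)"
proof -
  let ?E = "(\<phi> ^^ j) ` fst t" and ?q = "(\<phi> ^^ j) q"
  note tile_t = of_type_is_tile[OF nonp_of_type[OF t]]
  have "compact ?E" using tile_t linear_continuous_on linear_funpow
    by (intro compact_continuous_image) (auto simp: is_tile_def linear_conv_bounded_linear)
  then have "bounded ?E" by (rule compact_imp_bounded)
  then obtain M where "\<forall>u\<in>?E. norm u \<le> M" unfolding bounded_iff by (rule exE)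
  then have M: "\<And>u. u \<in> ?E \<Longrightarrow> norm u \<le> M" by (rule bspec)
  have ex: "\<exists>i::nat. ?q - real i *\<^sub>R z \<notin> ?E"
  proof -
    obtain i :: nat where "(M + norm ?q) / norm z < real i" using reals_Archimedean2 by blast
    then have "M + norm ?q < real i * norm z" using z(1) by (simp add: field_simps)
    also have "real i * norm z \<le> norm ?q + norm (?q - real i *\<^sub>R z)"
      using norm_triangle_sub[of "real i *\<^sub>R z" ?q] by (simp add: norm_minus_commute)
    finally have "norm (?q - real i *\<^sub>R z) > M" by simp
    then have "?q - real i *\<^sub>R z \<notin> ?E" using M by (meson not_le)
    then show ?thesis by (rule exI)
  qed
  \<comment> \<open>The first exit: all earlier points of the walk lie in the supertile, where the
    period is valid.\<close>
  define i where "i = (LEAST i::nat. ?q - real i *\<^sub>R z \<notin> ?E)"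
  have i: "?q - real i *\<^sub>R z \<notin> ?E" unfolding i_def by (rule LeastI_ex[OF ex])
  have below: "?q - real i' *\<^sub>R z \<in> ?E" if "i' < i" for i'
    using not_less_Least[OF that[unfolded i_def]] unfolding not_not .
  have "i \<noteq> 0"
  proof
    assume "i = 0"
    then show False using i imageI[OF q, of "\<phi> ^^ j"] by simp
  qed
  then obtain m where m: "i = Suc m" by (cases i) auto
  let ?u = "?q - real m *\<^sub>R z" and ?u' = "?q - real i *\<^sub>R z"
  have "closed_segment ?u ?u' \<inter> frontier ?E \<noteq> {}"
  proof (rule connected_Int_frontier)
    show "connected (closed_segment ?u ?u')" by simp
    show "closed_segment ?u ?u' \<inter> ?E \<noteq> {}" using below[of m] m by auto
    show "closed_segment ?u ?u' - ?E \<noteq> {}" using i by auto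
  qed
  then obtain b where b: "b \<in> closed_segment ?u ?u'" "b \<in> frontier ?E" by blast
  obtain \<theta> where \<theta>: "0 \<le> \<theta>" "\<theta> \<le> 1" "b = (1 - \<theta>) *\<^sub>R ?u + \<theta> *\<^sub>R ?u'"
    using b(1) unfolding closed_segment_def by blast
  \<comment> \<open>The carried crossing point stays at the offset \<theta> z, of norm at most K,
    from a point of the walk.\<close>
  have bq: "b + real i' *\<^sub>R z = ?q - real (m - i') *\<^sub>R z - \<theta> *\<^sub>R z" if "i' \<le> m" for i'
    using that by (simp add: \<theta>(3) m of_nat_diff algebra_simps)
  obtain b0 where b0: "b = (\<phi> ^^ j) b0" "b0 \<in> frontier (fst t)" using b(2) unfolding frontier_image by blast
  obtain s0 where s0: "s0 \<in> (W ^^ (k + j)) {t}" "nonp s0" "(\<phi> ^^ (k + j)) b0 \<in> frontier (fst s0)"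
    using border_iter[OF t b0(2)] by blast
  have tile_s0: "is_tile s0" using of_type_is_tile[OF nonp_of_type[OF s0(2)]] .
  have bs0: "(\<phi> ^^ k) b \<in> fst s0"
    using frontier_tile_mem[OF tile_s0 s0(3)] by (simp add: b0(1) phi_pow_phi_pow)
  let ?Z = "(\<phi> ^^ k) z"
  have \<theta>z: "norm (\<theta> *\<^sub>R z) \<le> K"
    using \<theta>(1,2) z(2) mult_left_le_one_le[of "norm z" \<theta>] by simp
  have chain: "i' \<le> m \<Longrightarrow> tile_shift (real i' *\<^sub>R ?Z) s0 \<in> (W ^^ k) G" for i'
  proof (induction i')
    case 0
    have "s0 \<in> (W ^^ k) ((W ^^ j) {t})" using s0(1) by (simp only: Wn_Wn)
    then have "s0 \<in> (W ^^ k) G" by (rule subsetD[OF Wn_mono[OF G(2)]])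
    then show ?case by simp
  next
    case (Suc i')
    then have IH: "tile_shift (real i' *\<^sub>R ?Z) s0 \<in> (W ^^ k) G" by simp
    let ?s = "tile_shift (real i' *\<^sub>R ?Z) s0" and ?b = "b + real i' *\<^sub>R z"
    \<comment> \<open>The tile may touch the crossing point only with its boundary, while
      \<open>near_period\<close> asks for an interior point. One exists within distance 1 on the
      scale of G, which accounts for the neighbourhood K + 1.\<close>
    have "open ((\<phi> ^^ k) ` ball ?b 1)"
      by (rule open_surjective_linear_image[OF open_ball linear_funpow bij_is_surj[OF bij_funpow]])
    moreover have "(\<phi> ^^ k) ?b \<in> (\<phi> ^^ k) ` ball ?b 1" by (rule imageI) simp
    moreover have "(\<phi> ^^ k) ?b \<in> fst ?s" using bs0 by (simp add: phi_pow_add phi_pow_scaleR)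
    moreover have "is_tile ?s" using tile_s0 by simp
    ultimately obtain y where "y \<in> interior (fst ?s)" "y \<in> (\<phi> ^^ k) ` ball ?b 1"
      using is_tile_interior_meets[of ?s "(\<phi> ^^ k) ?b" "(\<phi> ^^ k) ` ball ?b 1"] by blast
    then obtain v where v: "(\<phi> ^^ k) v \<in> interior (fst ?s)" "dist ?b v < 1" by auto
    have i': "i' \<le> m" "m - i' < i" using Suc.prems m by simp_all
    from below[OF i'(2)] obtain q' where q': "q' \<in> fst t" "?q - real (m - i') *\<^sub>R z = (\<phi> ^^ j) q'" by blast
    have "dist ?b ((\<phi> ^^ j) q') \<le> K" unfolding bq[OF i'(1)] q'(2) using \<theta>z by (simp add: dist_norm)
    then have "dist v ((\<phi> ^^ j) q') < K + 1"
      using dist_triangle[of v "(\<phi> ^^ j) q'" ?b] v(2) by (simp add: dist_commute)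
    from near_periodD[OF per IH q'(1) this v(1)]
    have "tile_shift ?Z ?s \<in> (W ^^ k) G" .
    moreover have "tile_shift ?Z ?s = tile_shift (real (Suc i') *\<^sub>R ?Z) s0" by (simp add: algebra_simps)
    ultimately show ?case by simp
  qed
  let ?s = "tile_shift (real m *\<^sub>R ?Z) s0" and ?v = "b + real m *\<^sub>R z"
  have s: "?s \<in> (W ^^ k) G" using chain by simp
  then obtain g where g: "g \<in> G" "?s \<in> (W ^^ k) {g}" "of_type \<A> g" using X_Wn_parent[OF G(1)] by blast
  have "nonp g" by (rule nonp_parent[OF g(3,2)]) (use s0(2) in simp)
  moreover have "(\<phi> ^^ k) ?v \<in> fst ?s" using bs0 by (simp add: phi_pow_add phi_pow_scaleR)
  then have "?v \<in> fst g" by (rule Wn_fst_mem[OF g(3,2)])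
  moreover have "dist ?v ?q \<le> K" using bq[of m] \<theta>z by (simp add: dist_norm)
  ultimately show ?thesis using g(1) by blast
qed

text \<open>For large j the image of the periodic descendant c contains the ball of radius K about
  the image of q. It is filled with periodic tiles, and a nonperiodic tile meeting the ball would
  overlap one of them.\<close>

lemma per_descendant_far:
  assumes t: "of_type \<A> t" and c: "c \<in> (W ^^ i) {t}" "per c"
  shows "\<exists>J. \<forall>j\<ge>J. \<exists>q\<in>fst t. \<forall>G\<in>X. (W ^^ j) {t} \<subseteq> G \<longrightarrow>
    (\<forall>g\<in>G. nonp g \<longrightarrow> (\<forall>v\<in>fst g. dist v ((\<phi> ^^ j) q) > K))"
proof -
  note oc = per_of_type[OF c(2)]
  obtain x where x: "x \<in> interior (fst c)" using is_tile_interior_nonempty[OF of_type_is_tile[OF oc]] by blast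
  obtain d where d: "d > 0" "ball x d \<subseteq> interior (fst c)" using open_contains_ball x open_interior by meson
  obtain q where q: "q \<in> fst t" "(\<phi> ^^ i) q = x"
    using Wn_subset[OF t c(1)] x interior_subset by blast
  \<comment> \<open>A distance of at most K then pulls back to a distance below d.\<close>
  let ?e = "d / (\<bar>K\<bar> + 1)"
  have "?e > 0" using d(1) by (simp add: add_nonneg_pos)
  from expansive_funpow_lower_bound[OF expansive this] obtain L
    where L: "\<And>l x. l \<ge> L \<Longrightarrow> norm x \<le> ?e * norm ((\<phi> ^^ l) x)" by blast
  have "dist v ((\<phi> ^^ j) q) > K"
    if j: "j \<ge> L + i" and G: "G \<in> X" "(W ^^ j) {t} \<subseteq> G" and g: "g \<in> G" "nonp g" and v: "v \<in> fst g" for j G g v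
  proof (rule ccontr)
    assume "\<not> dist v ((\<phi> ^^ j) q) > K"
    define l where "l = j - i"
    have jl: "j = l + i" "l \<ge> L" using j by (simp_all add: l_def)
    obtain v0 where v0: "(\<phi> ^^ l) v0 = v" using surj_funpow by blast
    have "(\<phi> ^^ j) q = (\<phi> ^^ l) x" unfolding jl(1) phi_pow_phi_pow[symmetric] q(2) ..
    then have le: "norm ((\<phi> ^^ l) (v0 - x)) \<le> \<bar>K\<bar>"
      using \<open>\<not> dist v ((\<phi> ^^ j) q) > K\<close> unfolding v0[symmetric] by (simp add: dist_funpow)
    have "norm (v0 - x) \<le> ?e * norm ((\<phi> ^^ l) (v0 - x))" by (rule L[OF jl(2)])
    also have "\<dots> \<le> ?e * \<bar>K\<bar>" using le \<open>?e > 0\<close> by (intro mult_left_mono) auto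
    also have "\<dots> < d" using d(1) by (simp add: divide_simps)
    finally have "v0 \<in> ball x d" by (simp add: dist_norm norm_minus_commute)
    then have "v0 \<in> interior (fst c)" using d(2) by blast
    then have "v \<in> (\<phi> ^^ l) ` interior (fst c)" unfolding v0[symmetric] by (rule imageI)
    moreover have "open ((\<phi> ^^ l) ` interior (fst c))"
      by (rule open_surjective_linear_image[OF open_interior linear_funpow bij_is_surj[OF bij_funpow]])
    ultimately obtain u where u: "u \<in> interior (fst g)" "u \<in> (\<phi> ^^ l) ` interior (fst c)"
      using is_tile_interior_meets[OF X_is_tile[OF G(1) g(1)] v] by blast
    have "u \<in> supp ((W ^^ l) {c})" unfolding supp_Wn_single[OF oc] using u(2) interior_subset by blast
    then obtain c' where c': "c' \<in> (W ^^ l) {c}" "u \<in> fst c'" unfolding mem_supp_iff by blast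
    have "is_tile c'" using of_type_is_tile[OF of_type_Wn_single[OF oc c'(1)]] .
    from is_tile_interior_meets[OF this c'(2) open_interior u(1)] have ov: "overlap c' g"
      unfolding overlap_def .
    have "c' \<in> (W ^^ l) ((W ^^ i) {t})" by (rule mem_WnI[OF c(1) c'(1)])
    then have "c' \<in> G" using G(2) unfolding Wn_Wn jl(1) by blast
    from X_unique[OF G(1) this g(1) ov] have "c' = g" .
    then have "per g" using per_Wn[OF c(2) c'(1)] by simp
    then show False using g(2) nonp_iff[OF per_of_type] by blast
  qed
  then show ?thesis using q(1) by blast
qed

text \<open>A lies in a tiling TA and has 0 in its interior, so its images fill ever larger balls
  about 0. There the tilings \<open>(W ^^ h n) TA\<close> consist of descendants of A, and finite
  patches of a limit are found there.\<close>

lemma limit_of_supertiles: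
  assumes A: "A \<in> \<A>" and h: "strict_mono (h :: nat \<Rightarrow> nat)"
  shows "\<exists>T\<in>X. \<forall>P. P \<subseteq> T \<longrightarrow> finite P \<longrightarrow> (\<exists>n x. shift x P \<subseteq> (W ^^ h n) {A})"
proof -
  obtain TA where TA: "TA \<in> X" "A \<in> TA" using admissible A unfolding admissible_def by blast
  define U where "U n = (W ^^ h n) TA" for n
  have U: "U n \<in> X" for n unfolding U_def by (rule X_Wn[OF TA(1)])
  have "\<exists>p. fst p \<in> \<A> \<and> tile_shift (snd p) (fst p) \<in> U n \<and> norm (snd p) \<le> radius" for n
  proof -
    obtain u where u: "u \<in> U n" "0 \<in> fst u" using tiling_covers[OF X_tiling[OF U]] .
    obtain C x where C: "C \<in> \<A>" "u = tile_shift x C" using X_of_type[OF U u(1)] unfolding of_type_def by blast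
    then have "norm (- x) \<le> radius" using u(2) by (intro prototile_norm_le[OF C(1)]) simp
    then show ?thesis using u(1) C by (intro exI[of _ "(C, x)"]) simp
  qed
  then have "\<forall>n. \<exists>p. fst p \<in> \<A> \<and> tile_shift (snd p) (fst p) \<in> U n \<and> norm (snd p) \<le> radius" by (rule allI)
  from choice[OF this] obtain p where p: "\<forall>n. fst (p n) \<in> \<A> \<and> tile_shift (snd (p n)) (fst (p n)) \<in> U n \<and> norm (snd (p n)) \<le> radius"
    by (rule exE)
  have "\<exists>r c. strict_mono (r :: nat \<Rightarrow> nat) \<and> (\<forall>n. fst (p (r n)) = c) \<and> c \<in> \<A>"
    using finite_prototiles by (rule finite_range_const_subseq) (simp add: p)
  then obtain r c where r: "strict_mono (r :: nat \<Rightarrow> nat)" "\<And>n. fst (p (r n)) = c"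
    by (elim exE conjE) (rule that, assumption, erule spec)
  \<comment> \<open>Moves the tile over 0 to its prototile position, a shift of norm at most
    \<open>radius\<close>, so that all V n share the tile c.\<close>
  define V where "V n = shift (- snd (p (r n))) (U (r n))" for n
  have "\<exists>T\<in>X. \<exists>f. c \<in> T \<and> strict_mono (f :: nat \<Rightarrow> nat) \<and>
    (\<forall>P. P \<subseteq> T \<longrightarrow> finite P \<longrightarrow> (\<exists>N. \<forall>n\<ge>N. P \<subseteq> V (f n)))"
  proof (rule limit_tiling)
    show "V n \<in> X" for n unfolding V_def using U by simp
    show "c \<in> V n" for n unfolding V_def using p r(2)[of n] by (metis minus_minus mem_shift)
  qed
  then obtain T f where T: "T \<in> X" "strict_mono (f :: nat \<Rightarrow> nat)"
      "\<forall>P. P \<subseteq> T \<longrightarrow> finite P \<longrightarrow> (\<exists>N. \<forall>n\<ge>N. P \<subseteq> V (f n))"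
    by (elim bexE exE conjE) (rule that)
  obtain d where d: "d > 0" "ball 0 d \<subseteq> interior (fst A)"
    using open_contains_ball zero_in_interior[OF A] open_interior by meson
  have "\<exists>n x. shift x P \<subseteq> (W ^^ h n) {A}" if P: "P \<subseteq> T" "finite P" for P
  proof -
    obtain N where N: "\<forall>n\<ge>N. P \<subseteq> V (f n)" using T(3) P by blast
    have "\<forall>q\<in>P. \<exists>y. y \<in> interior (fst q)"
      using P(1) X_is_tile[OF T(1)] is_tile_interior_nonempty by blast
    from bchoice[OF this] obtain y where y: "\<And>q. q \<in> P \<Longrightarrow> y q \<in> interior (fst q)" by blast
    have "bounded (y ` P)" using P(2) by (intro finite_imp_bounded) simp
    then obtain M where M: "M > 0" "\<And>q. q \<in> P \<Longrightarrow> norm (y q) \<le> M" unfolding bounded_pos by blast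
    \<comment> \<open>Points of norm at most M + radius, where the chosen interior points lie, then
      pull back into the ball of radius d inside A.\<close>
    let ?e = "d / (M + radius + 1)"
    have pos: "M + radius + 1 > 0" using M(1) radius_pos by simp
    then have "?e > 0" using d(1) by simp
    from expansive_funpow_lower_bound[OF expansive this] obtain L
      where L: "\<And>l x. l \<ge> L \<Longrightarrow> norm x \<le> ?e * norm ((\<phi> ^^ l) x)" by blast
    define n where "n = r (f (max N L))"
    have nL: "h n \<ge> L"
      using seq_suble[OF h, of n] seq_suble[OF r(1), of "f (max N L)"] seq_suble[OF T(2), of "max N L"]
      by (simp add: n_def)
    define x where "x = snd (p n)"
    have sub: "P \<subseteq> shift (- x) (U n)" using N unfolding V_def n_def x_def by simp
    have "shift x P \<subseteq> (W ^^ h n) {A}"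
    proof
      fix s assume "s \<in> shift x P"
      then have q: "tile_shift (- x) s \<in> P" by simp
      then have "tile_shift (- x) s \<in> shift (- x) (U n)" using sub by (rule subsetD[rotated])
      then have sU: "s \<in> (W ^^ h n) TA" by (simp add: U_def)
      let ?y = "y (tile_shift (- x) s) + x"
      have ys: "?y \<in> interior (fst s)" using y[OF q] by simp
      have "norm ?y \<le> M + radius" using norm_triangle_ineq[of "y (tile_shift (- x) s)" x] M(2)[OF q] p
        unfolding x_def by (smt (verit))
      obtain y0 where y0: "(\<phi> ^^ h n) y0 = ?y" using surj_funpow by blast
      have "norm y0 \<le> ?e * norm ?y" using L[OF nL, of y0] unfolding y0 .
      also have "\<dots> \<le> ?e * (M + radius)" using \<open>norm ?y \<le> M + radius\<close> \<open>?e > 0\<close> by (intro mult_left_mono) auto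
      also have "\<dots> < d" using d(1) pos by (simp add: divide_simps)
      finally have "y0 \<in> interior (fst A)" using d(2) by (auto simp: subset_iff)
      obtain t where t: "t \<in> TA" "s \<in> (W ^^ h n) {t}" "of_type \<A> t" using X_Wn_parent[OF TA(1) sU] by blast
      have "(\<phi> ^^ h n) y0 \<in> interior (fst s)" using ys by (simp only: y0)
      then have "y0 \<in> interior (fst t)" by (rule Wn_interior_mem[OF t(3,2)])
      then have "overlap t A" using \<open>y0 \<in> interior (fst A)\<close> unfolding overlap_def by blast
      then have "t = A" by (rule X_unique[OF TA(1) t(1) TA(2)])
      then show "s \<in> (W ^^ h n) {A}" using t(2) by simp
    qed
    then show ?thesis by blast
  qed
  then show ?thesis using T(1) by blast
qed

end

subsection \<open>Partial recognizability\<close>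

context border_subst
begin

text \<open>A period found in one supertile of level j must be transferred to a limit of supertiles
  of growing level. This works because a period is checked on pairs of nearby tiles, and along h
  supertiles of the same prototile show the same pairs.\<close>

lemma nonp_part_determined:
  assumes S: "S \<in> X" "S' \<in> X" and eq: "(W ^^ n0) S = (W ^^ n0) S'" and a: "a \<in> S" "nonp a"
  shows "a \<in> S'"
proof (rule ccontr)
  assume a': "a \<notin> S'"
  obtain K where K: "K \<ge> 1" "\<And>x. norm (\<phi> x) \<le> K * norm x" using ex_norm_bound by blast
  have Kpos: "K + 1 > 0" using K(1) by simp
  define hasper where "hasper A \<longleftrightarrow> (\<exists>i c. c \<in> (W ^^ i) {A} \<and> per c)" for A
  define far where "far A j \<longleftrightarrow> (\<exists>q\<in>fst A. \<forall>G\<in>X. (W ^^ j) {A} \<subseteq> G \<longrightarrow>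
    (\<forall>g\<in>G. nonp g \<longrightarrow> (\<forall>v\<in>fst g. dist v ((\<phi> ^^ j) q) > K)))" for A j
  have "\<forall>A\<in>{A\<in>\<A>. hasper A}. \<forall>\<^sub>F j in sequentially. far A j"
  proof
    fix A assume "A \<in> {A\<in>\<A>. hasper A}"
    then obtain i c where A: "A \<in> \<A>" and c: "c \<in> (W ^^ i) {A}" "per c" unfolding hasper_def by blast
    from per_descendant_far[OF of_type_prototile(2)[OF A] c, of K]
    show "\<forall>\<^sub>F j in sequentially. far A j" unfolding eventually_sequentially far_def .
  qed
  moreover have "finite {A\<in>\<A>. hasper A}" using finite_prototiles by simp
  ultimately have "\<forall>\<^sub>F j in sequentially. \<forall>A\<in>{A\<in>\<A>. hasper A}. far A j"
    by (intro eventually_ball_finite)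
  then obtain J where J: "\<And>j A. j \<ge> J \<Longrightarrow> A \<in> \<A> \<Longrightarrow> hasper A \<Longrightarrow> far A j"
    unfolding eventually_sequentially by blast
  \<comment> \<open>A tile that overlaps the translate of c by z has a point within radius + norm z
    of the position of c.\<close>
  define r where "r = radius + K"
  let ?V = "\<Union>C\<in>\<A>. {t. \<exists>T\<in>X. C \<in> T \<and> t \<in> meeting T r}"
  \<comment> \<open>Two tiles suffice: one to be moved by the period and one that its translate
    overlaps.\<close>
  define F where "F j = {(A, C, d). A \<in> \<A> \<and> C \<in> \<A> \<and> d \<in> ?V \<and>
      (\<exists>x. tile_shift x C \<in> (W ^^ j) {A} \<and> tile_shift x d \<in> (W ^^ j) {A})}" for j
  have "finite ?V" by (intro finite_UN_I finite_prototiles finite_neighbours)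
  then have "finite (\<A> \<times> \<A> \<times> ?V)" by (intro finite_cartesian_product finite_prototiles)
  then have "finite (Pow (\<A> \<times> \<A> \<times> ?V))" by (simp only: finite_Pow_iff)
  moreover have "F j \<in> Pow (\<A> \<times> \<A> \<times> ?V)" for j unfolding F_def by blast
  ultimately have "\<exists>h c. strict_mono (h :: nat \<Rightarrow> nat) \<and> (\<forall>n. F (h n) = c) \<and> c \<in> Pow (\<A> \<times> \<A> \<times> ?V)"
    by (rule finite_range_const_subseq)
  then obtain h c where h: "strict_mono (h :: nat \<Rightarrow> nat)" "\<And>n. F (h n) = c"
    by (elim exE conjE) (rule that, assumption, erule spec)
  define j where "j = h J"
  have jJ: "j \<ge> J" unfolding j_def using seq_suble[OF h(1)] .
  obtain t G0 k z where t: "nonp t" "G0 \<in> X" "(W ^^ j) {t} \<subseteq> G0" "z \<noteq> 0" "norm z \<le> K" "near_period (K + 1) j k G0 t z"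
    using local_period_scaled[OF S eq a a' K Kpos, of j] by blast
  obtain A x where A: "A \<in> A_nonp \<A> \<phi> \<omega>" "t = tile_shift x A" using t(1) unfolding of_type_def by blast
  then have AA: "A \<in> \<A>" by (simp add: A_nonp_def)
  define G where "G = shift (- (\<phi> ^^ j) x) G0"
  have G: "G \<in> X" using t(2) by (simp add: G_def)
  have per_G: "near_period (K + 1) j k G A z"
    unfolding G_def by (rule near_period_shift) (use t(6) A(2) in simp)
  have AG: "(W ^^ j) {A} \<subseteq> G"
  proof -
    have "shift ((\<phi> ^^ j) x) ((W ^^ j) {A}) \<subseteq> G0" using t(3) unfolding A(2) Wn_tile_shift .
    then show ?thesis unfolding G_def shift_subset_shift_iff .
  qed
  have nonp_A: "nonp A" using A(1) by (rule of_type_prototile(2))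
  \<comment> \<open>Nonperiodic tiles come within K of every point of the supertile of A, which a
    periodic descendant would forbid at a level j \<ge> J.\<close>
  have not_per: "\<not> hasper A"
  proof
    assume "hasper A"
    from J[OF jJ AA this] obtain q where q: "q \<in> fst A"
      and fq: "\<forall>G\<in>X. (W ^^ j) {A} \<subseteq> G \<longrightarrow> (\<forall>g\<in>G. nonp g \<longrightarrow> (\<forall>v\<in>fst g. dist v ((\<phi> ^^ j) q) > K))"
      unfolding far_def by blast
    obtain g v where g: "g \<in> G" "nonp g" "v \<in> fst g" "dist v ((\<phi> ^^ j) q) \<le> K"
      using nonp_relatively_dense[OF nonp_A G AG t(4,5) per_G q] by blast
    have "dist v ((\<phi> ^^ j) q) > K" using fq G AG g(1,2,3) by blast
    then show False using g(4) by simp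
  qed
  obtain T where T: "T \<in> X" and supertile: "\<forall>P. P \<subseteq> T \<longrightarrow> finite P \<longrightarrow> (\<exists>n x. shift x P \<subseteq> (W ^^ h n) {A})"
    using limit_of_supertiles[OF AA h(1)] by blast
  define T0 where "T0 = (W ^^ k) T"
  have T0: "T0 \<in> X" unfolding T0_def by (rule X_Wn[OF T])
  define v where "v = (\<phi> ^^ k) z"
  have v: "v \<noteq> 0" unfolding v_def using t(4) funpow_eq_iff[of k z 0] by simp
  have inT0: "tile_shift v s \<in> T0" if s: "s \<in> T0" for s
  proof -
    obtain c where c: "c \<in> T" "s \<in> (W ^^ k) {c}" "of_type \<A> c" using X_Wn_parent[OF T] s unfolding T0_def by blast
    have tile_s: "is_tile s" using X_is_tile[OF T0 s] .
    then have "is_tile (tile_shift v s)" by simp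
    then obtain s1 where s1: "s1 \<in> T0" "overlap (tile_shift v s) s1" using X_overlap_ex[OF T0] by blast
    obtain d where d: "d \<in> T" "s1 \<in> (W ^^ k) {d}" "of_type \<A> d" using X_Wn_parent[OF T] s1(1) unfolding T0_def by blast
    have vs: "tile_shift v s \<in> (W ^^ k) {tile_shift z c}" unfolding v_def by (rule mem_Wn_tile_shift[OF c(2)])
    \<comment> \<open>The overlap of s + v with s1, seen k substitutions earlier.\<close>
    have "overlap (tile_shift z c) d"
      by (rule overlap_Wn[OF _ vs d(3,2) s1(2)]) (use c(3) in simp)
    then obtain y where y: "y \<in> interior (fst (tile_shift z c))" "y \<in> interior (fst d)" unfolding overlap_def by blast
    then have yc: "y - z \<in> fst c" and yd: "y \<in> fst d" using interior_subset by auto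
    obtain C \<gamma> where C: "C \<in> \<A>" "c = tile_shift \<gamma> C" using c(3) unfolding of_type_def by blast
    define d0 where "d0 = tile_shift (- \<gamma>) d"
    have "norm (y - z - \<gamma>) \<le> radius" using yc prototile_norm_le[OF C(1)] by (simp add: C(2))
    then have "norm (y - \<gamma>) \<le> r"
      using norm_triangle_ineq[of "y - z - \<gamma>" z] t(5) by (simp add: r_def algebra_simps)
    moreover have "y - \<gamma> \<in> fst d0" using yd by (simp add: d0_def)
    moreover have "d0 \<in> shift (- \<gamma>) T" using d(1) by (simp add: d0_def)
    ultimately have "d0 \<in> meeting (shift (- \<gamma>) T) r" by (intro meetingI)
    moreover have "shift (- \<gamma>) T \<in> X" "C \<in> shift (- \<gamma>) T" using T c(1) by (simp_all add: C(2))
    ultimately have d0V: "d0 \<in> ?V" using C(1) by blast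
    \<comment> \<open>The pair c, d occurs in the supertile of A at some level h n, hence by the
      choice of h also at level j, where the period is available.\<close>
    obtain n x where nx: "shift x {c, d} \<subseteq> (W ^^ h n) {A}"
      using supertile[rule_format, of "{c, d}"] c(1) d(1) by auto
    then have "tile_shift (\<gamma> + x) C \<in> (W ^^ h n) {A}" "tile_shift (\<gamma> + x) d0 \<in> (W ^^ h n) {A}"
      by (simp_all add: C(2) d0_def)
    then have "(A, C, d0) \<in> F (h n)" unfolding F_def using AA C(1) d0V by blast
    then have "(A, C, d0) \<in> F j" unfolding j_def h(2) .
    then obtain u where u: "tile_shift u C \<in> (W ^^ j) {A}" "tile_shift u d0 \<in> (W ^^ j) {A}" unfolding F_def by blast
    define \<sigma> where "\<sigma> = u - \<gamma>"
    have \<sigma>: "tile_shift \<sigma> c \<in> (W ^^ j) {A}" "tile_shift \<sigma> d \<in> (W ^^ j) {A}"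
      using u by (simp_all add: \<sigma>_def C(2) d0_def)
    let ?g = "(\<phi> ^^ k) \<sigma>"
    have sG: "tile_shift ?g s \<in> (W ^^ k) {tile_shift \<sigma> c}" by (rule mem_Wn_tile_shift[OF c(2)])
    have sG': "tile_shift ?g s \<in> (W ^^ k) G" using AG \<sigma>(1) by (intro mem_WnI[OF _ sG]) blast
    have s1G: "tile_shift ?g s1 \<in> (W ^^ k) G"
      using AG \<sigma>(2) by (intro mem_WnI[OF _ mem_Wn_tile_shift[OF d(2)]]) blast
    have "is_tile (tile_shift ?g s)" using tile_s by simp
    then obtain y' where y': "y' \<in> interior (fst (tile_shift ?g s))" using is_tile_interior_nonempty by blast
    obtain v' where v': "(\<phi> ^^ k) v' = y'" using surj_funpow by blast
    have "of_type \<A> (tile_shift \<sigma> c)" using c(3) by simp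
    then have "v' \<in> interior (fst (tile_shift \<sigma> c))" using sG y' unfolding v'[symmetric] by (rule Wn_interior_mem)
    then have "v' \<in> fst (tile_shift \<sigma> c)" using interior_subset by blast
    then have "v' \<in> (\<phi> ^^ j) ` fst A"
      using Wn_subset[OF of_type_prototile(2)[OF AA] \<sigma>(1)] by (rule subsetD[rotated])
    then obtain q where q: "q \<in> fst A" "v' = (\<phi> ^^ j) q" by blast
    have dq: "dist v' ((\<phi> ^^ j) q) < K + 1" using q(2) Kpos by simp
    have "tile_shift ((\<phi> ^^ k) z) (tile_shift ?g s) \<in> (W ^^ k) G"
      by (rule near_periodD[OF per_G sG' q(1) dq]) (use y' v' in simp)
    then have "tile_shift ?g (tile_shift v s) \<in> (W ^^ k) G"
      by (simp only: v_def tile_shift_tile_shift add.commute[of ?g])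
    moreover have "overlap (tile_shift ?g (tile_shift v s)) (tile_shift ?g s1)"
      using s1(2) by (simp only: overlap_shift)
    ultimately have "tile_shift ?g (tile_shift v s) = tile_shift ?g s1"
      using X_unique[OF X_Wn[OF G] _ s1G] by blast
    then have "tile_shift v s = s1" by (simp only: tile_shift_inj_iff)
    then show ?thesis using s1(1) by simp
  qed
  have "shift v T0 \<subseteq> T0"
  proof
    fix s assume "s \<in> shift v T0"
    then have "tile_shift (- v) s \<in> T0" by simp
    from inT0[OF this] show "s \<in> T0" by simp
  qed
  then have period: "shift v T0 = T0"
    using tiling_subset_eq[of "shift v T0" T0] X_tiling[OF T0] by simp
  have np: "\<not> per s" if s: "s \<in> T0" for s
  proof
    assume ps: "per s"
    obtain c where c: "c \<in> T" "s \<in> (W ^^ k) {c}" using X_Wn_parent[OF T] s unfolding T0_def by blast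
    obtain n x where nx: "shift x {c} \<subseteq> (W ^^ h n) {A}"
      using supertile[rule_format, of "{c}"] c(1) by auto
    then have "tile_shift x c \<in> (W ^^ h n) {A}" by simp
    from mem_WnI[OF this mem_Wn_tile_shift[OF c(2)]]
    have "tile_shift ((\<phi> ^^ k) x) s \<in> (W ^^ (k + h n)) {A}" unfolding Wn_Wn .
    moreover have "per (tile_shift ((\<phi> ^^ k) x) s)" using ps by simp
    ultimately show False using not_per unfolding hasper_def by blast
  qed
  \<comment> \<open>M inherits the period, which makes its tiles periodic, while translates of them
    are tiles of T0.\<close>
  obtain M where M: "min_tiling M" "sublang M T0" using ex_min_tiling[OF T0] by blast
  note MX = min_tilingD(1)[OF M(1)]
  have pM: "shift v M = M"
    by (rule sublang_shift_period[OF M(2) X_tiling[OF T0] period X_tiling[OF MX]])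
  obtain s where s: "s \<in> M" using tiling_covers[OF X_tiling[OF MX]] .
  obtain B x where B: "B \<in> \<A>" "s = tile_shift x B" using X_of_type[OF MX s] unfolding of_type_def by blast
  have "B \<in> A_per \<A> \<phi> \<omega>" unfolding A_per_iff using B M(1) v pM s by blast
  then have "per s" unfolding B(2) by (rule of_type_prototile)
  obtain y where "shift y {s} \<subseteq> T0" using sublangD[OF M(2), of "{s}"] s by auto
  then have "tile_shift y s \<in> T0" by simp
  then have "\<not> per (tile_shift y s)" by (rule np)
  then show False using \<open>per s\<close> by simp
qed

text \<open>At every level the ancestor of s0 is nonperiodic and so common to both preimages. It is
  an origin from which the ancestors of u and u' stay at bounded distance, so their configuration
  repeats at two levels, and a translation then carries u and u' into one tiling.\<close>

lemma W_inj_on_nonp: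
  assumes S: "S \<in> X" "S' \<in> X" and eq: "W S = W S'" and s0: "s0 \<in> S" "nonp s0"
  shows "S = S'"
proof -
  have "S \<subseteq> S'"
  proof
    fix u assume u: "u \<in> S"
    obtain u' where u': "u' \<in> S'" "overlap u u'" using X_overlap_ex[OF S(2) X_is_tile[OF S(1) u]] by blast
    obtain y where y: "y \<in> interior (fst u)" "y \<in> interior (fst u')" using u'(2) unfolding overlap_def by blast
    obtain y0 where y0: "y0 \<in> fst s0" using X_is_tile[OF S(1) s0(1)] unfolding is_tile_def by blast
    have "\<forall>m. \<exists>R. R \<in> X \<and> (W ^^ m) R = S" using Wn_surj[OF S(1)] by blast
    from choice[OF this] obtain R where R: "\<And>m. R m \<in> X" "\<And>m. (W ^^ m) (R m) = S" by blast
    have "\<forall>m. \<exists>R. R \<in> X \<and> (W ^^ m) R = S'" using Wn_surj[OF S(2)] by blast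
    from choice[OF this] obtain R' where R': "\<And>m. R' m \<in> X" "\<And>m. (W ^^ m) (R' m) = S'" by blast
    have agree: "(W ^^ N) (R m) = (W ^^ N) (R' m)" if "N \<ge> Suc m" for N m
      by (rule Wn_eq_mono[OF _ that]) (simp add: R(2) R'(2) eq)
    \<comment> \<open>From level L on pulling back does not increase distances, whence the levels n
      + L.\<close>
    obtain L where L: "\<And>l x. l \<ge> L \<Longrightarrow> norm x \<le> 1 * norm ((\<phi> ^^ l) x)"
      using expansive_funpow_lower_bound[OF expansive, of 1] by (simp only: zero_less_one) blast
    \<comment> \<open>The ancestors of u and u' share the pull-back \<beta> of y, which is within
      norm (y - y0) of a point of the common ancestor.\<close>
    define r where "r = radius + norm (y - y0)"
    let ?V = "\<Union>C\<in>\<A>. {t. \<exists>T\<in>X. C \<in> T \<and> t \<in> meeting T r}"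
    have fin: "finite ?V" by (intro finite_UN_I finite_prototiles finite_neighbours)
    have "\<exists>p. fst p \<in> \<A> \<times> ?V \<times> ?V \<and>
        tile_shift (snd p) (fst (snd (fst p))) \<in> R (n + L) \<and> u \<in> (W ^^ (n + L)) {tile_shift (snd p) (fst (snd (fst p)))} \<and>
        tile_shift (snd p) (snd (snd (fst p))) \<in> R' (n + L) \<and> u' \<in> (W ^^ (n + L)) {tile_shift (snd p) (snd (snd (fst p)))}" for n
    proof -
      let ?n = "n + L"
      have "s0 \<in> (W ^^ ?n) (R ?n)" using R(2) s0(1) by simp
      then obtain a where a: "a \<in> R ?n" "s0 \<in> (W ^^ ?n) {a}" "of_type \<A> a" using X_Wn_parent[OF R(1)] by blast
      have "nonp a" by (rule nonp_parent[OF a(3,2) s0(2)])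
      then have a': "a \<in> R' ?n" using nonp_part_determined[OF R(1) R'(1) agree[OF order_refl] a(1)] by blast
      have "u \<in> (W ^^ ?n) (R ?n)" using R(2) u by simp
      then obtain b where b: "b \<in> R ?n" "u \<in> (W ^^ ?n) {b}" "of_type \<A> b" using X_Wn_parent[OF R(1)] by blast
      have "u' \<in> (W ^^ ?n) (R' ?n)" using R'(2) u'(1) by simp
      then obtain b' where b': "b' \<in> R' ?n" "u' \<in> (W ^^ ?n) {b'}" "of_type \<A> b'" using X_Wn_parent[OF R'(1)] by blast
      obtain C x where C: "C \<in> \<A>" "a = tile_shift x C" using a(3) unfolding of_type_def by blast
      obtain \<alpha> where \<alpha>: "(\<phi> ^^ ?n) \<alpha> = y0" using surj_funpow by blast
      obtain \<beta> where \<beta>: "(\<phi> ^^ ?n) \<beta> = y" using surj_funpow by blast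
      have "\<alpha> \<in> fst a" using Wn_fst_mem[OF a(3,2), of \<alpha>] y0 \<alpha> by simp
      then have "norm (\<alpha> - x) \<le> radius" using prototile_norm_le[OF C(1)] by (simp add: C(2))
      moreover have "norm (\<beta> - \<alpha>) \<le> norm (y - y0)"
        using L[of ?n "\<beta> - \<alpha>"] by (simp add: phi_pow_diff \<alpha> \<beta>)
      ultimately have "norm (\<beta> - x) \<le> r"
        using norm_triangle_ineq[of "\<beta> - \<alpha>" "\<alpha> - x"] by (simp add: r_def)
      have \<beta>b: "\<beta> \<in> fst b" using Wn_interior_mem[OF b(3,2), of \<beta>] y(1) \<beta> interior_subset by auto
      have \<beta>b': "\<beta> \<in> fst b'" using Wn_interior_mem[OF b'(3,2), of \<beta>] y(2) \<beta> interior_subset by auto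
      have "tile_shift (- x) b \<in> meeting (shift (- x) (R ?n)) r"
        by (rule meetingI[of _ _ "\<beta> - x"]) (use b(1) \<beta>b \<open>norm (\<beta> - x) \<le> r\<close> in simp_all)
      moreover have "shift (- x) (R ?n) \<in> X" "C \<in> shift (- x) (R ?n)" using R(1) a(1) by (simp_all add: C(2))
      ultimately have bV: "tile_shift (- x) b \<in> ?V" using C(1) by blast
      have "tile_shift (- x) b' \<in> meeting (shift (- x) (R' ?n)) r"
        by (rule meetingI[of _ _ "\<beta> - x"]) (use b'(1) \<beta>b' \<open>norm (\<beta> - x) \<le> r\<close> in simp_all)
      moreover have "shift (- x) (R' ?n) \<in> X" "C \<in> shift (- x) (R' ?n)" using R'(1) a' by (simp_all add: C(2))
      ultimately have b'V: "tile_shift (- x) b' \<in> ?V" using C(1) by blast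
      let ?p = "((C, tile_shift (- x) b, tile_shift (- x) b'), x)"
      have "fst ?p \<in> \<A> \<times> ?V \<times> ?V" unfolding fst_conv by (intro SigmaI C(1) bV b'V)
      moreover have "tile_shift x (tile_shift (- x) b) = b" "tile_shift x (tile_shift (- x) b') = b'" by simp_all
      ultimately show ?thesis
        using b(1,2) b'(1,2) by (intro exI[of _ ?p]) (simp only: fst_conv snd_conv simp_thms)
    qed
    then have "\<forall>n. \<exists>p. fst p \<in> \<A> \<times> ?V \<times> ?V \<and>
        tile_shift (snd p) (fst (snd (fst p))) \<in> R (n + L) \<and> u \<in> (W ^^ (n + L)) {tile_shift (snd p) (fst (snd (fst p)))} \<and>
        tile_shift (snd p) (snd (snd (fst p))) \<in> R' (n + L) \<and> u' \<in> (W ^^ (n + L)) {tile_shift (snd p) (snd (snd (fst p)))}"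
      by (rule allI)
    from choice[OF this] obtain p where p: "\<forall>n. fst (p n) \<in> \<A> \<times> ?V \<times> ?V \<and>
        tile_shift (snd (p n)) (fst (snd (fst (p n)))) \<in> R (n + L) \<and> u \<in> (W ^^ (n + L)) {tile_shift (snd (p n)) (fst (snd (fst (p n))))} \<and>
        tile_shift (snd (p n)) (snd (snd (fst (p n)))) \<in> R' (n + L) \<and> u' \<in> (W ^^ (n + L)) {tile_shift (snd (p n)) (snd (snd (fst (p n))))}"
      by (rule exE)
    have "\<exists>h c. strict_mono (h :: nat \<Rightarrow> nat) \<and> (\<forall>n. fst (p (h n)) = c) \<and> c \<in> \<A> \<times> ?V \<times> ?V"
    proof (rule finite_range_const_subseq)
      show "finite (\<A> \<times> ?V \<times> ?V)" by (intro finite_cartesian_product finite_prototiles fin)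
      show "fst (p n) \<in> \<A> \<times> ?V \<times> ?V" for n using p by (rule allE) (erule conjunct1)
    qed
    then obtain h c where h: "strict_mono (h :: nat \<Rightarrow> nat)" "\<And>n. fst (p (h n)) = c"
      by (elim exE conjE) (rule that, assumption, erule spec)
    define b where "b = fst (snd c)"
    define b' where "b' = snd (snd c)"
    define x where "x n = snd (p (h n))" for n
    have B: "tile_shift (x n) b \<in> R (h n + L)" "u \<in> (W ^^ (h n + L)) {tile_shift (x n) b}"
      "tile_shift (x n) b' \<in> R' (h n + L)" "u' \<in> (W ^^ (h n + L)) {tile_shift (x n) b'}" for n
      using spec[OF p, of "h n"] unfolding h(2) b_def b'_def x_def by simp_all
    \<comment> \<open>At least one level apart, since \<open>R ?m\<close> and \<open>R' ?m\<close>
      agree only one substitution beyond level \<open>?m\<close>.\<close>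
    let ?m = "h 0 + L" and ?N = "h 1 + L" and ?w = "x 0 - x 1"
    have "h 0 < h 1" using h(1) by (simp add: strict_mono_def)
    then have N: "?N \<ge> Suc ?m" by simp
    let ?g = "(\<phi> ^^ ?N) ?w"
    have "tile_shift ?g u \<in> (W ^^ ?N) {tile_shift (x 0) b}"
      using mem_Wn_tile_shift[OF B(2)[of 1], of ?w] by simp
    then have gu: "tile_shift ?g u \<in> (W ^^ ?N) (R ?m)" by (rule mem_WnI[OF B(1)])
    have "tile_shift ?g u' \<in> (W ^^ ?N) {tile_shift (x 0) b'}"
      using mem_Wn_tile_shift[OF B(4)[of 1], of ?w] by simp
    then have "tile_shift ?g u' \<in> (W ^^ ?N) (R' ?m)" by (rule mem_WnI[OF B(3)])
    then have gu': "tile_shift ?g u' \<in> (W ^^ ?N) (R ?m)" unfolding agree[OF N] .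
    have "overlap (tile_shift ?g u) (tile_shift ?g u')" using u'(2) by (simp only: overlap_shift)
    from X_unique[OF X_Wn[OF R(1)] gu gu' this] have "u = u'" by (simp only: tile_shift_inj_iff)
    then show "u \<in> S'" using u'(1) by simp
  qed
  then show ?thesis by (rule tiling_subset_eq[OF X_tiling[OF S(1)] X_tiling[OF S(2)]])
qed

end

theorem theorem4p4:
  fixes \<A> :: "('d::finite, 'l::finite) tile set"
    and \<phi> :: "real ^ 'd \<Rightarrow> real ^ 'd"
    and \<omega> :: "('d, 'l) tile \<Rightarrow> ('d, 'l) tile set"
  assumes "tile_substitution \<A> \<phi> \<omega>"
    and "admissible \<A> \<phi> \<omega>"
    and "FPC \<A> \<phi> \<omega>"
    and "nonperiodic_border_condition \<A> \<phi> \<omega>"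
  shows "partially_recognizable \<A> \<phi> \<omega>"
proof -
  interpret border_subst \<A> \<phi> \<omega>
    using assms by unfold_locales
  show ?thesis
    unfolding partially_recognizable_def
  proof (intro ballI impI)
    fix T assume T: "T \<in> X" and "\<exists>t\<in>T. nonp t"
    then obtain t where t: "t \<in> T" "nonp t" by blast
    obtain S where S: "S \<in> X" "W S = T" using W_surj[OF T] by blast
    have "t \<in> (W ^^ 1) S" using t(1) S(2) by simp
    then obtain s where s: "s \<in> S" "t \<in> (W ^^ 1) {s}" "of_type \<A> s" using X_Wn_parent[OF S(1)] by blast
    have "nonp s" by (rule nonp_parent[OF s(3,2) t(2)])
    show "\<exists>!T'. T' \<in> X \<and> W T' = T"
    proof (rule ex1I[of _ S])
      show "S \<in> X \<and> W S = T" using S by (rule conjI)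
      fix S' assume S': "S' \<in> X \<and> W S' = T"
      have "W S = W S'" using S' S(2) by simp
      from W_inj_on_nonp[OF S(1) conjunct1[OF S'] this s(1) \<open>nonp s\<close>] show "S' = S" by (rule sym)
    qed
  qed
qed

end
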